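(* Let $G\in\mathbb{C}[x_0,x_1,x_2]$ be homogeneous of degree $n\ge 2$ defining a smooth projective plane curve $X\subset\mathbb{P}^2$, let $G_i=\partial G/\partial x_i$, and let $U_0,U_1,U_2\in\mathbb{C}[x_0,x_1,x_2]$ be homogeneous with $\deg U_0=\deg U_2=2n-3$, $\deg U_1=n-3$, such that $$U_0U_1=\sum_{i=0}^2R_i^{(01)}G_i,\qquad U_1U_2=\sum_{i=0}^2R_i^{(12)}G_i$$ with $R_i^{(01)},R_i^{(12)}$ homogeneous of degree $2n-5$. Let $w_i=[W_i]$ be the classes corresponding to $U_i$, $i=0,1,2$, and let $\langle w_0,w_1,w_2\rangle_{A_X}\in\mathbb{C}$ be the Massey triple product relative to the defining system $A_X=\{W_0,W_1,W_2,W_{01},W_{12}\}$ determined by these data (see context). Then $$\langle w_0,w_1,w_2\rangle_{A_X}=R_{\deg G\cdot(A-B)},$$ where $$A=U_0x_1R_0^{(12)}G_0G_1+U_2x_0R_2^{(01)}G_0G_2+U_0x_0R_0^{(12)}G_0^2,$$ $$B=A_0^{(01)}U_2G_1G_2+U_0A_1^{(12)}G_0G_2+U_0U_1U_2x_0G_0,$$ with $A_0^{(01)}=x_1R_2^{(01)}-x_2R_1^{(01)}$, $A_1^{(12)}=-x_0R_2^{(12)}+x_2R_0^{(12)}$, and where for $F\in\mathbb{C}[x_0,x_1,x_2]_{6n-9}$ the number $R_F\in\mathbb{C}$ is the unique scalar with $F-R_F\,\mathrm{Det}_G\in\langle G_0^2,G_1^2,G_2^2\rangle$, $\mathrm{Det}_G=\det\big(\partial(G_i^2)/\partial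 x_j\big)_{i,j}$.
   Context: The zero polynomial counts as homogeneous of every degree, and it is the only homogeneous polynomial of negative degree; $\mathbb{C}[x_0,x_1,x_2]_m$ is the space of homogeneous polynomials of degree $m$. Let $\mathcal{U}_i=\{x\in\mathbb{P}^2:G_i(x)\ne0\}$; since $X$ is smooth, $\mathcal{U}=\{\mathcal{U}_0,\mathcal{U}_1,\mathcal{U}_2\}$ covers $\mathbb{P}^2$. Put $G_{ij}=G_iG_j$, $G_{012}=G_0G_1G_2$. Čech–de Rham complex: $\mathcal{C}^p_q=\mathcal{C}^q(\mathcal{U}|_X,\Omega_X^p)$ with total differential $D=d+(-1)^p\delta$ on $\mathcal{C}^p_q$, $(\delta\varphi)_{ij}=\varphi_j-\varphi_i$, $(\delta\varphi)_{012}=\varphi_{12}-\varphi_{02}+\varphi_{01}$. For $\alpha\in\mathcal{C}^p_q$, $\beta\in\mathcal{C}^r_s$: $(\alpha\wedge\beta)_{i_0\cdots i_{q+s}}=\alpha_{i_0\cdots i_q}\wedge\beta_{i_q\cdots i_{q+s}}$, $\alpha\bullet\beta=(-1)^{qr}\alpha\wedge\beta$. $\Omega=x_0dx_1\wedge dx_2-x_1dx_0\wedge dx_2+x_2dx_0\wedge dx_1$; $\Omega_i=K_i\Omega$, $\Omega_{ij}=K_jK_i\Omega$, $K_j$ being contraction with $\partial/\partial x_j$; explicitly $\Omega_0=x_2dx_1-x_1dx_2$, $\Omega_1=x_0dx_2-x_2dx_0$, $\Omega_2=x_1dx_0-x_0dx_1$, $\Omega_{01}=x_2$, $\Omega_{02}=-x_1$,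 $\Omega_{12}=x_0$. Cochains on $X$: for $k=0,2$, $W_k\in\mathcal{C}^0_1$ has components $\frac{U_k}{G_{ij}}\Omega_{ij}$ on $\mathcal{U}_i\cap\mathcal{U}_j\cap X$ ($i<j$), with class $w_k\in H^1(X,\mathcal{O}_X)$; $W_1\in\mathcal{C}^1_0$ has components $\frac{U_1}{G_i}\Omega_i$, with class $w_1\in H^0(X,\Omega_X^1)$. For $(k\ell)=(01),(12)$ put $A_0^{(k\ell)}=x_1R_2^{(k\ell)}-x_2R_1^{(k\ell)}$, $A_1^{(k\ell)}=-x_0R_2^{(k\ell)}+x_2R_0^{(k\ell)}$, $A_2^{(k\ell)}=x_0R_1^{(k\ell)}-x_1R_0^{(k\ell)}$. Let $W_{01}\in\mathcal{C}^1_0$ have components $\frac{A_i^{(01)}}{G_i^2}\Omega_i$ and $W_{12}\in\mathcal{C}^1_0$ have components $-\frac{A_i^{(12)}}{G_i^2}\Omega_i$ on $\mathcal{U}_i\cap X$; these satisfy $D(W_{01})=W_0\bullet W_1$, $D(W_{12})=W_1\bullet W_2$. Massey product: $W_{01}\bullet W_2+W_0\bullet W_{12}\in\mathcal{C}^1_1$ is a cocycle with class in $H^1(\mathcal{U}|_X,\Omega_X^1)$, and $$\langle w_0,w_1,w_2\rangle_{A_X}:=\mathrm{Res}_0\big(\tilde\delta[W_{01}\bullet W_2+W_0\bullet W_{12}]\big)\in\mathbb{C}.$$ Here (all forms being algebraic) $\tilde\delta:H^1(\mathcal{U}|_X,\Omega^1_X)\to H^2(\mathbb{P}^2,\Omega^2_{\mathbb{P}^2})$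 is the connecting map of the Poincaré residue sequence $0\to\Omega^2_{\mathbb{P}^2}\to\Omega^2_{\mathbb{P}^2}(\log X)\to\Omega^1_X\to0$, with the residue normalized so that $\omega\wedge\frac{dg}{g}\mapsto\omega|_X$ for $g$ a local equation of $X$: choose a lift $\tilde\varphi\in\mathcal{C}^1(\mathcal{U},\Omega^2_{\mathbb{P}^2}(\log X))$ of a cocycle $\varphi$, and set $\tilde\delta[\varphi]=[\delta\tilde\varphi]$. The Grothendieck residue $\mathrm{Res}_0:H^2(\mathbb{P}^2,\Omega^2_{\mathbb{P}^2})\to\mathbb{C}$ is the isomorphism normalized by: the class of the 2-cocycle $\frac{F}{G_{012}^2}\Omega$ on $\mathcal{U}_0\cap\mathcal{U}_1\cap\mathcal{U}_2$, with $F\in\mathbb{C}[x_0,x_1,x_2]_{6n-9}$, is sent to $R_F$. (Every class has such a representative, $\mathrm{Det}_G\notin\langle G_0^2,G_1^2,G_2^2\rangle$, and $R_F$ exists and is unique because $(\mathbb{C}[x_0,x_1,x_2]/\langle G_0^2,G_1^2,G_2^2\rangle)_{6n-9}\cong\mathbb{C}$.) *)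

theory Defs
  imports
    "HOL-Analysis.Analysis"
    "HOL-Library.Poly_Mapping"
    "HOL-Library.Function_Algebras"
    "HOL-Computational_Algebra.Fraction_Field"
begin

section \<open>Polynomials and rational functions in three variables\<close>

text \<open>
  The three variables are indexed by the type \<open>3\<close>, whose elements are \<open>0 < 1 < 2\<close>.
\<close>

type_synonym cpoly = "(3 \<Rightarrow>\<^sub>0 nat) \<Rightarrow>\<^sub>0 complex"
type_synonym ratfun = "cpoly fract"

definition xv :: "3 \<Rightarrow> cpoly" where
  "xv i = Poly_Mapping.single (Poly_Mapping.single i 1) 1"

definition const :: "complex \<Rightarrow> cpoly" where
  "const c = Poly_Mapping.single 0 c"

definition eval :: "cpoly \<Rightarrow> complex ^ 3 \<Rightarrow> complex" where
  "eval P x = (\<Sum>m\<in>Poly_Mapping.keys P.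
     Poly_Mapping.lookup P m * (\<Prod>i\<in>UNIV. x $ i ^ Poly_Mapping.lookup m i))"

definition pd :: "cpoly \<Rightarrow> 3 \<Rightarrow> cpoly" where
  "pd P i = (\<Sum>m\<in>Poly_Mapping.keys P.
     Poly_Mapping.single (m - Poly_Mapping.single i 1)
       (of_nat (Poly_Mapping.lookup m i) * Poly_Mapping.lookup P m))"

text \<open>
  Degrees are integers: \<open>0\<close> is homogeneous of every degree, and is the only homogeneous
  polynomial of negative degree.
\<close>

definition homog :: "int \<Rightarrow> cpoly \<Rightarrow> bool" where
  "homog d P \<longleftrightarrow> (\<forall>m\<in>Poly_Mapping.keys P. int (\<Sum>i\<in>UNIV. Poly_Mapping.lookup m i) = d)"

definition smooth_curve :: "cpoly \<Rightarrow> bool" where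
  "smooth_curve G \<longleftrightarrow> (\<forall>x. x \<noteq> 0 \<longrightarrow> eval G x = 0 \<longrightarrow> (\<exists>i. eval (pd G i) x \<noteq> 0))"

definition emb :: "cpoly \<Rightarrow> ratfun" where
  "emb P = Fraction_Field.Fract P 1"

section \<open>Rational differential forms on affine three-space\<close>

text \<open>
  The coefficient of \<open>dx\<^sub>a \<and> dx\<^sub>b \<and> \<dots>\<close> with \<open>a < b < \<dots>\<close> is stored at the index set \<open>{a, b, \<dots>}\<close>.
\<close>

type_synonym form = "(ratfun, 3 set) vec"

definition dx :: "3 \<Rightarrow> form" where
  "dx i = axis {i} 1"

definition wedge :: "form \<Rightarrow> form \<Rightarrow> form" where
  "wedge \<alpha> \<beta> = (\<chi> S. \<Sum>T\<in>Pow S.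
     (-1) ^ card {(a, b). a \<in> T \<and> b \<in> S - T \<and> b < a} * (\<alpha> $ T) * (\<beta> $ (S - T)))"

definition contract :: "ratfun ^ 3 \<Rightarrow> form \<Rightarrow> form" where
  "contract v \<alpha> = (\<chi> S. \<Sum>j\<in>- S. (-1) ^ card {k\<in>S. k < j} * (v $ j) * (\<alpha> $ insert j S))"

definition euler :: "ratfun ^ 3" where
  "euler = (\<chi> j. emb (xv j))"

definition K_op :: "3 \<Rightarrow> form \<Rightarrow> form" where
  "K_op j = contract (axis j 1)"

definition dpoly :: "cpoly \<Rightarrow> form" where
  "dpoly P = (\<Sum>j\<in>UNIV. emb (pd P j) *s dx j)"

definition Omega_vol :: form where
  "Omega_vol = emb (xv 0) *s wedge (dx 1) (dx 2) - emb (xv 1) *s wedge (dx 0) (dx 2)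
     + emb (xv 2) *s wedge (dx 0) (dx 1)"

section \<open>Sections over the cover\<close>

text \<open>
  For a nonempty set of indices \<open>I\<close>, let \<open>U\<^sub>I\<close> be the intersection of the sets \<open>G\<^sub>i \<noteq> 0\<close>, \<open>i \<in> I\<close>.
  This is the affine open set \<open>D\<^sub>+(G\<^sub>I)\<close> with \<open>G\<^sub>I\<close> the product of the \<open>G\<^sub>i\<close>, a polynomial of degree
  \<open>card I * (n - 1)\<close>. The regular functions of degree \<open>d\<close> on the cone over \<open>U\<^sub>I\<close> form the degree \<open>d\<close>
  part of the localization of the polynomial ring at \<open>G\<^sub>I\<close>; each \<open>dx\<^sub>j\<close> has degree one.
\<close>

definition reg_fun :: "nat \<Rightarrow> cpoly \<Rightarrow> 3 set \<Rightarrow> int \<Rightarrow> ratfun set" where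
  "reg_fun n G I d = {emb P / emb (\<Prod>i\<in>I. pd G i) ^ k | P k.
     homog (d + int k * int (card I) * (int n - 1)) P}"

definition cone_forms :: "nat \<Rightarrow> cpoly \<Rightarrow> nat \<Rightarrow> int \<Rightarrow> 3 set \<Rightarrow> form set" where
  "cone_forms n G p d I = {\<alpha>. \<forall>S. if card S = p then \<alpha> $ S \<in> reg_fun n G I (d - int p) else \<alpha> $ S = 0}"

text \<open>
  By the Euler sequence, the sections of \<open>\<Omega>\<^sup>p\<close> of the projective plane over \<open>U\<^sub>I\<close> are the regular
  \<open>p\<close>-forms of degree zero on the cone that are killed by contraction with the Euler field.
\<close>

definition Omega_P2 :: "nat \<Rightarrow> cpoly \<Rightarrow> nat \<Rightarrow> 3 set \<Rightarrow> form set" where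
  "Omega_P2 n G p I = {\<alpha> \<in> cone_forms n G p 0 I. contract euler \<alpha> = 0}"

text \<open>
  The forms on \<open>U\<^sub>I\<close> whose restriction to \<open>X\<close> is zero. The kernel of \<open>\<Omega>\<^sup>p \<rightarrow> \<Omega>\<^sup>p\<^sub>X\<close> on the plane is
  generated by \<open>g\<close> and \<open>dg\<close> for local equations \<open>g = G / h\<close>, with \<open>h\<close> invertible of degree \<open>n\<close>; in
  homogeneous terms it consists of the sections of the form \<open>G \<alpha> + dG \<and> \<beta>\<close> with \<open>\<alpha>\<close>, \<open>\<beta>\<close> regular of
  degree \<open>-n\<close> on the cone. Since \<open>U\<^sub>I\<close> is affine, the quotient of \<^const>\<open>Omega_P2\<close> by this subspace is
  the space of sections of \<open>\<Omega>\<^sup>p\<^sub>X\<close> over the trace of \<open>U\<^sub>I\<close> on \<open>X\<close>. Below, sections on \<open>X\<close> are given by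
  representatives in \<^const>\<open>Omega_P2\<close>. (For \<open>p = 0\<close> the term with \<open>\<beta>\<close> is necessarily zero.)
\<close>

definition zero_on_X :: "nat \<Rightarrow> cpoly \<Rightarrow> nat \<Rightarrow> 3 set \<Rightarrow> form set" where
  "zero_on_X n G p I = {\<omega> \<in> Omega_P2 n G p I.
     \<exists>\<alpha>\<in>cone_forms n G p (- int n) I. \<exists>\<beta>\<in>cone_forms n G (p - 1) (- int n) I.
       \<omega> = emb G *s \<alpha> + wedge (dpoly G) \<beta>}"

text \<open>
  Logarithmic two-forms and the Poincare residue, normalized by \<open>\<omega> \<and> dg/g \<mapsto> \<omega>|\<^sub>X\<close>. For a local
  equation \<open>g = G / h\<close> we have \<open>dg/g = dG/G - dh/h\<close>, and \<open>dh/h\<close> is regular on the cone. Hence the form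
  is written as \<open>\<alpha> \<and> dG/G + \<beta>\<close>, where \<open>\<beta>\<close> is regular on the cone but need not come from the plane,
  although the sum does.
\<close>

definition log_decomp :: "nat \<Rightarrow> cpoly \<Rightarrow> 3 set \<Rightarrow> form \<Rightarrow> form \<Rightarrow> bool" where
  "log_decomp n G I \<omega> \<alpha> \<longleftrightarrow> contract euler \<omega> = 0 \<and> \<alpha> \<in> Omega_P2 n G 1 I \<and>
     (\<exists>\<beta>\<in>cone_forms n G 2 0 I. \<omega> = wedge \<alpha> ((1 / emb G) *s dpoly G) + \<beta>)"

definition Omega2_log :: "nat \<Rightarrow> cpoly \<Rightarrow> 3 set \<Rightarrow> form set" where
  "Omega2_log n G I = {\<omega>. \<exists>\<alpha>. log_decomp n G I \<omega> \<alpha>}"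

definition has_residue :: "nat \<Rightarrow> cpoly \<Rightarrow> 3 set \<Rightarrow> form \<Rightarrow> form \<Rightarrow> bool" where
  "has_residue n G I \<omega> \<phi> \<longleftrightarrow> (\<exists>\<alpha>. log_decomp n G I \<omega> \<alpha> \<and> \<alpha> - \<phi> \<in> zero_on_X n G 1 I)"

section \<open>Cech cochains\<close>

text \<open>Cochains have components only at strictly increasing index tuples, and are \<open>0\<close> elsewhere.\<close>

type_synonym cochain = "3 list \<Rightarrow> form"

definition idx :: "nat \<Rightarrow> 3 list set" where
  "idx q = {s. length s = q + 1 \<and> sorted_wrt (<) s}"

definition cochains :: "nat \<Rightarrow> (3 set \<Rightarrow> form set) \<Rightarrow> cochain set" where
  "cochains q S = {\<phi>. \<forall>s. if s \<in> idx q then \<phi> s \<in> S (set s) else \<phi> s = 0}"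

text \<open>The coboundary from \<open>q\<close>-cochains to \<open>(q + 1)\<close>-cochains.\<close>

definition cech_d :: "nat \<Rightarrow> cochain \<Rightarrow> cochain" where
  "cech_d q \<phi> = (\<lambda>s. if s \<in> idx (q + 1)
     then \<Sum>k<length s. (-1) ^ k *s \<phi> (take k s @ drop (k + 1) s) else 0)"

text \<open>
  The product \<open>\<alpha> \<bullet> \<beta>\<close> for a \<open>q\<close>-cochain \<open>\<alpha>\<close> of \<open>p\<close>-forms and an \<open>s\<close>-cochain \<open>\<beta>\<close> of \<open>r\<close>-forms; the
  sign does not depend on \<open>p\<close>.
\<close>

definition bullet :: "nat \<Rightarrow> nat \<times> nat \<Rightarrow> cochain \<Rightarrow> cochain \<Rightarrow> cochain" where
  "bullet q = (\<lambda>(r, s) \<alpha> \<beta> t. if t \<in> idx (q + s)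
     then (-1) ^ (q * r) *s wedge (\<alpha> (take (q + 1) t)) (\<beta> (drop q t)) else 0)"

text \<open>
  The class of \<open>\<phi>\<close> in degree \<open>q \<ge> 1\<close>, with coefficients in the quotient of \<open>S\<close> by \<open>N\<close>, as the set of
  all its representing cochains in \<open>S\<close>.
\<close>

definition cech_class ::
    "nat \<Rightarrow> (3 set \<Rightarrow> form set) \<Rightarrow> (3 set \<Rightarrow> form set) \<Rightarrow> cochain \<Rightarrow> cochain set" where
  "cech_class q S N \<phi> = {\<phi>' \<in> cochains q S.
     \<exists>\<psi>\<in>cochains (q - 1) S. \<phi>' - \<phi> - cech_d (q - 1) \<psi> \<in> cochains q N}"

definition H1_X :: "nat \<Rightarrow> cpoly \<Rightarrow> cochain \<Rightarrow> cochain set" where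
  "H1_X n G = cech_class 1 (Omega_P2 n G 1) (zero_on_X n G 1)"

definition H2_P2 :: "nat \<Rightarrow> cpoly \<Rightarrow> cochain \<Rightarrow> cochain set" where
  "H2_P2 n G = cech_class 2 (Omega_P2 n G 2) (\<lambda>_. {0})"

definition connecting :: "nat \<Rightarrow> cpoly \<Rightarrow> cochain set \<Rightarrow> cochain set" where
  "connecting n G c = (THE e. \<exists>\<phi>\<in>c. \<exists>\<phi>'\<in>cochains 1 (Omega2_log n G).
     (\<forall>s\<in>idx 1. has_residue n G (set s) (\<phi>' s) (\<phi> s)) \<and> e = H2_P2 n G (cech_d 1 \<phi>'))"

section \<open>The Grothendieck residue\<close>

definition Det_G :: "cpoly \<Rightarrow> cpoly" where
  "Det_G G = det (\<chi> i j. pd ((pd G i)\<^sup>2) j)"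

definition R_num :: "cpoly \<Rightarrow> cpoly \<Rightarrow> complex" where
  "R_num G F = (THE r. \<exists>a :: 3 \<Rightarrow> cpoly. F - const r * Det_G G = (\<Sum>i\<in>UNIV. a i * (pd G i)\<^sup>2))"

definition top_cochain :: "cpoly \<Rightarrow> cpoly \<Rightarrow> cochain" where
  "top_cochain G F = (\<lambda>s. if s \<in> idx 2
     then (emb F / emb (pd G 0 * pd G 1 * pd G 2) ^ 2) *s Omega_vol else 0)"

definition Res0 :: "nat \<Rightarrow> cpoly \<Rightarrow> cochain set \<Rightarrow> complex" where
  "Res0 n G c = (THE r. \<exists>F. homog (6 * int n - 9) F \<and> c = H2_P2 n G (top_cochain G F) \<and> r = R_num G F)"

section \<open>The defining system and the Massey product\<close>

definition W_0form :: "cpoly \<Rightarrow> cpoly \<Rightarrow> cochain" where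
  "W_0form G U = (\<lambda>s. if s \<in> idx 1
     then (emb U / emb (pd G (s ! 0) * pd G (s ! 1))) *s K_op (s ! 1) (K_op (s ! 0) Omega_vol) else 0)"

definition W_1form :: "cpoly \<Rightarrow> cpoly \<Rightarrow> cochain" where
  "W_1form G U = (\<lambda>s. if s \<in> idx 0
     then (emb U / emb (pd G (s ! 0))) *s K_op (s ! 0) Omega_vol else 0)"

definition A_coef :: "(3 \<Rightarrow> cpoly) \<Rightarrow> 3 \<Rightarrow> cpoly" where
  "A_coef R i =
    (if i = 0 then xv 1 * R 2 - xv 2 * R 1
     else if i = 1 then - xv 0 * R 2 + xv 2 * R 0
     else xv 0 * R 1 - xv 1 * R 0)"

definition W_kl :: "cpoly \<Rightarrow> (3 \<Rightarrow> cpoly) \<Rightarrow> cochain" where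
  "W_kl G R = (\<lambda>s. if s \<in> idx 0
     then (emb (A_coef R (s ! 0)) / emb (pd G (s ! 0)) ^ 2) *s K_op (s ! 0) Omega_vol else 0)"

text \<open>
  The arguments are the members of the defining system \<open>W\<^sub>0, W\<^sub>1, W\<^sub>2, W\<^sub>0\<^sub>1, W\<^sub>1\<^sub>2\<close>. The value does
  not involve \<open>W\<^sub>1\<close>, which enters only through the relations satisfied by \<open>W\<^sub>0\<^sub>1\<close> and \<open>W\<^sub>1\<^sub>2\<close>.
\<close>

definition massey ::
    "nat \<Rightarrow> cpoly \<Rightarrow> cochain \<Rightarrow> cochain \<Rightarrow> cochain \<Rightarrow> cochain \<Rightarrow> cochain \<Rightarrow> complex" where
  "massey n G W0 W1 W2 W01 W12 =
     Res0 n G (connecting n G (H1_X n G (bullet 0 (0, 1) W01 W2 + bullet 1 (1, 0) W0 W12)))"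

end

theory Submission
  imports Defs "HOL-Computational_Algebra.Fundamental_Theorem_Algebra"
begin

text \<open>
  A residue form \<open>c \<Omega>\<^sub>i\<close> lifts to the logarithmic form \<open>- (c G\<^sub>i / G) \<Omega>\<close>, because
  \<open>\<Omega>\<^sub>i \<and> dG = n G K\<^sub>i vol - G\<^sub>i \<Omega>\<close>. Lifting the Massey cochain in this way, its coboundary is a multiple of
  \<open>\<Omega>\<close>; Euler's relation and the two relations \<open>U\<^sub>0 U\<^sub>1 = \<Sum> R\<^sub>i G\<^sub>i\<close>, \<open>U\<^sub>1 U\<^sub>2 = \<Sum> R\<^sub>i G\<^sub>i\<close> cancel the
  pole along \<open>G\<close>, and the coboundary equals \<open>n (A - B) \<Omega> / (G\<^sub>0 G\<^sub>1 G\<^sub>2)\<^sup>2\<close> as a cochain.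

  That the residue of the class does not depend on the representative needs
  \<open>F (G\<^sub>0 G\<^sub>1 G\<^sub>2)\<^sup>m \<in> (G\<^sub>0\<^sup>2\<^sup>+\<^sup>m, G\<^sub>1\<^sup>2\<^sup>+\<^sup>m, G\<^sub>2\<^sup>2\<^sup>+\<^sup>m) \<Longrightarrow> F \<in> (G\<^sub>0\<^sup>2, G\<^sub>1\<^sup>2, G\<^sub>2\<^sup>2)\<close>, that is, that powers of the
  \<open>G\<^sub>i\<close> form regular sequences. By the Nullstellensatz the ideal they generate contains powers of the
  variables; these form a regular sequence of length three, which forces the Koszul complex on three
  generators to be exact.
\<close>

text \<open>Classes are sets of representatives, and \<open>connecting\<close>, \<open>Res0\<close>
  and \<open>R_num\<close> are definite descriptions, so the explicit cochain identity must be
  complemented by uniqueness: the connecting map may depend neither on the representative nor on the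
  lift, and a class must determine F modulo the ideal of the squares. The second point is the
  obstacle. The cochains bounded out may have poles of any order along the G_i, so arbitrary powers
  of the G_i have to be cancelled. The Nullstellensatz rests on the uncountability of the complex
  numbers. Modulo an ideal maximal among those avoiding the powers of x_i, every x_j becomes a
  constant multiple of x_i, and the constants are the coordinates of a point of the projective plane
  off the line x_i = 0. The factor deg G comes from Euler's relation: the lift puts one G into the
  denominator, the numerator of its coboundary is a multiple of x_0 G_0 + x_1 G_1 + x_2 G_2 = n G,
  and cancelling G leaves n.\<close>

section \<open>Exactness of the Koszul complex\<close>

text \<open>
  Multiplication by an element of the ideal \<open>(a, b, c)\<close> is null-homotopic on the Koszul complex of
  \<open>a, b, c\<close>. Hence each \<open>y\<^sub>i\<close> pushes a cycle one step up the complex taken modulo the previous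
  \<open>y\<^sub>i\<close>, until it reaches the last term, where regularity applies. Below, \<open>p, q, s\<close> are the
  coordinates of the resulting two-chain and \<open>w\<close> that of the three-chain.
\<close>

lemma koszul_exact:
  fixes a b c f g h :: "'a::comm_ring_1"
  assumes y0: "y0 = r0 * a + r1 * b + r2 * c"
    and y1: "y1 = s0 * a + s1 * b + s2 * c"
    and y2: "y2 = t0 * a + t1 * b + t2 * c"
    and reg0: "\<And>f. y0 * f = 0 \<Longrightarrow> f = 0"
    and reg1: "\<And>f g. y1 * f = y0 * g \<Longrightarrow> \<exists>u. f = y0 * u"
    and reg2: "\<And>f g h. y2 * f = y0 * g + y1 * h \<Longrightarrow> \<exists>u v. f = y0 * u + y1 * v"
    and cycle: "f * a + g * b + h * c = 0"
  shows "\<exists>u v. f = u * b + v * c"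
proof -
  define p q s where "p = r1 * f - r0 * g" and "q = r2 * f - r0 * h" and "s = r2 * g - r1 * h"
  have f: "y0 * f = b * p + c * q"
  proof -
    have "y0 * f - (b * p + c * q) = r0 * (f * a + g * b + h * c)"
      by (simp add: y0 p_def q_def algebra_simps)
    then show ?thesis using cycle by simp
  qed
  have g: "y0 * g = c * s - a * p"
  proof -
    have "y0 * g - (c * s - a * p) = r1 * (f * a + g * b + h * c)"
      by (simp add: y0 p_def s_def algebra_simps)
    then show ?thesis using cycle by simp
  qed
  have h: "y0 * h = - (a * q) - b * s"
  proof -
    have "y0 * h - (- (a * q) - b * s) = r2 * (f * a + g * b + h * c)"
      by (simp add: y0 q_def s_def algebra_simps)
    then show ?thesis using cycle by simp
  qed
  define w where "w = s2 * p - s1 * q + s0 * s"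
  \<comment> \<open>The next three identities are the homotopy formula for y1 on two-chains: y1
    times the chain (p, q, s) is the boundary of w plus the homotopy applied to the boundary of (p,
    q, s), which is y0 times the given cycle.\<close>
  have cw: "c * w = y1 * p - y0 * (s1 * f - s0 * g)"
  proof -
    have "y0 * (s1 * f - s0 * g) = s1 * (y0 * f) - s0 * (y0 * g)" by (simp add: algebra_simps)
    then show ?thesis unfolding f g by (simp add: w_def y1 algebra_simps)
  qed
  have bw: "b * w = y0 * (s2 * f - s0 * h) - y1 * q"
  proof -
    have "y0 * (s2 * f - s0 * h) = s2 * (y0 * f) - s0 * (y0 * h)" by (simp add: algebra_simps)
    then show ?thesis unfolding f h by (simp add: w_def y1 algebra_simps)
  qed
  have aw: "a * w = y1 * s - y0 * (s2 * g - s1 * h)"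
  proof -
    have "y0 * (s2 * g - s1 * h) = s2 * (y0 * g) - s1 * (y0 * h)" by (simp add: algebra_simps)
    then show ?thesis unfolding g h by (simp add: w_def y1 algebra_simps)
  qed
  have "y2 * w = t0 * (a * w) + t1 * (b * w) + t2 * (c * w)"
    by (simp add: y2 algebra_simps)
  also have "\<dots> = y0 * (- t0 * (s2 * g - s1 * h) + t1 * (s2 * f - s0 * h) - t2 * (s1 * f - s0 * g))
      + y1 * (t0 * s - t1 * q + t2 * p)"
    unfolding aw bw cw by (simp add: algebra_simps)
  finally obtain u v where w: "w = y0 * u + y1 * v" using reg2 by blast
  \<comment> \<open>The boundary of v times the generator of the three-chains is removed from the
    two-chain; what remains is divisible by y0, so y0 can be cancelled from the formula for y0
    f.\<close>
  have "y1 * (p - c * v) = y0 * (c * u + (s1 * f - s0 * g))"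
    using cw by (simp add: w algebra_simps)
  then obtain p' where p': "p - c * v = y0 * p'" using reg1 by blast
  have "y1 * (q + b * v) = y0 * (s2 * f - s0 * h - b * u)"
    using bw by (simp add: w algebra_simps)
  then obtain q' where q': "q + b * v = y0 * q'" using reg1 by blast
  have "y0 * f = b * (p - c * v) + c * (q + b * v)"
    using f by (simp add: algebra_simps)
  also have "\<dots> = y0 * (b * p' + c * q')" unfolding p' q' by (simp add: algebra_simps)
  finally have "y0 * (f - (b * p' + c * q')) = 0" by (simp add: algebra_simps)
  then have "f - (b * p' + c * q') = 0" by (rule reg0)
  then have "f = p' * b + q' * c" by (simp add: algebra_simps)
  then show ?thesis by blast
qed

section \<open>Ideals maximal among those avoiding the powers of an element\<close>

definition is_ideal :: "'a::comm_ring_1 set \<Rightarrow> bool" where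
  "is_ideal J \<longleftrightarrow> 0 \<in> J \<and> (\<forall>p\<in>J. \<forall>q\<in>J. p + q \<in> J) \<and> (\<forall>p\<in>J. \<forall>r. r * p \<in> J)"

lemma is_idealD:
  assumes "is_ideal J"
  shows "0 \<in> J" "p \<in> J \<Longrightarrow> q \<in> J \<Longrightarrow> p + q \<in> J" "p \<in> J \<Longrightarrow> r * p \<in> J" "p \<in> J \<Longrightarrow> p * r \<in> J"
    "p \<in> J \<Longrightarrow> - p \<in> J" "p \<in> J \<Longrightarrow> q \<in> J \<Longrightarrow> p - q \<in> J"
proof -
  show *: "0 \<in> J" "p \<in> J \<Longrightarrow> q \<in> J \<Longrightarrow> p + q \<in> J" "p \<in> J \<Longrightarrow> r * p \<in> J" for p q r
    using assms by (auto simp: is_ideal_def)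
  show "p \<in> J \<Longrightarrow> p * r \<in> J" using *(3)[of p r] by (simp add: mult.commute)
  show m: "p \<in> J \<Longrightarrow> - p \<in> J" for p using *(3)[of p "-1"] by simp
  show "p \<in> J \<Longrightarrow> q \<in> J \<Longrightarrow> p - q \<in> J" using *(2)[of p "-q"] m by simp
qed

lemma is_ideal_sum:
  assumes "is_ideal J" "\<And>i. i \<in> A \<Longrightarrow> f i \<in> J"
  shows "sum f A \<in> J"
  using assms(2) by (induction A rule: infinite_finite_induct) (auto simp: is_idealD[OF assms(1)])

text \<open>Zorn's lemma gives an ideal J maximal among those containing I but no power of x. It
  corresponds to a maximal ideal of the localization at x, which is why every p outside J is
  invertible modulo J up to a power of x, and why J is prime.\<close>

lemma ideal_avoiding_powers:
  fixes x :: "'a::comm_ring_1"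
  assumes "is_ideal I" and "\<And>k. x ^ k \<notin> I"
  obtains J where "is_ideal J" "I \<subseteq> J" "\<And>k. x ^ k \<notin> J"
    "\<And>p. p \<notin> J \<Longrightarrow> \<exists>q k. x ^ k - p * q \<in> J"
    "\<And>p q. p * q \<in> J \<Longrightarrow> p \<in> J \<or> q \<in> J"
proof -
  define A where "A = {J. is_ideal J \<and> I \<subseteq> J \<and> (\<forall>k. x ^ k \<notin> J)}"
  have "\<exists>M\<in>A. \<forall>X\<in>A. M \<subseteq> X \<longrightarrow> X = M"
  proof (rule subset_Zorn_nonempty)
    show "A \<noteq> {}" using assms by (auto simp: A_def)
    fix C assume C: "C \<noteq> {}" "subset.chain A C"
    then have CA: "C \<subseteq> A" and tot: "\<And>X Y. X \<in> C \<Longrightarrow> Y \<in> C \<Longrightarrow> X \<subseteq> Y \<or> Y \<subseteq> X"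
      by (auto simp: subset_chain_def)
    have id: "is_ideal X" if "X \<in> C" for X using that CA by (auto simp: A_def)
    have "is_ideal (\<Union>C)"
      unfolding is_ideal_def
    proof (intro conjI ballI allI)
      show "0 \<in> \<Union>C" using C(1) id is_idealD(1) by blast
      show "r * p \<in> \<Union>C" if "p \<in> \<Union>C" for p r using that id is_idealD(3) by blast
      show "p + q \<in> \<Union>C" if pq: "p \<in> \<Union>C" "q \<in> \<Union>C" for p q
      proof -
        from pq obtain X Y where "X \<in> C" "Y \<in> C" "p \<in> X" "q \<in> Y" by blast
        then obtain Z where "Z \<in> C" "p \<in> Z" "q \<in> Z" using tot by blast
        then show ?thesis using id is_idealD(2) by blast
      qed
    qed
    then show "\<Union>C \<in> A" using C(1) CA unfolding A_def by blast
  qed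
  then obtain J where J: "J \<in> A" and max: "\<And>X. X \<in> A \<Longrightarrow> J \<subseteq> X \<Longrightarrow> X = J" by blast
  have id: "is_ideal J" and sub: "I \<subseteq> J" and av: "\<And>k. x ^ k \<notin> J" using J by (auto simp: A_def)
  note D = is_idealD[OF id]
  have inv: "\<exists>q k. x ^ k - p * q \<in> J" if p: "p \<notin> J" for p
  proof -
    define X where "X = {j + p * q | j q. j \<in> J}"
    have "is_ideal X"
      unfolding is_ideal_def
    proof (intro conjI ballI allI)
      show "0 \<in> X" unfolding X_def using D(1) by (auto intro!: exI[of _ 0])
      show "u + v \<in> X" if uv: "u \<in> X" "v \<in> X" for u v
      proof -
        from uv obtain j q j' q' where "u = j + p * q" "j \<in> J" "v = j' + p * q'" "j' \<in> J"
          unfolding X_def by blast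
        then have "u + v = (j + j') + p * (q + q')" "j + j' \<in> J"
          using D(2) by (auto simp: algebra_simps)
        then show ?thesis unfolding X_def by blast
      qed
      show "r * u \<in> X" if u: "u \<in> X" for u r
      proof -
        from u obtain j q where "u = j + p * q" "j \<in> J" unfolding X_def by blast
        then have "r * u = r * j + p * (r * q)" "r * j \<in> J" using D(3) by (auto simp: algebra_simps)
        then show ?thesis unfolding X_def by blast
      qed
    qed
    moreover have JX: "J \<subseteq> X"
    proof
      show "j \<in> X" if "j \<in> J" for j
        unfolding X_def using that by (intro CollectI exI[of _ j] exI[of _ 0]) simp
    qed
    moreover have "p \<in> X" unfolding X_def using D(1) by (intro CollectI exI[of _ 0] exI[of _ 1]) simp
    ultimately have "X \<notin> A" using max[of X] p by blast
    then obtain k where "x ^ k \<in> X" using \<open>is_ideal X\<close> JX sub by (auto simp: A_def)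
    then obtain j q where "x ^ k = j + p * q" "j \<in> J" unfolding X_def by blast
    then have "x ^ k - p * q \<in> J" by simp
    then show ?thesis by blast
  qed
  have prime: "p \<in> J \<or> q \<in> J" if "p * q \<in> J" for p q
  proof (rule ccontr)
    assume "\<not> (p \<in> J \<or> q \<in> J)"
    then have "p \<notin> J" "q \<notin> J" by auto
    then obtain p' k q' l where pq: "x ^ k - p * p' \<in> J" "x ^ l - q * q' \<in> J"
      using inv[of p] inv[of q] by auto
    \<comment> \<open>Modulo J, x^k is p p' and x^l is q q', so x^(k + l) is a multiple of p
      q.\<close>
    have "(x ^ k - p * p') * x ^ l + (p * p') * (x ^ l - q * q') + (p' * q') * (p * q) \<in> J"
      by (intro D(2) D(4)[OF pq(1)] D(3)[OF pq(2)] D(3)[OF that])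
    moreover have "(x ^ k - p * p') * x ^ l + (p * p') * (x ^ l - q * q') + (p' * q') * (p * q)
        = x ^ (k + l)" by (simp only: power_add) (simp add: ring_distribs mult_ac)
    ultimately show False using av[of "k + l"] by simp
  qed
  show ?thesis by (rule that[OF id sub av inv prime])
qed

lemma prime_power_mem:
  fixes J :: "'a::comm_ring_1 set"
  assumes "\<And>p q. p * q \<in> J \<Longrightarrow> p \<in> J \<or> q \<in> J" "1 \<notin> J" "p ^ k \<in> J"
  shows "p \<in> J"
  using assms(3)
proof (induction k)
  case (Suc k)
  then show ?case using assms(1)[of p "p ^ k"] by (metis power_Suc)
qed (use assms(2) in simp)

section \<open>Polynomials in three variables\<close>

abbreviation "lk \<equiv> Poly_Mapping.lookup"
abbreviation "sg \<equiv> Poly_Mapping.single"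
abbreviation "ks \<equiv> Poly_Mapping.keys"

lemma UNIV_three: "(UNIV::3 set) = {0, 1, 2}"
proof -
  \<comment> \<open>Numerals of the type \<open>3\<close> are read modulo 3, so the element that
    \<open>UNIV_3\<close> calls 3 is 0.\<close>
  have *: "(3::3) = 0" by simp
  show ?thesis unfolding UNIV_3 * by blast
qed

lemma three_neq [simp]: "(0::3) \<noteq> 1" "(0::3) \<noteq> 2" "(1::3) \<noteq> 2" "(1::3) \<noteq> 0" "(2::3) \<noteq> 0" "(2::3) \<noteq> 1"
  by simp_all

lemma three_less [simp]: "(0::3) < 1" "(0::3) < 2" "(1::3) < 2" "\<not> (1::3) < 0" "\<not> (2::3) < 0" "\<not> (2::3) < 1"
  by (simp_all add: less_bit1_def bit1.Rep_0 bit1.Rep_1 bit1.Rep_numeral)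

lemma sum_three: "(\<Sum>i\<in>(UNIV::3 set). f i) = f 0 + f 1 + (f 2 :: 'a::comm_monoid_add)"
  unfolding UNIV_three by (simp add: add.assoc)

lemma prod_three: "(\<Prod>i\<in>(UNIV::3 set). f i) = f 0 * f 1 * (f 2 :: 'a::comm_monoid_mult)"
  unfolding UNIV_three by (simp add: mult.assoc)

lemma sum_monomials:
  assumes "finite A" "ks P \<subseteq> A"
  shows "(\<Sum>m\<in>A. sg m (lk P m)) = P"
proof (rule poly_mapping_eqI)
  fix k
  have "lk (\<Sum>m\<in>A. sg m (lk P m)) k = (\<Sum>m\<in>A. if m = k then lk P k else 0)"
    unfolding lookup_sum lookup_single when_def by (rule sum.cong) auto
  also have "\<dots> = (if k \<in> A then lk P k else 0)" using assms by simp
  also have "\<dots> = lk P k"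
    using assms(2) not_in_keys_iff_lookup_eq_zero[of k P] by auto
  finally show "lk (\<Sum>m\<in>A. sg m (lk P m)) k = lk P k" .
qed

text \<open>Reduces statements that are additive in a polynomial to monomials, as for the
  multiplicativity of \<open>eval\<close> and the coefficients of a product with a monomial.\<close>

lemma poly_mapping_additive_induct [case_names zero single add]:
  fixes p :: "'a \<Rightarrow>\<^sub>0 'b::comm_monoid_add"
  assumes "Q 0" "\<And>m c. Q (sg m c)" "\<And>p q. Q p \<Longrightarrow> Q q \<Longrightarrow> Q (p + q)"
  shows "Q p"
proof -
  have "Q (\<Sum>m\<in>A. sg m (lk p m))" if "finite A" for A
    using that by (induction A) (simp_all add: assms)
  from this[of "ks p"] show ?thesis by (simp add: sum_monomials)
qed

section \<open>Evaluation and constant polynomials\<close>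

lemma eval_superset:
  assumes "finite A" "ks P \<subseteq> A"
  shows "eval P x = (\<Sum>m\<in>A. lk P m * (\<Prod>i\<in>UNIV. x $ i ^ lk m i))"
  unfolding eval_def using assms
  by (intro sum.mono_neutral_left) (auto simp: not_in_keys_iff_lookup_eq_zero)

lemma eval_add [simp]: "eval (P + Q) x = eval P x + eval Q x"
proof -
  have "finite (ks P \<union> ks Q)" "ks (P + Q) \<subseteq> ks P \<union> ks Q" by (simp_all add: keys_add)
  then show ?thesis
    using eval_superset[of "ks P \<union> ks Q"]
    by (simp add: lookup_add distrib_right sum.distrib)
qed

lemma eval_zero [simp]: "eval 0 x = 0"
  by (simp add: eval_def)

lemma eval_single: "eval (sg m c) x = c * (\<Prod>i\<in>UNIV. x $ i ^ lk m i)"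
  by (simp add: eval_superset[of "{m}"])

lemma eval_one [simp]: "eval 1 x = 1"
  using eval_single[of 0 1 x] by simp

lemma eval_mult [simp]: "eval (P * Q) x = eval P x * eval Q x"
proof (induction P rule: poly_mapping_additive_induct)
  case (single m c)
  show ?case
  proof (induction Q rule: poly_mapping_additive_induct)
    case (single m' c')
    show ?case
      by (simp add: mult_single eval_single lookup_add power_add prod.distrib)
  qed (simp_all add: distrib_left)
qed (simp_all add: distrib_right)

lemma eval_sum: "eval (sum f A) x = (\<Sum>i\<in>A. eval (f i) x)"
  by (induction A rule: infinite_finite_induct) auto

lemma eval_xv [simp]: "eval (xv i) x = x $ i"
proof -
  have "eval (xv i) x = (\<Prod>j\<in>UNIV. if j = i then x $ j else 1)"
    unfolding xv_def eval_single mult_1_left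
    by (rule prod.cong) (simp_all add: lookup_single when_def eq_commute[of i])
  then show ?thesis by simp
qed

lemma const_simps [simp]: "const 0 = 0" "const 1 = 1"
  "const (a + b) = const a + const b" "const (a * b) = const a * const b" "const (- a) = - const a"
  by (simp_all add: const_def single_add mult_single single_uminus)

lemma const_of_nat: "const (of_nat k) = of_nat k"
  by (simp add: const_def)

lemma const_diff [simp]: "const (a - b) = const a - const b"
  using const_simps(3)[of a "-b"] by simp

lemma const_power [simp]: "const (a ^ k) = const a ^ k"
  by (induction k) auto

lemma const_sum: "const (sum f A) = (\<Sum>i\<in>A. const (f i))"
  by (induction A rule: infinite_finite_induct) auto

lemma const_prod: "const (prod f A) = (\<Prod>i\<in>A. const (f i))"
  by (induction A rule: infinite_finite_induct) auto

lemma xv_power: "xv i ^ k = sg (sg i k) 1"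
  by (induction k) (auto simp: xv_def mult_single simp flip: single_add)

lemma single_eq_monomial: "sg m c = const c * (\<Prod>i\<in>UNIV. xv i ^ lk m i)"
proof -
  have "m = sg 0 (lk m 0) + sg 1 (lk m 1) + sg 2 (lk m 2)"
  proof (rule poly_mapping_eqI)
    fix i :: 3
    have "i \<in> {0, 1, 2}" unfolding UNIV_three[symmetric] by (rule UNIV_I)
    then show "lk m i = lk (sg 0 (lk m 0) + sg 1 (lk m 1) + sg 2 (lk m 2)) i"
      by (auto simp: lookup_add lookup_single when_def)
  qed
  then have "sg m c = sg (sg 0 (lk m 0) + sg 1 (lk m 1) + sg 2 (lk m 2)) c"
    by (rule arg_cong[where f = "\<lambda>m. sg m c"])
  also have "\<dots> = const c * (\<Prod>i\<in>UNIV. xv i ^ lk m i)"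
    by (simp add: xv_power prod_three const_def mult_single)
  finally show ?thesis .
qed

section \<open>Powers of the variables as a regular sequence\<close>

lemma lookup_single_mult: "lk (sg k 1 * (f :: cpoly)) (k + m) = lk f m"
proof (induction f rule: poly_mapping_additive_induct)
  case (single m' c)
  show ?case by (simp add: mult_single lookup_single when_def)
qed (simp_all add: distrib_left lookup_add)

lemma keys_xv_power_mult:
  assumes "m \<in> ks (xv i ^ N * f)"
  shows "N \<le> lk m i"
proof -
  have "m \<in> {a + b | a b. a \<in> ks (xv i ^ N) \<and> b \<in> ks f}" using assms keys_mult by blast
  then show ?thesis by (auto simp: xv_power lookup_add lookup_single)
qed

lemma mem_keys_xv_power_mult:
  assumes "m \<in> ks f"
  shows "sg i N + m \<in> ks (xv i ^ N * f)"
  using assms by (simp add: xv_power in_keys_iff lookup_single_mult)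

lemma xv_power_dvd:
  assumes "\<And>m. m \<in> ks f \<Longrightarrow> N \<le> lk m i"
  shows "\<exists>h. f = xv i ^ N * h"
proof -
  have "sg i N + (m - sg i N) = m" if "m \<in> ks f" for m
    using assms[OF that]
    by (intro poly_mapping_eqI) (auto simp: lookup_add lookup_minus lookup_single when_def)
  then have "xv i ^ N * (\<Sum>m\<in>ks f. sg (m - sg i N) (lk f m)) = (\<Sum>m\<in>ks f. sg m (lk f m))"
    by (simp add: sum_distrib_left xv_power mult_single)
  also have "\<dots> = f" by (rule sum_monomials) auto
  finally show ?thesis by (intro exI) (erule sym)
qed

lemma xv_power_reg0: "xv i ^ N * f = 0 \<Longrightarrow> f = 0"
  using mem_keys_xv_power_mult[of _ f i N] by (metis ex_in_conv keys_eq_empty keys_zero)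

lemma xv_power_reg1:
  assumes "xv j ^ N * f = xv i ^ M * g" "i \<noteq> j"
  shows "\<exists>u. f = xv i ^ M * u"
proof (rule xv_power_dvd)
  fix m assume "m \<in> ks f"
  then have "sg j N + m \<in> ks (xv i ^ M * g)" using mem_keys_xv_power_mult[of m f j N] assms(1) by simp
  then have "M \<le> lk (sg j N + m) i" by (rule keys_xv_power_mult)
  then show "M \<le> lk m i" using assms(2) by (simp add: lookup_add lookup_single when_def)
qed

lemma keys_sum_monomials:
  assumes "m \<in> ks (\<Sum>m\<in>A. sg m (f m))"
  shows "m \<in> A"
proof -
  have "m \<in> (\<Union>m\<in>A. ks (sg m (f m)))" using assms keys_sum by (rule rev_subsetD)
  then obtain m' where "m' \<in> A" "m \<in> ks (sg m' (f m'))" by (rule UN_E)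
  then show ?thesis by (simp split: if_splits)
qed

text \<open>The ideal of two powers of variables is monomial, so membership is read off the
  exponents. Multiplication by a power of x_l changes only the exponent of x_l; hence every monomial
  of f itself is divisible by one of the two powers, and f splits accordingly.\<close>

lemma xv_power_reg2:
  assumes "xv l ^ K * f = xv i ^ M * g + xv j ^ N * h" "i \<noteq> l" "j \<noteq> l"
  shows "\<exists>u v. f = xv i ^ M * u + xv j ^ N * v"
proof -
  have *: "M \<le> lk m i \<or> N \<le> lk m j" if "m \<in> ks f" for m
  proof -
    have "sg l K + m \<in> ks (xv i ^ M * g) \<union> ks (xv j ^ N * h)"
      using mem_keys_xv_power_mult[OF that, of l K] unfolding assms(1) by (rule subsetD[OF keys_add])
    then have "M \<le> lk (sg l K + m) i \<or> N \<le> lk (sg l K + m) j"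
      using keys_xv_power_mult[of "sg l K + m" i M g] keys_xv_power_mult[of "sg l K + m" j N h] by (elim UnE) simp_all
    then show ?thesis using assms(2,3) by (simp add: lookup_add lookup_single when_def)
  qed
  define A where "A = {m \<in> ks f. M \<le> lk m i}"
  have "A \<subseteq> ks f" by (simp add: A_def)
  then have "(\<Sum>m\<in>ks f - A. sg m (lk f m)) + (\<Sum>m\<in>A. sg m (lk f m)) = f"
    by (simp add: sum_monomials flip: sum.subset_diff)
  moreover have "\<exists>u. (\<Sum>m\<in>A. sg m (lk f m)) = xv i ^ M * u"
    by (rule xv_power_dvd) (auto simp: A_def dest: keys_sum_monomials)
  moreover have "\<exists>v. (\<Sum>m\<in>ks f - A. sg m (lk f m)) = xv j ^ N * v"
    by (rule xv_power_dvd) (use * in \<open>auto simp: A_def dest!: keys_sum_monomials\<close>)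
  ultimately obtain u v where "xv j ^ N * v + xv i ^ M * u = f" by auto
  then have "f = xv i ^ M * u + xv j ^ N * v" by (simp add: add.commute)
  then show ?thesis by blast
qed

section \<open>Ideals avoiding the powers of a variable\<close>

lemma finite_bounded_monomials: "finite {m :: 3 \<Rightarrow>\<^sub>0 nat. \<forall>i. lk m i \<le> d}"
proof (rule inj_on_finite)
  show "inj_on lk {m :: 3 \<Rightarrow>\<^sub>0 nat. \<forall>i. lk m i \<le> d}"
    by (auto intro: inj_onI poly_mapping_eqI)
  show "lk ` {m :: 3 \<Rightarrow>\<^sub>0 nat. \<forall>i. lk m i \<le> d} \<subseteq> PiE UNIV (\<lambda>_. {..d})"
    by (auto simp: PiE_UNIV_domain)
  show "finite (PiE (UNIV :: 3 set) (\<lambda>_. {..d}))" by (intro finite_PiE) auto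
qed

text \<open>The bound is the sum of the total degrees of all monomials of p. Attaching a natural
  number to each polynomial distributes the uncountably many inverses in
  \<open>linear_form_mem\<close> over countably many classes.\<close>

lemma bounded_monomials_exhaust: "\<exists>d. \<forall>m\<in>ks (p :: cpoly). \<forall>i. lk m i \<le> d"
proof (intro exI ballI allI)
  fix m and i :: 3 assume "m \<in> ks p"
  then have "(\<Sum>i\<in>UNIV. lk m i) \<le> (\<Sum>m\<in>ks p. \<Sum>i\<in>UNIV. lk m i)"
    by (intro member_le_sum) auto
  moreover have "lk m i \<le> (\<Sum>i\<in>UNIV. lk m i)"
    by (intro member_le_sum) auto
  ultimately show "lk m i \<le> (\<Sum>m\<in>ks p. \<Sum>i\<in>UNIV. lk m i)" by (rule order_trans[rotated])
qed

lemma ideal_cong_mult: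
  assumes "is_ideal J" "p - p' \<in> J" "q - q' \<in> J"
  shows "p * q - p' * q' \<in> J"
proof -
  have "p * q - p' * q' = (p - p') * q + p' * (q - q')" by (simp add: algebra_simps)
  then show ?thesis using assms(2,3) is_idealD[OF assms(1)] by simp
qed

lemma ideal_cong_power:
  assumes "is_ideal J" "p - p' \<in> J"
  shows "p ^ k - p' ^ k \<in> J"
proof (induction k)
  case 0
  show ?case using is_idealD(1)[OF assms(1)] by simp
next
  case (Suc k)
  then show ?case using ideal_cong_mult[OF assms(1,2) Suc] by simp
qed

text \<open>This is x^N Q(y/x). The formal degree N may exceed the degree of Q, the excess appearing
  as a power of x.\<close>

definition homogenize :: "cpoly \<Rightarrow> cpoly \<Rightarrow> nat \<Rightarrow> complex poly \<Rightarrow> cpoly" where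
  "homogenize y x N Q = (\<Sum>i\<le>N. const (coeff Q i) * y ^ i * x ^ (N - i))"

lemma homogenize_linear_factor:
  assumes "degree Q \<le> N"
  shows "homogenize y x (Suc N) ([:- c, 1:] * Q) = (y - const c * x) * homogenize y x N Q"
proof -
  have "homogenize y x (Suc N) ([:- c, 1:] * Q)
      = (\<Sum>i\<le>Suc N. const (coeff (pCons 0 Q) i) * y ^ i * x ^ (Suc N - i))
        - (\<Sum>i\<le>Suc N. const c * (const (coeff Q i) * y ^ i * x ^ (Suc N - i)))"
    by (simp only: homogenize_def flip: sum_subtractf)
       (rule sum.cong, simp_all add: algebra_simps)
  also have "(\<Sum>i\<le>Suc N. const (coeff (pCons 0 Q) i) * y ^ i * x ^ (Suc N - i))
      = y * homogenize y x N Q"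
    by (subst sum.atMost_Suc_shift) (simp add: homogenize_def sum_distrib_left mult_ac)
  \<comment> \<open>The degree bound makes the coefficient of index N + 1 vanish.\<close>
  also have "(\<Sum>i\<le>Suc N. const c * (const (coeff Q i) * y ^ i * x ^ (Suc N - i)))
      = (\<Sum>i\<le>N. const c * (const (coeff Q i) * y ^ i * x ^ (Suc N - i)))"
    using assms by (simp add: coeff_eq_0)
  also have "\<dots> = const c * x * homogenize y x N Q"
    unfolding homogenize_def sum_distrib_left
    by (rule sum.cong) (simp_all add: Suc_diff_le mult_ac)
  finally show ?thesis by (simp add: algebra_simps)
qed

lemma homogenize_prod:
  assumes "finite S"
  shows "homogenize y x (card S) (\<Prod>c\<in>S. [:- c, 1:]) = (\<Prod>c\<in>S. y - const c * x)"
  using assms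
proof (induction S)
  case empty
  show ?case by (simp add: homogenize_def)
next
  case (insert c S)
  have "degree (\<Prod>c\<in>S. [:- c, 1:]) \<le> card S"
    using degree_prod_sum_le[OF insert(1), of "\<lambda>c. [:- c, 1:]"] by simp
  from homogenize_linear_factor[OF this] insert show ?case by simp
qed

text \<open>Over the complex numbers a nonzero binary form is a constant times a power of x times
  factors y - c x. The prime ideal J contains neither nonzero constants nor powers of x, so it
  contains one of the other factors. The induction runs over the formal degree and splits off one
  root at a time.\<close>

lemma linear_factor_mem:
  assumes J: "is_ideal J" and prime: "\<And>p q. p * q \<in> J \<Longrightarrow> p \<in> J \<or> q \<in> J"
    and av: "\<And>k. x ^ k \<notin> J"
    and "degree Q \<le> N" "Q \<noteq> 0" "homogenize y x N Q \<in> J"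
  shows "\<exists>c. y - const c * x \<in> J"
  using assms(4-6)
proof (induction N arbitrary: Q)
  case 0
  then have "coeff Q 0 \<noteq> 0" by (metis le_zero_eq leading_coeff_0_iff)
  have "const (inverse (coeff Q 0)) * const (coeff Q 0) = 1"
    using \<open>coeff Q 0 \<noteq> 0\<close> by (simp only: const_simps(4)[symmetric]) simp
  moreover have "const (inverse (coeff Q 0)) * const (coeff Q 0) \<in> J"
    using 0(3) is_idealD(3)[OF J] by (simp add: homogenize_def)
  ultimately show ?case using av[of 0] by simp
next
  case (Suc N)
  show ?case
  proof (cases "degree Q = 0")
    \<comment> \<open>Without roots left, the form is a nonzero constant times x^(N + 1), which J
      avoids.\<close>
    case True
    then have "coeff Q 0 \<noteq> 0" using Suc.prems(2) by (metis leading_coeff_0_iff)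
    have "homogenize y x (Suc N) Q = (\<Sum>i\<le>Suc N. if i = 0 then const (coeff Q 0) * x ^ Suc N else 0)"
      unfolding homogenize_def
      by (rule sum.cong) (use True in \<open>auto simp: coeff_eq_0\<close>)
    then have "const (coeff Q 0) * x ^ Suc N \<in> J" using Suc.prems(3) by simp
    then have "const (inverse (coeff Q 0)) * (const (coeff Q 0) * x ^ Suc N) \<in> J"
      by (rule is_idealD(3)[OF J])
    moreover have "const (inverse (coeff Q 0)) * const (coeff Q 0) = 1"
      using \<open>coeff Q 0 \<noteq> 0\<close> by (simp only: const_simps(4)[symmetric]) simp
    ultimately have "x ^ Suc N \<in> J" by (simp only: mult.assoc[symmetric] mult_1_left)
    then show ?thesis using av by blast
  next
    case False
    then have "\<not> constant (poly Q)" by (simp add: constant_degree)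
    then obtain c where "poly Q c = 0" using fundamental_theorem_of_algebra by blast
    then obtain Q' where Q': "Q = [:- c, 1:] * Q'" by (metis dvdE poly_eq_0_iff_dvd)
    then have "Q' \<noteq> 0" using Suc.prems(2) by auto
    then have "degree Q = Suc (degree Q')" unfolding Q' by (subst degree_mult_eq) auto
    then have deg: "degree Q' \<le> N" using Suc.prems(1) by simp
    have "(y - const c * x) * homogenize y x N Q' \<in> J"
      using Suc.prems(3) unfolding Q' homogenize_linear_factor[OF deg] .
    then show ?thesis using prime Suc.IH[OF deg \<open>Q' \<noteq> 0\<close>] by blast
  qed
qed

text \<open>
  Otherwise all the \<open>y - c x\<close> are invertible modulo \<open>J\<close> up to powers of \<open>x\<close>. As \<open>\<complex>\<close> is uncountable,
  infinitely many of the inverses lie in one finite-dimensional space of polynomials, and a linear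
  relation between them yields a nonzero binary form in \<open>y\<close> and \<open>x\<close> that lies in \<open>J\<close>.
\<close>

lemma linear_form_mem:
  assumes J: "is_ideal J" and prime: "\<And>p q. p * q \<in> J \<Longrightarrow> p \<in> J \<or> q \<in> J"
    and av: "\<And>k. x ^ k \<notin> J"
    and inv: "\<And>p. p \<notin> J \<Longrightarrow> \<exists>q k. x ^ k - p * q \<in> J"
  shows "\<exists>c. y - const c * x \<in> J"
proof (rule ccontr)
  assume notin: "\<not> ?thesis"
  then have "\<forall>c. \<exists>q k. x ^ k - (y - const c * x) * q \<in> J" using inv by blast
  then obtain q k where qk: "\<And>c. x ^ k c - (y - const c * x) * q c \<in> J" by metis
  note D = is_idealD[OF J]
  have xJ: "x \<notin> J" using av[of 1] by simp
  obtain d where d: "\<And>c m i. m \<in> ks (q c) \<Longrightarrow> lk m i \<le> d c"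
    using choice[of "\<lambda>c d. \<forall>m\<in>ks (q c). \<forall>i. lk m i \<le> d"] bounded_monomials_exhaust by blast
  have "\<exists>a b. infinite {c. k c = a \<and> d c = b}"
  proof (rule ccontr)
    assume "\<not> ?thesis"
    then have "countable (\<Union>a. \<Union>b. {c. k c = a \<and> d c = b})"
      by (intro countable_UN countableI_type) (blast intro: countable_finite)
    moreover have "(\<Union>a. \<Union>b. {c. k c = a \<and> d c = b}) = UNIV" by auto
    ultimately show False using uncountable_UNIV_complex by simp
  qed
  then obtain a b where inf: "infinite {c. k c = a \<and> d c = b}" by blast
  define \<Lambda> where "\<Lambda> = {c. k c = a \<and> d c = b}"
  have q: "x ^ a - (y - const c * x) * q c \<in> J" if "c \<in> \<Lambda>" for c
    using qk[of c] that by (simp add: \<Lambda>_def)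
  \<comment> \<open>Infinitely many c must give infinitely many polynomials for dimension to be
    exceeded. If c and e shared the inverse q, subtracting the two congruences would give (c - e) x
    q in J, hence q in J and then x^a in J.\<close>
  have inj: "inj_on q \<Lambda>"
  proof (rule inj_onI, rule ccontr)
    fix c e assume ce: "c \<in> \<Lambda>" "e \<in> \<Lambda>" "q c = q e" "c \<noteq> e"
    have "(x ^ a - (y - const c * x) * q c) - (x ^ a - (y - const e * x) * q e) \<in> J"
      using q ce D(6) by blast
    moreover have "(x ^ a - (y - const c * x) * q c) - (x ^ a - (y - const e * x) * q e)
        = const (c - e) * (x * q c)" using ce(3) by (simp add: algebra_simps)
    ultimately have "const (inverse (c - e)) * (const (c - e) * (x * q c)) \<in> J" using D(3) by simp
    moreover have "const (inverse (c - e)) * const (c - e) = 1"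
      using ce(4) by (simp only: const_simps(4)[symmetric]) simp
    ultimately have "x * q c \<in> J" by (simp only: mult.assoc[symmetric] mult_1_left)
    then have "q c \<in> J" using prime xJ by blast
    then have "(x ^ a - (y - const c * x) * q c) + (y - const c * x) * q c \<in> J"
      using q[OF ce(1)] D by blast
    then show False using av[of a] by simp
  qed
  interpret cp: vector_space "\<lambda>c p. const c * p :: cpoly"
    by unfold_locales (simp_all add: algebra_simps)
  define T :: "cpoly set" where "T = (\<lambda>m. sg m 1) ` {m. \<forall>i. lk m i \<le> b}"
  have T: "finite T" unfolding T_def by (intro finite_imageI finite_bounded_monomials)
  have span: "q ` \<Lambda> \<subseteq> cp.span T"
  proof (rule image_subsetI)
    fix c assume c: "c \<in> \<Lambda>"
    have "(\<Sum>m\<in>ks (q c). const (lk (q c) m) * sg m 1) \<in> cp.span T"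
    proof (intro cp.span_sum cp.span_scale cp.span_base)
      fix m assume "m \<in> ks (q c)"
      then show "sg m 1 \<in> T" using d c by (auto simp: T_def \<Lambda>_def)
    qed
    moreover have "(\<Sum>m\<in>ks (q c). const (lk (q c) m) * sg m 1) = (\<Sum>m\<in>ks (q c). sg m (lk (q c) m))"
      by (simp add: const_def mult_single)
    ultimately show "q c \<in> cp.span T" by (simp add: sum_monomials)
  qed
  have "cp.dependent (q ` \<Lambda>)"
    using cp.independent_span_bound[OF T _ span] inf finite_image_iff[OF inj]
    by (auto simp: \<Lambda>_def)
  then obtain S u where Su: "finite S \<and> S \<subseteq> q ` \<Lambda> \<and> (\<Sum>v\<in>S. const (u v) * v) = 0 \<and> (\<exists>v\<in>S. u v \<noteq> 0)"
    unfolding cp.dependent_explicit by (elim exE)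
  from Su obtain v where v: "v \<in> S" "u v \<noteq> 0" by (elim conjE bexE)
  from Su have S: "S \<subseteq> q ` \<Lambda>" "finite S" "(\<Sum>v\<in>S. const (u v) * v) = 0" by simp_all
  obtain L where L: "L \<subseteq> \<Lambda>" "finite L" "S = q ` L"
    using finite_subset_image[OF S(2,1)] by auto
  obtain c0 where c0: "c0 \<in> L" "v = q c0" using v(1) unfolding L(3) by (elim imageE)
  define w where "w c = u (q c)" for c
  have injL: "inj_on q L" by (rule inj_on_subset[OF inj L(1)])
  have rel: "(\<Sum>c\<in>L. const (w c) * q c) = 0"
    using S(3) unfolding L(3) w_def by (simp add: sum.reindex[OF injL])
  \<comment> \<open>Multiplying the relation between the q c by the product of all y - e x, and
    replacing (y - c x) q c by x^a modulo J, leaves x^a times the homogenization of this Q.\<close>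
  define Q where "Q = (\<Sum>c\<in>L. smult (w c) (\<Prod>e\<in>L - {c}. [:- e, 1:]))"
  define N where "N = card L - 1"
  have cardL: "card (L - {c}) = N" if "c \<in> L" for c using that L(2) by (simp add: N_def)
  have degprod: "degree (\<Prod>e\<in>L - {c}. [:- e, 1:]) \<le> N" if "c \<in> L" for c
    using degree_prod_sum_le[of "L - {c}" "\<lambda>c. [:- c, 1:]"] L(2) cardL[OF that] by simp
  have deg: "degree Q \<le> N"
    unfolding Q_def by (intro degree_sum_le L(2) order_trans[OF degree_smult_le] degprod)
  \<comment> \<open>Lagrange interpolation: at c0 every summand but the one of c0 vanishes, and its
    coefficient is nonzero. So Q is not zero.\<close>
  have "poly Q c0 = (\<Sum>c\<in>L. if c = c0 then w c0 * (\<Prod>e\<in>L - {c0}. c0 - e) else 0)"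
    unfolding Q_def poly_sum poly_smult poly_prod
  proof (rule sum.cong[OF refl])
    fix c assume "c \<in> L"
    show "w c * (\<Prod>e\<in>L - {c}. poly [:- e, 1:] c0)
        = (if c = c0 then w c0 * (\<Prod>e\<in>L - {c0}. c0 - e) else 0)"
    proof (cases "c = c0")
      case False
      then have "(\<Prod>e\<in>L - {c}. poly [:- e, 1:] c0) = 0"
        using c0(1) L(2) by (intro prod_zero) auto
      then show ?thesis using False by simp
    qed simp
  qed
  also have "\<dots> = w c0 * (\<Prod>e\<in>L - {c0}. c0 - e)" using L(2) c0(1) by simp
  also have "\<dots> \<noteq> 0" using v(2) c0(2) L(2) by (simp add: w_def)
  finally have pQ: "poly Q c0 \<noteq> 0" .
  have "Q \<noteq> 0"
  proof
    assume "Q = 0"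
    with pQ show False by simp
  qed
  have hom: "homogenize y x N Q = (\<Sum>c\<in>L. const (w c) * (\<Prod>e\<in>L - {c}. y - const e * x))"
  proof -
    have "homogenize y x N Q
        = (\<Sum>i\<le>N. \<Sum>c\<in>L. const (w c) * (const (coeff (\<Prod>e\<in>L - {c}. [:- e, 1:]) i) * y ^ i * x ^ (N - i)))"
      unfolding homogenize_def
    proof (rule sum.cong[OF refl])
      fix i
      have "const (coeff Q i) = (\<Sum>c\<in>L. const (w c) * const (coeff (\<Prod>e\<in>L - {c}. [:- e, 1:]) i))"
        by (simp add: Q_def coeff_sum const_sum del: mult_pCons_left)
      then show "const (coeff Q i) * y ^ i * x ^ (N - i)
          = (\<Sum>c\<in>L. const (w c) * (const (coeff (\<Prod>e\<in>L - {c}. [:- e, 1:]) i) * y ^ i * x ^ (N - i)))"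
        by (simp only: sum_distrib_right mult.assoc)
    qed
    also have "\<dots> = (\<Sum>c\<in>L. const (w c) * homogenize y x N (\<Prod>e\<in>L - {c}. [:- e, 1:]))"
      by (subst sum.swap) (simp add: homogenize_def sum_distrib_left)
    also have "\<dots> = (\<Sum>c\<in>L. const (w c) * (\<Prod>e\<in>L - {c}. y - const e * x))"
    proof (rule sum.cong[OF refl])
      fix c assume "c \<in> L"
      then show "const (w c) * homogenize y x N (\<Prod>e\<in>L - {c}. [:- e, 1:])
          = const (w c) * (\<Prod>e\<in>L - {c}. y - const e * x)"
        using homogenize_prod[of "L - {c}" y x] L(2) cardL[of c] by simp
    qed
    finally show ?thesis .
  qed
  have "x ^ a * homogenize y x N Q \<in> J"
  proof -
    define P where "P = (\<Prod>e\<in>L. y - const e * x)"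
    have "x ^ a * homogenize y x N Q - P * (\<Sum>c\<in>L. const (w c) * q c)
        = (\<Sum>c\<in>L. const (w c) * (x ^ a * (\<Prod>e\<in>L - {c}. y - const e * x)) - const (w c) * (P * q c))"
      by (simp add: hom sum_subtractf sum_distrib_left mult_ac)
    also have "\<dots> = (\<Sum>c\<in>L. const (w c) * (\<Prod>e\<in>L - {c}. y - const e * x) * (x ^ a - (y - const c * x) * q c))"
    proof (rule sum.cong[OF refl])
      fix c assume "c \<in> L"
      then have P: "P = (y - const c * x) * (\<Prod>e\<in>L - {c}. y - const e * x)"
        unfolding P_def by (rule prod.remove[OF L(2)])
      show "const (w c) * (x ^ a * (\<Prod>e\<in>L - {c}. y - const e * x)) - const (w c) * (P * q c)
        = const (w c) * (\<Prod>e\<in>L - {c}. y - const e * x) * (x ^ a - (y - const c * x) * q c)"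
        unfolding P by (simp add: right_diff_distrib mult_ac)
    qed
    also have "\<dots> \<in> J"
      using L(1) by (intro is_ideal_sum[OF J] D(3) q) auto
    finally show ?thesis using rel by simp
  qed
  then have QJ: "homogenize y x N Q \<in> J" using prime[of "x ^ a" "homogenize y x N Q"] av[of a] by simp
  have "\<exists>c. y - const c * x \<in> J" by (rule linear_factor_mem[OF J prime av deg \<open>Q \<noteq> 0\<close> QJ])
  with notin show False by (rule notE)
qed

section \<open>The Jacobian ideal\<close>

lemma homog_zero [simp]: "homog d 0"
  by (simp add: homog_def)

lemma homog_single: "(c \<noteq> 0 \<Longrightarrow> int (\<Sum>i\<in>UNIV. lk m i) = d) \<Longrightarrow> homog d (sg m c)"
  by (auto simp: homog_def)

lemma homog_add: "homog d P \<Longrightarrow> homog d Q \<Longrightarrow> homog d (P + Q)"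
  unfolding homog_def using keys_add[of P Q] by blast

lemma homog_sum: "(\<And>i. i \<in> A \<Longrightarrow> homog d (f i)) \<Longrightarrow> homog d (sum f A)"
  by (induction A rule: infinite_finite_induct) (auto intro: homog_add)

lemma homog_mult:
  assumes "homog d P" "homog e Q"
  shows "homog (d + e) (P * Q)"
  unfolding homog_def
proof
  fix m assume "m \<in> ks (P * Q)"
  then obtain a b where "m = a + b" "a \<in> ks P" "b \<in> ks Q" using keys_mult by blast
  then show "int (\<Sum>i\<in>UNIV. lk m i) = d + e"
    using assms unfolding homog_def by (simp add: lookup_add sum.distrib)
qed

lemma homog_const [simp]: "homog 0 (const c)"
  unfolding const_def by (rule homog_single) simp

lemma homog_one [simp]: "homog 0 1"
  using homog_const[of 1] by simp

lemma homog_xv [simp]: "homog 1 (xv i)"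
  unfolding xv_def by (rule homog_single) (simp add: lookup_single when_def)

lemma homog_uminus: "homog d P \<Longrightarrow> homog d (- P)"
  by (simp add: homog_def in_keys_iff)

lemma homog_diff: "homog d P \<Longrightarrow> homog d Q \<Longrightarrow> homog d (P - Q)"
  using homog_add[of d P "- Q"] homog_uminus by simp

lemma homog_of_nat: "homog 0 (of_nat k)"
  using homog_const[of "of_nat k"] by (simp add: const_of_nat)

lemma homog_power: "homog d P \<Longrightarrow> homog (int k * d) (P ^ k)"
proof (induction k)
  case (Suc k)
  then have "homog (d + int k * d) (P * P ^ k)" by (intro homog_mult)
  then show ?case by (simp add: algebra_simps)
qed simp

lemma homog_prod:
  assumes "\<And>i. i \<in> A \<Longrightarrow> homog d (f i)" "finite A"
  shows "homog (int (card A) * d) (prod f A)"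
  using assms(2,1)
proof (induction A)
  case (insert a A)
  then have "homog (d + int (card A) * d) (f a * prod f A)" by (intro homog_mult) auto
  then show ?case using insert(1,2) by (simp add: algebra_simps)
qed simp

lemma homog_pd:
  assumes "homog d P"
  shows "homog (d - 1) (pd P i)"
  unfolding pd_def
proof (rule homog_sum, rule homog_single)
  fix m assume m: "m \<in> ks P" and nz: "of_nat (lk m i) * lk P m \<noteq> 0"
  \<comment> \<open>A positive exponent keeps the subtraction in \<open>m - sg i 1\<close> from
    being truncated, so the degree drops by exactly one.\<close>
  then have "0 < lk m i" by (cases "lk m i") auto
  have "(\<Sum>j\<in>UNIV. lk m j) = (\<Sum>j\<in>UNIV. lk (m - sg i 1) j + (if j = i then 1 else 0))"
    using \<open>0 < lk m i\<close> by (intro sum.cong) (auto simp: lookup_minus lookup_single when_def)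
  also have "\<dots> = (\<Sum>j\<in>UNIV. lk (m - sg i 1) j) + 1" by (simp add: sum.distrib)
  finally have "int (\<Sum>j\<in>UNIV. lk m j) = int (\<Sum>j\<in>UNIV. lk (m - sg i 1) j) + 1" by (simp only: of_nat_add of_nat_1)
  moreover have "int (\<Sum>j\<in>UNIV. lk m j) = d" using assms m unfolding homog_def by (rule bspec)
  ultimately show "int (\<Sum>j\<in>UNIV. lk (m - sg i 1) j) = d - 1" by (simp only: eq_diff_eq)
qed

lemma pd_zero [simp]: "pd 0 i = 0"
  by (simp add: pd_def)

lemma euler_pd:
  assumes "homog (int d) P"
  shows "(\<Sum>i\<in>UNIV. xv i * pd P i) = of_nat d * P"
proof -
  \<comment> \<open>If the exponent of x_i is 0, the subtraction is truncated, but then the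
    coefficient is 0 as well.\<close>
  have *: "xv i * sg (m - sg i 1) (of_nat (lk m i) * c) = sg m (of_nat (lk m i) * c)"
    for i m and c :: complex
  proof (cases "lk m i = 0")
    case False
    then have "sg i 1 + (m - sg i 1) = m"
      by (intro poly_mapping_eqI) (auto simp: lookup_add lookup_minus lookup_single when_def)
    then show ?thesis by (simp add: xv_def mult_single)
  qed simp
  have "(\<Sum>i\<in>UNIV. xv i * pd P i) = (\<Sum>i\<in>UNIV. \<Sum>m\<in>ks P. sg m (of_nat (lk m i) * lk P m))"
    by (simp only: pd_def sum_distrib_left *)
  also have "\<dots> = (\<Sum>m\<in>ks P. \<Sum>i\<in>UNIV. sg m (of_nat (lk m i) * lk P m))"
    by (rule sum.swap)
  also have "\<dots> = (\<Sum>m\<in>ks P. of_nat d * sg m (lk P m))"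
  proof (rule sum.cong[OF refl])
    fix m assume "m \<in> ks P"
    then have "(\<Sum>i\<in>UNIV. lk m i) = d" using assms by (simp add: homog_def del: of_nat_sum)
    then have "of_nat (\<Sum>i\<in>UNIV. lk m i) * lk P m = of_nat d * lk P m" by simp
    then have "sg m (\<Sum>i\<in>UNIV. of_nat (lk m i) * lk P m) = sg m (of_nat d * lk P m)"
      by (simp add: sum_distrib_right)
    moreover have "sg m (\<Sum>i\<in>UNIV. of_nat (lk m i) * lk P m) = (\<Sum>i\<in>UNIV. sg m (of_nat (lk m i) * lk P m))"
      by (simp add: sum_three single_add)
    moreover have "sg m (of_nat d * lk P m) = of_nat d * sg m (lk P m)"
      unfolding const_of_nat[symmetric] unfolding const_def mult_single by (simp only: add_0)
    ultimately show "(\<Sum>i\<in>UNIV. sg m (of_nat (lk m i) * lk P m)) = of_nat d * sg m (lk P m)" by simp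
  qed
  also have "\<dots> = of_nat d * P"
    by (simp add: sum_monomials flip: sum_distrib_left)
  finally show ?thesis .
qed

text \<open>Modulo J the variables are proportional to z with ratios v, so each monomial of degree d
  becomes its value at v times z^d. This turns congruences modulo J into evaluation at a projective
  point.\<close>

lemma homog_cong_eval:
  assumes J: "is_ideal J" and x: "\<And>j. xv j - const (v $ j) * z \<in> J" and P: "homog (int d) P"
  shows "P - const (eval P v) * z ^ d \<in> J"
proof -
  have "P = (\<Sum>m\<in>ks P. const (lk P m) * (\<Prod>i\<in>UNIV. xv i ^ lk m i))"
    by (simp add: sum_monomials flip: single_eq_monomial)
  moreover have "const (eval P v) * z ^ d
      = (\<Sum>m\<in>ks P. const (lk P m) * (\<Prod>i\<in>UNIV. (const (v $ i) * z) ^ lk m i))"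
    unfolding eval_def const_sum sum_distrib_right
  proof (rule sum.cong[OF refl])
    fix m assume "m \<in> ks P"
    then have d: "d = (\<Sum>i\<in>UNIV. lk m i)" using P by (simp add: homog_def del: of_nat_sum)
    show "const (lk P m * (\<Prod>i\<in>UNIV. v $ i ^ lk m i)) * z ^ d
        = const (lk P m) * (\<Prod>i\<in>UNIV. (const (v $ i) * z) ^ lk m i)"
      by (simp add: d const_prod power_mult_distrib prod.distrib power_sum mult.assoc)
  qed
  ultimately have "P - const (eval P v) * z ^ d
      = (\<Sum>m\<in>ks P. const (lk P m) * ((\<Prod>i\<in>UNIV. xv i ^ lk m i) - (\<Prod>i\<in>UNIV. (const (v $ i) * z) ^ lk m i)))"
    by (simp add: right_diff_distrib sum_subtractf)
  also have "\<dots> \<in> J"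
    unfolding prod_three
    by (intro is_ideal_sum[OF J] is_idealD(3)[OF J] ideal_cong_mult[OF J] ideal_cong_power[OF J] x)
  finally show ?thesis .
qed

section \<open>Ideals with three generators and cancellation of powers\<close>

definition ideal3 :: "'a::comm_ring_1 \<Rightarrow> 'a \<Rightarrow> 'a \<Rightarrow> 'a set" where
  "ideal3 a b c = {u * a + v * b + w * c | u v w. True}"

lemma is_ideal_ideal3: "is_ideal (ideal3 a b c)"
  unfolding is_ideal_def
proof (intro conjI ballI allI)
  show "0 \<in> ideal3 a b c" unfolding ideal3_def by (intro CollectI exI[of _ 0]) simp
  show "p + q \<in> ideal3 a b c" if pq: "p \<in> ideal3 a b c" "q \<in> ideal3 a b c" for p q
  proof -
    from pq obtain u v w u' v' w' where "p = u * a + v * b + w * c" "q = u' * a + v' * b + w' * c"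
      unfolding ideal3_def by blast
    then have "p + q = (u + u') * a + (v + v') * b + (w + w') * c" by (simp add: algebra_simps)
    then show ?thesis unfolding ideal3_def by blast
  qed
  show "r * p \<in> ideal3 a b c" if p: "p \<in> ideal3 a b c" for p r
  proof -
    from p obtain u v w where "p = u * a + v * b + w * c" unfolding ideal3_def by blast
    then have "r * p = (r * u) * a + (r * v) * b + (r * w) * c" by (simp add: algebra_simps)
    then show ?thesis unfolding ideal3_def by blast
  qed
qed

lemma ideal3_gens: "a \<in> ideal3 a b c" "b \<in> ideal3 a b c" "c \<in> ideal3 a b c"
proof -
  have "a = 1 * a + 0 * b + 0 * c" "b = 0 * a + 1 * b + 0 * c" "c = 0 * a + 0 * b + 1 * c" by simp_all
  then show "a \<in> ideal3 a b c" "b \<in> ideal3 a b c" "c \<in> ideal3 a b c" unfolding ideal3_def by blast+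
qed

lemma ideal3_perm: "ideal3 a b c = ideal3 b a c" "ideal3 a b c = ideal3 c b a"
proof -
  have 1: "ideal3 a b c \<subseteq> ideal3 b a c" for a b c :: 'a
  proof
    fix p assume "p \<in> ideal3 a b c"
    then obtain u v w where "p = u * a + v * b + w * c" unfolding ideal3_def by blast
    then have "p = v * b + u * a + w * c" by simp
    then show "p \<in> ideal3 b a c" unfolding ideal3_def by blast
  qed
  have 2: "ideal3 a b c \<subseteq> ideal3 c b a" for a b c :: 'a
  proof
    fix p assume "p \<in> ideal3 a b c"
    then obtain u v w where "p = u * a + v * b + w * c" unfolding ideal3_def by blast
    then have "p = w * c + v * b + u * a" by simp
    then show "p \<in> ideal3 c b a" unfolding ideal3_def by blast
  qed
  show "ideal3 a b c = ideal3 b a c" using 1[of a b c] 1[of b a c] by (rule equalityI)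
  show "ideal3 a b c = ideal3 c b a" using 2[of a b c] 2[of c b a] by (rule equalityI)
qed

text \<open>The radical of (a, b, c) contains the irrelevant ideal (x_0, x_1, x_2); for homogeneous
  generators of positive degree this means that they have no common zero in the projective
  plane.\<close>

definition irrelevant :: "cpoly \<Rightarrow> cpoly \<Rightarrow> cpoly \<Rightarrow> bool" where
  "irrelevant a b c \<longleftrightarrow> (\<forall>i. \<exists>k. xv i ^ k \<in> ideal3 a b c)"

lemma irrelevant_perm:
  assumes "irrelevant a b c"
  shows "irrelevant b a c" "irrelevant c b a"
  using assms unfolding irrelevant_def ideal3_perm(1)[of b a c] ideal3_perm(2)[of c b a] by blast+

text \<open>If no power of x_i lay in the ideal, a prime J avoiding these powers would yield
  constants c_j with x_j - c_j x_i in J, that is, a point v. Each g_j lies in J and is congruent to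
  g_j(v) x_i^d; a j with g_j(v) nonzero then puts x_i^d into J.\<close>

lemma nullstellensatz:
  fixes g :: "3 \<Rightarrow> cpoly"
  assumes hom: "\<And>i. homog (int d) (g i)"
    and nz: "\<And>x. x \<noteq> 0 \<Longrightarrow> \<exists>i. eval (g i) x \<noteq> 0"
  shows "irrelevant (g 0 ^ p) (g 1 ^ q) (g 2 ^ r)"
  unfolding irrelevant_def
proof (rule allI, rule ccontr)
  fix i
  assume "\<nexists>k. xv i ^ k \<in> ideal3 (g 0 ^ p) (g 1 ^ q) (g 2 ^ r)"
  then have nk: "xv i ^ k \<notin> ideal3 (g 0 ^ p) (g 1 ^ q) (g 2 ^ r)" for k by blast
  show False
  proof (rule ideal_avoiding_powers[OF is_ideal_ideal3 nk])
    fix J assume J: "is_ideal J" and sub: "ideal3 (g 0 ^ p) (g 1 ^ q) (g 2 ^ r) \<subseteq> J"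
      and av: "\<And>k. xv i ^ k \<notin> J" and inv: "\<And>p. p \<notin> J \<Longrightarrow> \<exists>q k. xv i ^ k - p * q \<in> J"
      and prime: "\<And>p q. p * q \<in> J \<Longrightarrow> p \<in> J \<or> q \<in> J"
    have one: "1 \<notin> J" using av[of 0] by simp
    have g: "g j \<in> J" for j
    proof -
      have "g 0 \<in> J" by (rule prime_power_mem[OF prime one subsetD[OF sub ideal3_gens(1)]])
      moreover have "g 1 \<in> J" by (rule prime_power_mem[OF prime one subsetD[OF sub ideal3_gens(2)]])
      moreover have "g 2 \<in> J" by (rule prime_power_mem[OF prime one subsetD[OF sub ideal3_gens(3)]])
      moreover have "j \<in> {0, 1, 2}" unfolding UNIV_three[symmetric] by (rule UNIV_I)
      ultimately show ?thesis by auto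
    qed
    have "\<exists>c. xv j - const c * xv i \<in> J" for j by (rule linear_form_mem[OF J prime av inv])
    then have "\<exists>c. \<forall>j. xv j - const (c j) * xv i \<in> J" by (intro choice allI)
    then obtain c where c: "\<And>j. xv j - const (c j) * xv i \<in> J" by blast
    \<comment> \<open>The coordinate i is set to 1, which makes v nonzero; the congruence for j = i
      is then trivial.\<close>
    define v :: "complex ^ 3" where "v = (\<chi> j. if j = i then 1 else c j)"
    have v: "xv j - const (v $ j) * xv i \<in> J" for j
      using c[of j] is_idealD(1)[OF J] by (simp add: v_def)
    have "v $ i \<noteq> 0" by (simp add: v_def)
    then have "v \<noteq> 0" by auto
    then obtain j where j: "eval (g j) v \<noteq> 0" using nz by blast
    have "g j - (g j - const (eval (g j) v) * xv i ^ d) \<in> J"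
      by (intro is_idealD(6)[OF J] g homog_cong_eval[OF J v hom])
    then have "const (eval (g j) v) * xv i ^ d \<in> J" by simp
    then have "const (inverse (eval (g j) v)) * (const (eval (g j) v) * xv i ^ d) \<in> J"
      by (rule is_idealD(3)[OF J])
    moreover have "const (inverse (eval (g j) v)) * const (eval (g j) v) = 1"
      using j by (simp only: const_simps(4)[symmetric]) simp
    ultimately have "xv i ^ d \<in> J" by (simp only: mult.assoc[symmetric] mult_1_left)
    then show False using av by blast
  qed
qed

text \<open>Powers of the three variables in the ideal serve as the y's of
  \<open>koszul_exact\<close>. The result is that a is a nonzerodivisor modulo (b, c), and by
  permutation so are the other generators modulo the remaining two.\<close>

lemma irrelevant_regular:
  assumes "irrelevant a b c" "f * a + g * b + h * c = 0"
  shows "\<exists>u v. f = u * b + v * c"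
proof -
  have "\<exists>k. \<forall>i. xv i ^ k i \<in> ideal3 a b c" using assms(1) unfolding irrelevant_def by (intro choice)
  then obtain k where k: "\<And>i. xv i ^ k i \<in> ideal3 a b c" by blast
  obtain r0 r1 r2 where r: "xv 0 ^ k 0 = r0 * a + r1 * b + r2 * c"
    using k[of 0] unfolding ideal3_def by blast
  obtain s0 s1 s2 where s: "xv 1 ^ k 1 = s0 * a + s1 * b + s2 * c"
    using k[of 1] unfolding ideal3_def by blast
  obtain t0 t1 t2 where t: "xv 2 ^ k 2 = t0 * a + t1 * b + t2 * c"
    using k[of 2] unfolding ideal3_def by blast
  show ?thesis
  proof (rule koszul_exact[OF r s t _ _ _ assms(2)])
    show "f = 0" if "xv 0 ^ k 0 * f = 0" for f using that by (rule xv_power_reg0)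
    show "\<exists>u. f = xv 0 ^ k 0 * u" if "xv 1 ^ k 1 * f = xv 0 ^ k 0 * g" for f g
      by (rule xv_power_reg1[OF that]) simp
    show "\<exists>u v. f = xv 0 ^ k 0 * u + xv 1 ^ k 1 * v"
      if "xv 2 ^ k 2 * f = xv 0 ^ k 0 * g + xv 1 ^ k 1 * h" for f g h
      by (rule xv_power_reg2[OF that]) simp_all
  qed
qed

text \<open>The term u a^(k + 1) is moved to the left, where a factor a can be split off and
  cancelled modulo (b, c).\<close>

lemma irrelevant_colon:
  assumes "irrelevant a b c" "a * f \<in> ideal3 (a ^ Suc k) b c"
  shows "f \<in> ideal3 (a ^ k) b c"
proof -
  obtain u v w where "a * f = u * a ^ Suc k + v * b + w * c"
    using assms(2) unfolding ideal3_def by blast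
  then have "(f - u * a ^ k) * a + (- v) * b + (- w) * c = 0" by (simp add: algebra_simps)
  then obtain u' v' where "f - u * a ^ k = u' * b + v' * c"
    using irrelevant_regular[OF assms(1)] by blast
  then have "f = u * a ^ k + u' * b + v' * c" by (simp add: algebra_simps)
  then show ?thesis unfolding ideal3_def by blast
qed

lemma irrelevant_colon_power:
  assumes "irrelevant a b c" "a ^ m * f \<in> ideal3 (a ^ (k + m)) b c"
  shows "f \<in> ideal3 (a ^ k) b c"
  using assms(2)
proof (induction m arbitrary: k)
  case (Suc m)
  have "a * (a ^ m * f) \<in> ideal3 (a ^ Suc (k + m)) b c" using Suc.prems by (simp add: mult_ac)
  then have "a ^ m * f \<in> ideal3 (a ^ (k + m)) b c" by (rule irrelevant_colon[OF assms(1)])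
  then show ?case by (rule Suc.IH)
qed simp

text \<open>The three m-th powers are cancelled one after the other, each lowering the exponent of
  its own generator from k + m to k. In between the generators carry different exponents, so
  \<open>irr\<close> is needed for mixed exponents.\<close>

lemma colon_powers:
  fixes g :: "3 \<Rightarrow> cpoly"
  assumes irr: "\<And>p q r. irrelevant (g 0 ^ p) (g 1 ^ q) (g 2 ^ r)"
    and F: "(g 0 * g 1 * g 2) ^ m * F \<in> ideal3 (g 0 ^ (k + m)) (g 1 ^ (k + m)) (g 2 ^ (k + m))"
  shows "F \<in> ideal3 (g 0 ^ k) (g 1 ^ k) (g 2 ^ k)"
proof -
  have irr0: "irrelevant (g 0) (g 1 ^ (k + m)) (g 2 ^ (k + m))"
    using irr[of 1 "k + m" "k + m"] by simp
  have irr1: "irrelevant (g 1) (g 0 ^ k) (g 2 ^ (k + m))"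
    using irrelevant_perm(1)[OF irr[of k 1 "k + m"]] by simp
  have irr2: "irrelevant (g 2) (g 1 ^ k) (g 0 ^ k)"
    using irrelevant_perm(2)[OF irr[of k k 1]] by simp
  have "g 0 ^ m * (g 1 ^ m * (g 2 ^ m * F)) \<in> ideal3 (g 0 ^ (k + m)) (g 1 ^ (k + m)) (g 2 ^ (k + m))"
    using F by (simp only: power_mult_distrib mult.assoc)
  from irrelevant_colon_power[OF irr0 this]
  have "g 1 ^ m * (g 2 ^ m * F) \<in> ideal3 (g 1 ^ (k + m)) (g 0 ^ k) (g 2 ^ (k + m))"
    by (rule ideal3_perm(1)[THEN equalityD1, THEN subsetD])
  from irrelevant_colon_power[OF irr1 this]
  have "g 2 ^ m * F \<in> ideal3 (g 0 ^ k) (g 1 ^ k) (g 2 ^ (k + m))"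
    by (rule ideal3_perm(1)[THEN equalityD1, THEN subsetD])
  then have "g 2 ^ m * F \<in> ideal3 (g 2 ^ (k + m)) (g 1 ^ k) (g 0 ^ k)"
    by (rule ideal3_perm(2)[THEN equalityD1, THEN subsetD])
  from irrelevant_colon_power[OF irr2 this] show ?thesis
    by (rule ideal3_perm(2)[THEN equalityD1, THEN subsetD])
qed

section \<open>Rational differential forms\<close>

lemma emb_simps [simp]: "emb 0 = 0" "emb 1 = 1" "emb (P + Q) = emb P + emb Q" "emb (P * Q) = emb P * emb Q"
  "emb (- P) = - emb P" "emb (P - Q) = emb P - emb Q"
  by (simp_all add: emb_def Zero_fract_def One_fract_def)

lemma emb_eq_iff [simp]: "emb P = emb Q \<longleftrightarrow> P = Q"
  by (simp add: emb_def eq_fract)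

lemma emb_eq_0_iff [simp]: "emb P = 0 \<longleftrightarrow> P = 0"
  using emb_eq_iff[of P 0] by (simp del: emb_eq_iff)

lemma emb_power [simp]: "emb (P ^ k) = emb P ^ k"
  by (induction k) auto

lemma emb_of_nat [simp]: "emb (of_nat k) = of_nat k"
  by (induction k) auto

lemma set3_eq_iff: "A = B \<longleftrightarrow> (0 \<in> A \<longleftrightarrow> 0 \<in> B) \<and> (1 \<in> A \<longleftrightarrow> 1 \<in> B) \<and> (2 \<in> A \<longleftrightarrow> 2 \<in> B)" for A B :: "3 set"
proof
  assume *: "(0 \<in> A \<longleftrightarrow> 0 \<in> B) \<and> (1 \<in> A \<longleftrightarrow> 1 \<in> B) \<and> (2 \<in> A \<longleftrightarrow> 2 \<in> B)"
  show "A = B"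
  proof (rule set_eqI)
    fix x :: 3
    have "x \<in> {0, 1, 2}" unfolding UNIV_three[symmetric] by (rule UNIV_I)
    then show "x \<in> A \<longleftrightarrow> x \<in> B" using * by auto
  qed
qed simp

lemma three_cases: "i = 0 \<or> i = 1 \<or> i = 2" for i :: 3
proof -
  have "i \<in> {0, 1, 2}" unfolding UNIV_three[symmetric] by (rule UNIV_I)
  then show ?thesis by simp
qed

lemma all_three: "(\<forall>i::3. P i) \<longleftrightarrow> P 0 \<and> P 1 \<and> P 2"
proof
  assume *: "P 0 \<and> P 1 \<and> P 2"
  show "\<forall>i. P i"
  proof
    show "P i" for i using three_cases[of i] * by (elim disjE) simp_all
  qed
qed simp

text \<open>A form has eight components; this reduces identities between forms to identities in the
  field of rational functions.\<close>

lemma all_3set: "(\<forall>S::3 set. P S) \<longleftrightarrow>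
    P {} \<and> P {0} \<and> P {1} \<and> P {2} \<and> P {0, 1} \<and> P {0, 2} \<and> P {1, 2} \<and> P {0, 1, 2}"
proof
  assume *: "P {} \<and> P {0} \<and> P {1} \<and> P {2} \<and> P {0, 1} \<and> P {0, 2} \<and> P {1, 2} \<and> P {0, 1, 2}"
  show "\<forall>S. P S"
  proof
    fix S :: "3 set"
    have "S \<in> {{}, {0}, {1}, {2}, {0, 1}, {0, 2}, {1, 2}, {0, 1, 2}}"
      by (simp add: set3_eq_iff) blast
    then show "P S" using * by (elim insertE) simp_all
  qed
qed simp

lemma form_eq_iff: "\<alpha> = \<beta> \<longleftrightarrow> (\<forall>S. \<alpha> $ S = \<beta> $ S)" for \<alpha> \<beta> :: form
  by (rule vec_eq_iff)

lemma sum_Pow_insert: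
  assumes "finite S" "a \<notin> S"
  shows "(\<Sum>T\<in>Pow (insert a S). f T) = (\<Sum>T\<in>Pow S. f T) + (\<Sum>T\<in>Pow S. f (insert a T))"
proof -
  have "Pow S \<inter> insert a ` Pow S = {}" using assms(2) by auto
  then have "(\<Sum>T\<in>Pow (insert a S). f T) = (\<Sum>T\<in>Pow S. f T) + (\<Sum>T\<in>insert a ` Pow S. f T)"
    unfolding Pow_insert using assms(1) by (intro sum.union_disjoint) simp_all
  also have "inj_on (insert a) (Pow S)" using assms(2) by (auto simp: inj_on_def)
  then have "(\<Sum>T\<in>insert a ` Pow S. f T) = (\<Sum>T\<in>Pow S. f (insert a T))"
    by (simp add: sum.reindex)
  finally show ?thesis .
qed

text \<open>Turns the exponent of the sign in \<open>wedge\<close> into a double sum that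
  simplification evaluates on explicit index sets.\<close>

lemma card_inversions:
  fixes T U :: "3 set"
  shows "card {(a, b). a \<in> T \<and> b \<in> U \<and> b < a} = (\<Sum>a\<in>T. \<Sum>b\<in>U. if b < a then 1 else 0)"
proof -
  have "{(a, b). a \<in> T \<and> b \<in> U \<and> b < a} = (SIGMA a:T. {b \<in> U. b < a})" by auto
  then have "card {(a, b). a \<in> T \<and> b \<in> U \<and> b < a} = (\<Sum>a\<in>T. card {b \<in> U. b < a})"
    by (simp add: card_SigmaI)
  also have "\<dots> = (\<Sum>a\<in>T. \<Sum>b\<in>U. if b < a then 1 else 0)"
    by (intro sum.cong refl) (simp add: sum.If_cases Int_def)
  finally show ?thesis .
qed

lemma insert3_commute: "{1, 0} = {0, 1 :: 3}" "{2, 0} = {0, 2 :: 3}" "{2, 1} = {1, 2 :: 3}"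
  "{1, 0, 2} = {0, 1, 2 :: 3}" "{2, 0, 1} = {0, 1, 2 :: 3}"
  by (simp_all add: set3_eq_iff)

lemma wedge_component:
  "wedge \<alpha> \<beta> $ {} = \<alpha> $ {} * \<beta> $ {}"
  "wedge \<alpha> \<beta> $ {0} = \<alpha> $ {} * \<beta> $ {0} + \<alpha> $ {0} * \<beta> $ {}"
  "wedge \<alpha> \<beta> $ {1} = \<alpha> $ {} * \<beta> $ {1} + \<alpha> $ {1} * \<beta> $ {}"
  "wedge \<alpha> \<beta> $ {2} = \<alpha> $ {} * \<beta> $ {2} + \<alpha> $ {2} * \<beta> $ {}"
  "wedge \<alpha> \<beta> $ {0, 1} = \<alpha> $ {} * \<beta> $ {0, 1} + \<alpha> $ {0} * \<beta> $ {1} - \<alpha> $ {1} * \<beta> $ {0} + \<alpha> $ {0, 1} * \<beta> $ {}"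
  "wedge \<alpha> \<beta> $ {0, 2} = \<alpha> $ {} * \<beta> $ {0, 2} + \<alpha> $ {0} * \<beta> $ {2} - \<alpha> $ {2} * \<beta> $ {0} + \<alpha> $ {0, 2} * \<beta> $ {}"
  "wedge \<alpha> \<beta> $ {1, 2} = \<alpha> $ {} * \<beta> $ {1, 2} + \<alpha> $ {1} * \<beta> $ {2} - \<alpha> $ {2} * \<beta> $ {1} + \<alpha> $ {1, 2} * \<beta> $ {}"
  "wedge \<alpha> \<beta> $ {0, 1, 2} = \<alpha> $ {} * \<beta> $ {0, 1, 2} + \<alpha> $ {0} * \<beta> $ {1, 2} - \<alpha> $ {1} * \<beta> $ {0, 2}
     + \<alpha> $ {2} * \<beta> $ {0, 1} + \<alpha> $ {0, 1} * \<beta> $ {2} - \<alpha> $ {0, 2} * \<beta> $ {1} + \<alpha> $ {1, 2} * \<beta> $ {0}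
     + \<alpha> $ {0, 1, 2} * \<beta> $ {}"
  unfolding wedge_def vec_lambda_beta card_inversions
  by (simp_all add: sum_Pow_insert insert_Diff_if)

lemma contract_component:
  "contract v \<alpha> $ {} = v $ 0 * \<alpha> $ {0} + v $ 1 * \<alpha> $ {1} + v $ 2 * \<alpha> $ {2}"
  "contract v \<alpha> $ {0} = - v $ 1 * \<alpha> $ {0, 1} - v $ 2 * \<alpha> $ {0, 2}"
  "contract v \<alpha> $ {1} = v $ 0 * \<alpha> $ {0, 1} - v $ 2 * \<alpha> $ {1, 2}"
  "contract v \<alpha> $ {2} = v $ 0 * \<alpha> $ {0, 2} + v $ 1 * \<alpha> $ {1, 2}"
  "contract v \<alpha> $ {0, 1} = v $ 2 * \<alpha> $ {0, 1, 2}"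
  "contract v \<alpha> $ {0, 2} = - v $ 1 * \<alpha> $ {0, 1, 2}"
  "contract v \<alpha> $ {1, 2} = v $ 0 * \<alpha> $ {0, 1, 2}"
  "contract v \<alpha> $ {0, 1, 2} = 0"
proof -
  have compl: "- {} = {0, 1, 2 :: 3}" "- {0} = {1, 2 :: 3}" "- {1} = {0, 2 :: 3}" "- {2} = {0, 1 :: 3}"
    "- {0, 1} = {2 :: 3}" "- {0, 2} = {1 :: 3}" "- {1, 2} = {0 :: 3}" "- {0, 1, 2} = ({} :: 3 set)"
    by (simp_all add: set3_eq_iff)
  have card: "card {k \<in> S. k < j} = (\<Sum>k\<in>S. if k < j then 1 else 0)" for S and j :: 3
    by (simp add: sum.If_cases Int_def)
  show
    "contract v \<alpha> $ {} = v $ 0 * \<alpha> $ {0} + v $ 1 * \<alpha> $ {1} + v $ 2 * \<alpha> $ {2}"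
    "contract v \<alpha> $ {0} = - v $ 1 * \<alpha> $ {0, 1} - v $ 2 * \<alpha> $ {0, 2}"
    "contract v \<alpha> $ {1} = v $ 0 * \<alpha> $ {0, 1} - v $ 2 * \<alpha> $ {1, 2}"
    "contract v \<alpha> $ {2} = v $ 0 * \<alpha> $ {0, 2} + v $ 1 * \<alpha> $ {1, 2}"
    "contract v \<alpha> $ {0, 1} = v $ 2 * \<alpha> $ {0, 1, 2}"
    "contract v \<alpha> $ {0, 2} = - v $ 1 * \<alpha> $ {0, 1, 2}"
    "contract v \<alpha> $ {1, 2} = v $ 0 * \<alpha> $ {0, 1, 2}"
    "contract v \<alpha> $ {0, 1, 2} = 0"
    unfolding contract_def vec_lambda_beta compl card
    by (simp_all add: insert3_commute add.assoc)
qed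

lemma dpoly_component: "dpoly P $ S =
  (if S = {0} then emb (pd P 0) else if S = {1} then emb (pd P 1) else if S = {2} then emb (pd P 2) else 0)"
  by (simp add: dpoly_def dx_def sum_three axis_def set3_eq_iff)

lemma Omega_vol_component:
  "Omega_vol $ {} = 0" "Omega_vol $ {0} = 0" "Omega_vol $ {1} = 0" "Omega_vol $ {2} = 0"
  "Omega_vol $ {0, 1} = emb (xv 2)" "Omega_vol $ {0, 2} = - emb (xv 1)" "Omega_vol $ {1, 2} = emb (xv 0)"
  "Omega_vol $ {0, 1, 2} = 0"
  by (simp_all add: Omega_vol_def wedge_component dx_def axis_def set3_eq_iff)

lemmas form_components = wedge_component contract_component Omega_vol_component

lemma eval_const: "eval (const c) x = c"
  unfolding const_def eval_single by simp

lemma wedge_add_left: "wedge (\<alpha> + \<beta>) \<gamma> = wedge \<alpha> \<gamma> + wedge \<beta> \<gamma>"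
  by (simp add: wedge_def vec_eq_iff sum.distrib algebra_simps)

lemma wedge_add_right: "wedge \<gamma> (\<alpha> + \<beta>) = wedge \<gamma> \<alpha> + wedge \<gamma> \<beta>"
  by (simp add: wedge_def vec_eq_iff sum.distrib algebra_simps)

lemma wedge_smult_left: "wedge (c *s \<alpha>) \<beta> = c *s wedge \<alpha> \<beta>"
  by (simp add: wedge_def vec_eq_iff sum_distrib_left mult_ac)

lemma wedge_smult_right: "wedge \<alpha> (c *s \<beta>) = c *s wedge \<alpha> \<beta>"
  by (simp add: wedge_def vec_eq_iff sum_distrib_left mult_ac)

lemma wedge_zero [simp]: "wedge 0 \<beta> = 0" "wedge \<alpha> 0 = 0"
  by (simp_all add: wedge_def vec_eq_iff)

lemma contract_add: "contract v (\<alpha> + \<beta>) = contract v \<alpha> + contract v \<beta>"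
  by (simp add: contract_def vec_eq_iff sum.distrib algebra_simps)

lemma contract_smult: "contract v (c *s \<alpha>) = c *s contract v \<alpha>"
  by (simp add: contract_def vec_eq_iff sum_distrib_left mult_ac)

lemma contract_zero [simp]: "contract v 0 = 0"
  by (simp add: contract_def vec_eq_iff)

lemma uminus_form: "- \<alpha> = (- 1 :: ratfun) *s \<alpha>"
  by (simp add: vec_eq_iff)

lemma contract_uminus: "contract v (- \<alpha>) = - contract v \<alpha>"
  unfolding uminus_form[of \<alpha>] uminus_form[of "contract v \<alpha>"] by (rule contract_smult)

text \<open>Contraction is an antiderivation, and a contracted one-form is a scalar stored at the
  empty index set.\<close>

lemma contract_wedge_one_forms:
  assumes "\<And>S. card S \<noteq> 1 \<Longrightarrow> \<alpha> $ S = 0" "\<And>S. card S \<noteq> 1 \<Longrightarrow> \<beta> $ S = 0"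
  shows "contract v (wedge \<alpha> \<beta>) = (contract v \<alpha> $ {}) *s \<beta> - (contract v \<beta> $ {}) *s \<alpha>"
proof -
  have z: "\<alpha> $ {} = 0" "\<alpha> $ {0, 1} = 0" "\<alpha> $ {0, 2} = 0" "\<alpha> $ {1, 2} = 0" "\<alpha> $ {0, 1, 2} = 0"
    "\<beta> $ {} = 0" "\<beta> $ {0, 1} = 0" "\<beta> $ {0, 2} = 0" "\<beta> $ {1, 2} = 0" "\<beta> $ {0, 1, 2} = 0"
    by (rule assms, simp)+
  show ?thesis
    unfolding form_eq_iff all_3set by (simp add: form_components z algebra_simps)
qed

lemma wedge_zero_form_left:
  assumes "\<And>S. S \<noteq> {} \<Longrightarrow> \<alpha> $ S = 0"
  shows "wedge \<alpha> \<beta> = (\<alpha> $ {}) *s \<beta>"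
proof -
  have z: "\<alpha> $ {0} = 0" "\<alpha> $ {1} = 0" "\<alpha> $ {2} = 0" "\<alpha> $ {0, 1} = 0" "\<alpha> $ {0, 2} = 0"
    "\<alpha> $ {1, 2} = 0" "\<alpha> $ {0, 1, 2} = 0"
    by (rule assms, simp)+
  show ?thesis unfolding form_eq_iff all_3set by (simp add: form_components z)
qed

lemma wedge_zero_form_right:
  assumes "\<And>S. S \<noteq> {} \<Longrightarrow> \<beta> $ S = 0"
  shows "wedge \<alpha> \<beta> = (\<beta> $ {}) *s \<alpha>"
proof -
  have z: "\<beta> $ {0} = 0" "\<beta> $ {1} = 0" "\<beta> $ {2} = 0" "\<beta> $ {0, 1} = 0" "\<beta> $ {0, 2} = 0"
    "\<beta> $ {1, 2} = 0" "\<beta> $ {0, 1, 2} = 0"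
    by (rule assms, simp)+
  show ?thesis unfolding form_eq_iff all_3set by (simp add: form_components z mult.commute)
qed

lemma wedge_dpoly_self: "wedge (dpoly P) (dpoly P) = 0"
  unfolding form_eq_iff all_3set
  by (simp add: form_components dpoly_component set3_eq_iff)

lemma euler_component: "euler $ i = emb (xv i)"
  by (simp add: euler_def)

lemma contract_euler_dpoly:
  assumes "homog (int d) P"
  shows "contract euler (dpoly P) $ {} = of_nat d * emb P"
proof -
  have "contract euler (dpoly P) $ {} = emb (\<Sum>i\<in>UNIV. xv i * pd P i)"
    by (simp add: contract_component dpoly_component euler_component sum_three set3_eq_iff)
  also have "\<dots> = of_nat d * emb P" by (simp add: euler_pd[OF assms])
  finally show ?thesis .
qed

lemma K_op_Omega_component:
  "K_op 0 Omega_vol $ {1} = emb (xv 2)" "K_op 0 Omega_vol $ {2} = - emb (xv 1)" "K_op 0 Omega_vol $ {0} = 0"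
  "K_op 1 Omega_vol $ {0} = - emb (xv 2)" "K_op 1 Omega_vol $ {2} = emb (xv 0)" "K_op 1 Omega_vol $ {1} = 0"
  "K_op 2 Omega_vol $ {0} = emb (xv 1)" "K_op 2 Omega_vol $ {1} = - emb (xv 0)" "K_op 2 Omega_vol $ {2} = 0"
  by (simp_all add: K_op_def form_components axis_def)

lemma K_op_Omega_zero: "card S \<noteq> 1 \<Longrightarrow> K_op i Omega_vol $ S = 0"
proof -
  have "\<forall>i. \<forall>S. card S \<noteq> 1 \<longrightarrow> K_op i Omega_vol $ S = 0"
    unfolding all_three all_3set by (simp add: K_op_def form_components axis_def)
  then show "card S \<noteq> 1 \<Longrightarrow> K_op i Omega_vol $ S = 0" by simp
qed

lemma K_op_K_op_Omega:
  assumes "S \<noteq> {}"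
  shows "K_op j (K_op i Omega_vol) $ S = 0"
proof -
  have "\<forall>i j. \<forall>S. S \<noteq> {} \<longrightarrow> K_op j (K_op i Omega_vol) $ S = 0"
    unfolding all_three all_3set by (simp add: K_op_def form_components axis_def)
  then show ?thesis using assms by simp
qed

lemma K_op_K_op_Omega_component:
  "K_op 1 (K_op 0 Omega_vol) $ {} = emb (xv 2)"
  "K_op 2 (K_op 0 Omega_vol) $ {} = - emb (xv 1)"
  "K_op 2 (K_op 1 Omega_vol) $ {} = emb (xv 0)"
  by (simp_all add: K_op_def form_components axis_def)

lemma contract_euler_Omega: "contract euler Omega_vol = 0"
  unfolding form_eq_iff all_3set by (simp add: form_components euler_component)

lemma contract_euler_K_op_Omega: "contract euler (K_op i Omega_vol) = 0"
proof -
  have "\<forall>i. contract euler (K_op i Omega_vol) = 0"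
    unfolding all_three form_eq_iff all_3set
    by (simp add: K_op_def form_components euler_component axis_def)
  then show ?thesis by simp
qed

text \<open>The coordinate volume form; its contraction with the Euler field is
  \<open>Omega_vol\<close>. Its contractions \<open>K_op i vol\<close> provide the regular part of
  the logarithmic lifts.\<close>

abbreviation vol :: form where "vol \<equiv> axis {0, 1, 2} 1"

lemma K_op_vol_component:
  assumes "card S = 2"
  shows "K_op i vol $ S \<in> {0, 1, - 1}"
proof -
  have "\<forall>i. \<forall>S. card S = 2 \<longrightarrow> K_op i vol $ S \<in> {0, 1, - 1}"
    unfolding all_three all_3set by (simp add: K_op_def form_components axis_def)
  then show ?thesis using assms by simp
qed

lemma K_op_vol_zero:
  assumes "card S \<noteq> 2"
  shows "K_op i vol $ S = 0"
proof -
  have "\<forall>i. \<forall>S. card S \<noteq> 2 \<longrightarrow> K_op i vol $ S = 0"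
    unfolding all_three all_3set by (simp add: K_op_def form_components axis_def set3_eq_iff)
  then show ?thesis using assms by simp
qed

text \<open>This is \<open>K\<^sub>i (\<Omega> \<and> dG) = K\<^sub>i (n G vol)\<close>.\<close>

lemma wedge_K_op_Omega_dpoly:
  assumes "homog (int n) G"
  shows "wedge (K_op i Omega_vol) (dpoly G) = (of_nat n * emb G) *s K_op i vol - emb (pd G i) *s Omega_vol"
proof -
  have e: "of_nat n * emb G = emb (xv 0) * emb (pd G 0) + emb (xv 1) * emb (pd G 1) + emb (xv 2) * emb (pd G 2)"
    using arg_cong[OF euler_pd[OF assms], of emb] by (simp add: sum_three)
  have "\<forall>i. wedge (K_op i Omega_vol) (dpoly G) = (of_nat n * emb G) *s K_op i vol - emb (pd G i) *s Omega_vol"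
    unfolding all_three form_eq_iff all_3set e
    by (simp add: K_op_def form_components axis_def dpoly_component set3_eq_iff algebra_simps)
  then show ?thesis by simp
qed

lemma eval_homog_origin:
  assumes "homog d P" "d > 0"
  shows "eval P 0 = 0"
  unfolding eval_def
proof (rule sum.neutral, rule ballI)
  fix m assume "m \<in> ks P"
  then have "int (\<Sum>i\<in>UNIV. lk m i) = d" using assms(1) unfolding homog_def by (rule bspec[rotated])
  then have "(\<Sum>i\<in>UNIV. lk m i) \<noteq> 0" using assms(2) by (intro notI) simp
  then obtain i where "lk m i \<noteq> 0" by (meson sum.neutral)
  then have "(\<Prod>i\<in>UNIV. (0 :: complex ^ 3) $ i ^ lk m i) = 0" by (intro prod_zero) auto
  then show "lk P m * (\<Prod>i\<in>UNIV. (0 :: complex ^ 3) $ i ^ lk m i) = 0" by simp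
qed

text \<open>Regularity applied to the relation 1 * 0 = 0 would put 1 into (a, b), although a and b
  vanish at the origin.\<close>

lemma irrelevant_nonzero:
  assumes "irrelevant 0 a b" "eval a 0 = 0" "eval b 0 = 0"
  shows False
proof -
  have "1 * 0 + 0 * a + 0 * b = 0" by simp
  from irrelevant_regular[OF assms(1) this] obtain u v where "1 = u * a + v * b" by (elim exE)
  then have "eval 1 (0 :: complex ^ 3) = eval (u * a + v * b) 0" by (rule arg_cong)
  then show False using assms(2,3) by simp
qed

section \<open>The Jacobian ideal of a smooth curve and regular functions over the cover\<close>

locale smooth_plane_curve =
  fixes n :: nat and G :: cpoly
  assumes n: "n \<ge> 2" and homG: "homog (int n) G" and smooth: "smooth_curve G"
begin

lemma homog_pdG: "homog (int n - 1) (pd G i)"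
  using homG by (rule homog_pd)

text \<open>By Euler's relation a common zero of the partial derivatives is a zero of n G, hence a
  singular point of the curve.\<close>

lemma irrelevant_pdG: "irrelevant (pd G 0 ^ p) (pd G 1 ^ q) (pd G 2 ^ r)"
proof (rule nullstellensatz)
  show "homog (int (n - 1)) (pd G i)" for i using homog_pdG[of i] n by (simp add: of_nat_diff)
  fix x :: "complex ^ 3" assume x: "x \<noteq> 0"
  show "\<exists>i. eval (pd G i) x \<noteq> 0"
  proof (rule ccontr)
    assume *: "\<nexists>i. eval (pd G i) x \<noteq> 0"
    have "eval (\<Sum>i\<in>UNIV. xv i * pd G i) x = eval (const (of_nat n) * G) x"
      by (simp only: euler_pd[OF homG] const_of_nat)
    moreover have "eval (const (of_nat n)) x = of_nat n" by (rule eval_const)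
    ultimately have "eval G x = 0" using * n by (simp add: eval_sum)
    then show False using x * smooth unfolding smooth_curve_def by blast
  qed
qed

text \<open>Needed because the partial derivatives are denominators. Their degree n - 1 is positive,
  so they vanish at the origin and none of the three can be 0.\<close>

lemma pdG_nonzero [simp]: "pd G i \<noteq> 0"
proof
  have ev: "eval (pd G j) 0 = 0" for j using homog_pdG by (rule eval_homog_origin) (use n in simp)
  have irr: "irrelevant (pd G 0) (pd G 1) (pd G 2)" using irrelevant_pdG[of 1 1 1] by simp
  assume "pd G i = 0"
  with three_cases[of i] consider "pd G 0 = 0" | "pd G 1 = 0" | "pd G 2 = 0" by auto
  then show False
  proof cases
    case 1
    show False by (rule irrelevant_nonzero[OF irr[unfolded 1] ev ev])
  next
    case 2
    show False by (rule irrelevant_nonzero[OF irrelevant_perm(1)[OF irr, unfolded 2] ev ev])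
  next
    case 3
    show False by (rule irrelevant_nonzero[OF irrelevant_perm(2)[OF irr, unfolded 3] ev ev])
  qed
qed

lemma G_nonzero [simp]: "G \<noteq> 0"
  using pdG_nonzero[of 0] by (intro notI) (simp del: pdG_nonzero)

abbreviation "R \<equiv> reg_fun n G"
abbreviation "C \<equiv> cone_forms n G"

lemma prod_pdG_nonzero [simp]: "(\<Prod>i\<in>I. pd G i) \<noteq> 0"
  by (simp add: prod_zero_iff)

lemma R_I: "homog (d + int k * int (card I) * (int n - 1)) P \<Longrightarrow> emb P / emb (\<Prod>i\<in>I. pd G i) ^ k \<in> R I d"
  unfolding reg_fun_def by (rule CollectI) (rule exI[of _ P], rule exI[of _ k], simp)

lemma R_E:
  assumes "f \<in> R I d"
  obtains P k where "f = emb P / emb (\<Prod>i\<in>I. pd G i) ^ k" "homog (d + int k * int (card I) * (int n - 1)) P"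
  using assms unfolding reg_fun_def by (elim CollectE exE conjE)

lemma R_poly: "homog d P \<Longrightarrow> emb P \<in> R I d"
  using R_I[of d 0 I P] by simp

lemma homog_prod_power: "homog (int k * int (card I) * (int n - 1)) ((\<Prod>i\<in>I. pd G i) ^ k)"
proof -
  have "homog (int (card I) * (int n - 1)) (\<Prod>i\<in>I. pd G i)" by (intro homog_prod homog_pdG) simp
  then have "homog (int k * (int (card I) * (int n - 1))) ((\<Prod>i\<in>I. pd G i) ^ k)" by (rule homog_power)
  then show ?thesis by (simp only: mult.assoc)
qed

lemma R_raise:
  assumes "homog (d + int k * int (card I) * (int n - 1)) P" "k \<le> l"
  obtains Q where "emb P / emb (\<Prod>i\<in>I. pd G i) ^ k = emb Q / emb (\<Prod>i\<in>I. pd G i) ^ l"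
    "homog (d + int l * int (card I) * (int n - 1)) Q"
proof
  let ?g = "\<Prod>i\<in>I. pd G i"
  have "emb ?g ^ l = emb ?g ^ k * emb ?g ^ (l - k)" using assms(2) by (simp flip: power_add)
  then show "emb P / emb ?g ^ k = emb (P * ?g ^ (l - k)) / emb ?g ^ l" by simp
  have "homog (d + int k * int (card I) * (int n - 1) + int (l - k) * int (card I) * (int n - 1)) (P * ?g ^ (l - k))"
    by (intro homog_mult assms homog_prod_power)
  moreover have "d + int k * int (card I) * (int n - 1) + int (l - k) * int (card I) * (int n - 1)
      = d + int l * int (card I) * (int n - 1)" using assms(2) by (simp add: of_nat_diff algebra_simps)
  ultimately show "homog (d + int l * int (card I) * (int n - 1)) (P * ?g ^ (l - k))" by simp
qed

lemma R_mult:
  assumes "f \<in> R I d" "h \<in> R I e"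
  shows "f * h \<in> R I (d + e)"
proof -
  let ?g = "\<Prod>i\<in>I. pd G i"
  from assms(1) obtain P k where P: "f = emb P / emb ?g ^ k" "homog (d + int k * int (card I) * (int n - 1)) P" by (rule R_E)
  from assms(2) obtain Q l where Q: "h = emb Q / emb ?g ^ l" "homog (e + int l * int (card I) * (int n - 1)) Q" by (rule R_E)
  have "homog (d + int k * int (card I) * (int n - 1) + (e + int l * int (card I) * (int n - 1))) (P * Q)"
    by (intro homog_mult P Q)
  moreover have "d + int k * int (card I) * (int n - 1) + (e + int l * int (card I) * (int n - 1))
      = d + e + int (k + l) * int (card I) * (int n - 1)" by (simp add: algebra_simps)
  ultimately have "homog (d + e + int (k + l) * int (card I) * (int n - 1)) (P * Q)" by simp
  from R_I[OF this] show ?thesis by (simp add: P(1) Q(1) power_add)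
qed

lemma R_add:
  assumes "f \<in> R I d" "h \<in> R I d"
  shows "f + h \<in> R I d"
proof -
  let ?g = "\<Prod>i\<in>I. pd G i"
  from assms(1) obtain P k where P: "f = emb P / emb ?g ^ k" "homog (d + int k * int (card I) * (int n - 1)) P" by (rule R_E)
  from assms(2) obtain Q l where Q: "h = emb Q / emb ?g ^ l" "homog (d + int l * int (card I) * (int n - 1)) Q" by (rule R_E)
  obtain P' where P': "emb P / emb ?g ^ k = emb P' / emb ?g ^ max k l" "homog (d + int (max k l) * int (card I) * (int n - 1)) P'"
    using P(2) max.cobounded1 by (rule R_raise)
  obtain Q' where Q': "emb Q / emb ?g ^ l = emb Q' / emb ?g ^ max k l" "homog (d + int (max k l) * int (card I) * (int n - 1)) Q'"
    using Q(2) max.cobounded2 by (rule R_raise)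
  have "f + h = emb (P' + Q') / emb ?g ^ max k l" by (simp only: P(1) Q(1) P'(1) Q'(1) emb_simps add_divide_distrib)
  then show ?thesis using R_I[OF homog_add[OF P'(2) Q'(2)]] by simp
qed

lemma R_zero [simp]: "0 \<in> R I d"
  using R_poly[of d 0] by simp

lemma R_const: "emb (const c) \<in> R I 0"
  by (rule R_poly) simp

lemma R_uminus: "f \<in> R I d \<Longrightarrow> - f \<in> R I d"
  using R_mult[OF R_const[of "- 1"], of f I d] by simp

lemma R_sign: "f \<in> R I d \<Longrightarrow> (- 1) ^ k * f \<in> R I d"
  by (cases "even k") (simp_all add: R_uminus)

lemma R_sum: "(\<And>i. i \<in> A \<Longrightarrow> f i \<in> R I d) \<Longrightarrow> sum f A \<in> R I d"
  by (induction A rule: infinite_finite_induct) (auto intro: R_add)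

text \<open>Denominators in \<open>reg_fun\<close> are powers of the full product over I, so the
  other partial derivatives are put into the numerator.\<close>

lemma R_inverse:
  assumes "i \<in> I"
  shows "1 / emb (pd G i) \<in> R I (1 - int n)"
proof -
  have g: "(\<Prod>i\<in>I. pd G i) = pd G i * (\<Prod>i\<in>I - {i}. pd G i)" using assms by (simp add: prod.remove)
  have "homog (int (card (I - {i})) * (int n - 1)) (\<Prod>i\<in>I - {i}. pd G i)"
    by (intro homog_prod homog_pdG) simp
  moreover have "card I \<ge> 1" using assms by (auto simp: Suc_le_eq card_gt_0_iff)
  then have "int (card (I - {i})) * (int n - 1) = 1 - int n + int 1 * int (card I) * (int n - 1)"
    using assms by (simp add: of_nat_diff algebra_simps)
  ultimately have "homog (1 - int n + int 1 * int (card I) * (int n - 1)) (\<Prod>i\<in>I - {i}. pd G i)" by simp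
  from R_I[OF this] show ?thesis unfolding g by simp
qed

lemma R_mono:
  assumes "I \<subseteq> I'" "f \<in> R I d"
  shows "f \<in> R I' d"
proof -
  from assms(2) obtain P k where P: "f = emb P / emb (\<Prod>i\<in>I. pd G i) ^ k" "homog (d + int k * int (card I) * (int n - 1)) P" by (rule R_E)
  have g: "(\<Prod>i\<in>I'. pd G i) = (\<Prod>i\<in>I. pd G i) * (\<Prod>i\<in>I' - I. pd G i)"
    using prod.subset_diff[OF assms(1), of "pd G"] by (simp add: mult.commute)
  have "homog (d + int k * int (card I) * (int n - 1) + int k * int (card (I' - I)) * (int n - 1)) (P * (\<Prod>i\<in>I' - I. pd G i) ^ k)"
    by (intro homog_mult P homog_prod_power)
  moreover have "card I' = card I + card (I' - I)"
    using card_mono[OF finite assms(1)] by (simp add: card_Diff_subset assms(1))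
  then have "d + int k * int (card I) * (int n - 1) + int k * int (card (I' - I)) * (int n - 1)
      = d + int k * int (card I') * (int n - 1)" by (simp add: algebra_simps)
  ultimately have "homog (d + int k * int (card I') * (int n - 1)) (P * (\<Prod>i\<in>I' - I. pd G i) ^ k)" by simp
  from R_I[OF this] show ?thesis
    unfolding g P(1) by (simp add: power_mult_distrib)
qed

end

section \<open>Logarithmic forms and residues\<close>

context smooth_plane_curve
begin

abbreviation "Om \<equiv> Omega_P2 n G"
abbreviation "Z \<equiv> zero_on_X n G 1"
abbreviation "ld \<equiv> log_decomp n G"

section \<open>Calculus of regular forms on the cone\<close>

lemma C_I:
  assumes "\<And>S. card S = p \<Longrightarrow> \<alpha> $ S \<in> R I (d - int p)" "\<And>S. card S \<noteq> p \<Longrightarrow> \<alpha> $ S = 0"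
  shows "\<alpha> \<in> C p d I"
  unfolding cone_forms_def using assms by simp

lemma C_D:
  assumes "\<alpha> \<in> C p d I"
  shows "card S = p \<Longrightarrow> \<alpha> $ S \<in> R I (d - int p)" "card S \<noteq> p \<Longrightarrow> \<alpha> $ S = 0"
  using assms unfolding cone_forms_def by (auto dest: spec[of _ S])

lemma C_zero [simp]: "0 \<in> C p d I"
  by (rule C_I) simp_all

lemma C_add:
  assumes "\<alpha> \<in> C p d I" "\<beta> \<in> C p d I"
  shows "\<alpha> + \<beta> \<in> C p d I"
  by (rule C_I) (simp_all add: R_add C_D[OF assms(1)] C_D[OF assms(2)])

lemma C_scale:
  assumes "f \<in> R I e" "\<alpha> \<in> C p d I"
  shows "f *s \<alpha> \<in> C p (e + d) I"
proof (rule C_I)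
  show "(f *s \<alpha>) $ S \<in> R I (e + d - int p)" if "card S = p" for S
    using R_mult[OF assms(1) C_D(1)[OF assms(2) that]] by (simp add: add_diff_eq)
  show "(f *s \<alpha>) $ S = 0" if "card S \<noteq> p" for S using C_D(2)[OF assms(2) that] by simp
qed

lemma C_uminus: "\<alpha> \<in> C p d I \<Longrightarrow> - \<alpha> \<in> C p d I"
  by (rule C_I) (simp_all add: R_uminus C_D)

lemma C_mono:
  assumes "I \<subseteq> I'" "\<alpha> \<in> C p d I"
  shows "\<alpha> \<in> C p d I'"
  by (rule C_I) (simp_all add: R_mono[OF assms(1)] C_D[OF assms(2)])

lemma C_wedge:
  assumes "\<alpha> \<in> C p d I" "\<beta> \<in> C q e I"
  shows "wedge \<alpha> \<beta> \<in> C (p + q) (d + e) I"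
proof (rule C_I)
  fix S :: "3 set"
  have card: "card S = card T + card (S - T)" if "T \<in> Pow S" for T
    using that card_mono[of S T] by (simp add: card_Diff_subset)
  show "wedge \<alpha> \<beta> $ S \<in> R I (d + e - int (p + q))" if "card S = p + q"
    unfolding wedge_def vec_lambda_beta
  proof (rule R_sum)
    fix T assume T: "T \<in> Pow S"
    have "\<alpha> $ T * \<beta> $ (S - T) \<in> R I (d + e - int (p + q))"
    proof (cases "card T = p")
      case True
      then have "card (S - T) = q" using card[OF T] that by simp
      from R_mult[OF C_D(1)[OF assms(1) True] C_D(1)[OF assms(2) this]]
      show ?thesis by (simp add: algebra_simps)
    next
      case False
      then show ?thesis by (simp add: C_D(2)[OF assms(1)])
    qed
    then have "(- 1) ^ card {(a, b). a \<in> T \<and> b \<in> S - T \<and> b < a} * (\<alpha> $ T * \<beta> $ (S - T)) \<in> R I (d + e - int (p + q))"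
      by (rule R_sign)
    then show "(- 1) ^ card {(a, b). a \<in> T \<and> b \<in> S - T \<and> b < a} * \<alpha> $ T * \<beta> $ (S - T) \<in> R I (d + e - int (p + q))"
      by (simp only: mult.assoc)
  qed
  show "wedge \<alpha> \<beta> $ S = 0" if "card S \<noteq> p + q"
    unfolding wedge_def vec_lambda_beta
  proof (rule sum.neutral, rule ballI)
    fix T assume T: "T \<in> Pow S"
    have "card T \<noteq> p \<or> card (S - T) \<noteq> q" using card[OF T] that by auto
    then have "\<alpha> $ T * \<beta> $ (S - T) = 0"
      using C_D(2)[OF assms(1), of T] C_D(2)[OF assms(2), of "S - T"] by (elim disjE) simp_all
    then show "(- 1) ^ card {(a, b). a \<in> T \<and> b \<in> S - T \<and> b < a} * \<alpha> $ T * \<beta> $ (S - T) = 0"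
      by (simp only: mult.assoc mult_zero_right)
  qed
qed

lemma C_dpoly:
  assumes "homog d P"
  shows "dpoly P \<in> C 1 d I"
proof -
  have pd: "emb (pd P i) \<in> R I (d - 1)" for i by (intro R_poly homog_pd assms)
  have "\<forall>S. if card S = 1 then dpoly P $ S \<in> R I (d - int 1) else dpoly P $ S = 0"
    unfolding all_3set by (simp add: dpoly_component set3_eq_iff pd)
  then show ?thesis unfolding cone_forms_def by (rule CollectI)
qed

lemma C_vol: "K_op i vol \<in> C 2 2 I"
proof (rule C_I)
  fix S :: "3 set"
  show "K_op i vol $ S \<in> R I (2 - int 2)" if "card S = 2"
  proof -
    have "1 \<in> R I 0" using R_const[of 1 I] by simp
    then have "\<forall>x\<in>{0, 1, - 1}. x \<in> R I 0" using R_uminus[of 1 I 0] by simp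
    then show ?thesis using K_op_vol_component[OF that, of i] by auto
  qed
  show "K_op i vol $ S = 0" if "card S \<noteq> 2" using that by (rule K_op_vol_zero)
qed

lemma C_K_op_Omega: "K_op i Omega_vol \<in> C 1 2 I"
proof -
  have x: "emb (xv j) \<in> R I 1" for j by (intro R_poly homog_xv)
  have "\<forall>i. \<forall>S. if card S = 1 then K_op i Omega_vol $ S \<in> R I (2 - int 1) else K_op i Omega_vol $ S = 0"
    unfolding all_three all_3set by (simp add: K_op_Omega_component K_op_Omega_zero x R_uminus)
  then show ?thesis unfolding cone_forms_def by (intro CollectI) (rule spec)
qed

lemma C_Omega: "Omega_vol \<in> C 2 3 I"
proof -
  have x: "emb (xv j) \<in> R I 1" for j by (intro R_poly homog_xv)
  have "\<forall>S. if card S = 2 then Omega_vol $ S \<in> R I (3 - int 2) else Omega_vol $ S = 0"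
    unfolding all_3set by (simp add: Omega_vol_component x R_uminus)
  then show ?thesis unfolding cone_forms_def by (rule CollectI)
qed

lemma Om_iff: "\<alpha> \<in> Om p I \<longleftrightarrow> \<alpha> \<in> C p 0 I \<and> contract euler \<alpha> = 0"
  by (simp add: Omega_P2_def)

lemma Om_zero [simp]: "0 \<in> Om p I"
  by (simp add: Om_iff)

lemma Om_add: "\<alpha> \<in> Om p I \<Longrightarrow> \<beta> \<in> Om p I \<Longrightarrow> \<alpha> + \<beta> \<in> Om p I"
  by (simp add: Om_iff C_add contract_add)

lemma Om_uminus: "\<alpha> \<in> Om p I \<Longrightarrow> - \<alpha> \<in> Om p I"
  by (simp add: Om_iff C_uminus contract_uminus)

lemma Om_diff: "\<alpha> \<in> Om p I \<Longrightarrow> \<beta> \<in> Om p I \<Longrightarrow> \<alpha> - \<beta> \<in> Om p I"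
  using Om_add[of \<alpha> p I "- \<beta>"] Om_uminus by simp

lemma Om_mono: "I \<subseteq> I' \<Longrightarrow> \<alpha> \<in> Om p I \<Longrightarrow> \<alpha> \<in> Om p I'"
  by (simp add: Om_iff C_mono)

lemma Z_iff: "\<omega> \<in> Z I \<longleftrightarrow> \<omega> \<in> Om 1 I \<and>
    (\<exists>\<alpha> \<beta>. \<alpha> \<in> C 1 (- int n) I \<and> \<beta> \<in> C 0 (- int n) I \<and> \<omega> = emb G *s \<alpha> + wedge (dpoly G) \<beta>)"
  unfolding zero_on_X_def by auto

lemma Z_zero [simp]: "0 \<in> Z I"
  unfolding Z_iff by (intro conjI exI[of _ 0]) simp_all

lemma Z_add:
  assumes "\<omega> \<in> Z I" "\<omega>' \<in> Z I"
  shows "\<omega> + \<omega>' \<in> Z I"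
proof -
  from assms(1) obtain \<alpha> \<beta> where 1: "\<omega> \<in> Om 1 I" "\<alpha> \<in> C 1 (- int n) I" "\<beta> \<in> C 0 (- int n) I"
    "\<omega> = emb G *s \<alpha> + wedge (dpoly G) \<beta>" unfolding Z_iff by (elim conjE exE)
  from assms(2) obtain \<alpha>' \<beta>' where 2: "\<omega>' \<in> Om 1 I" "\<alpha>' \<in> C 1 (- int n) I" "\<beta>' \<in> C 0 (- int n) I"
    "\<omega>' = emb G *s \<alpha>' + wedge (dpoly G) \<beta>'" unfolding Z_iff by (elim conjE exE)
  have "\<omega> + \<omega>' = emb G *s (\<alpha> + \<alpha>') + wedge (dpoly G) (\<beta> + \<beta>')"
    unfolding 1(4) 2(4) wedge_add_right vector_add_ldistrib by simp
  then show ?thesis unfolding Z_iff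
    using Om_add[OF 1(1) 2(1)] C_add[OF 1(2) 2(2)] C_add[OF 1(3) 2(3)] by (intro conjI exI)
qed

lemma Z_uminus:
  assumes "\<omega> \<in> Z I"
  shows "- \<omega> \<in> Z I"
proof -
  from assms(1) obtain \<alpha> \<beta> where 1: "\<omega> \<in> Om 1 I" "\<alpha> \<in> C 1 (- int n) I" "\<beta> \<in> C 0 (- int n) I"
    "\<omega> = emb G *s \<alpha> + wedge (dpoly G) \<beta>" unfolding Z_iff by (elim conjE exE)
  have "- \<omega> = emb G *s (- \<alpha>) + wedge (dpoly G) (- \<beta>)"
    unfolding 1(4) by (simp add: wedge_def vec_eq_iff sum_negf)
  then show ?thesis unfolding Z_iff
    using Om_uminus[OF 1(1)] C_uminus[OF 1(2)] C_uminus[OF 1(3)] by (intro conjI exI)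
qed

lemma Z_diff: "\<alpha> \<in> Z I \<Longrightarrow> \<beta> \<in> Z I \<Longrightarrow> \<alpha> - \<beta> \<in> Z I"
  using Z_add[of \<alpha> I "- \<beta>"] Z_uminus by simp

text \<open>Stating the regular part as a difference makes the relation visibly additive and
  monotone in I.\<close>

lemma ld_iff: "ld I \<omega> \<alpha> \<longleftrightarrow> contract euler \<omega> = 0 \<and> \<alpha> \<in> Om 1 I \<and>
    \<omega> - wedge \<alpha> ((1 / emb G) *s dpoly G) \<in> C 2 0 I"
proof -
  have "(\<exists>\<beta>\<in>C 2 0 I. \<omega> = \<gamma> + \<beta>) \<longleftrightarrow> \<omega> - \<gamma> \<in> C 2 0 I" for \<gamma>
  proof
    assume "\<omega> - \<gamma> \<in> C 2 0 I"
    then show "\<exists>\<beta>\<in>C 2 0 I. \<omega> = \<gamma> + \<beta>" by (intro bexI[of _ "\<omega> - \<gamma>"]) simp_all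
  qed (auto simp: add.commute)
  then show ?thesis by (simp add: log_decomp_def)
qed

lemma ld_add:
  assumes "ld I \<omega> \<alpha>" "ld I \<omega>' \<alpha>'"
  shows "ld I (\<omega> + \<omega>') (\<alpha> + \<alpha>')"
proof -
  let ?g = "(1 / emb G) *s dpoly G"
  have "\<omega> + \<omega>' - wedge (\<alpha> + \<alpha>') ?g = (\<omega> - wedge \<alpha> ?g) + (\<omega>' - wedge \<alpha>' ?g)"
    by (simp add: wedge_add_left)
  then have "\<omega> + \<omega>' - wedge (\<alpha> + \<alpha>') ?g \<in> C 2 0 I"
    using assms by (simp only: ld_iff C_add)
  then show ?thesis using assms by (simp add: ld_iff contract_add Om_add)
qed

lemma ld_uminus:
  assumes "ld I \<omega> \<alpha>"
  shows "ld I (- \<omega>) (- \<alpha>)"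
proof -
  let ?g = "(1 / emb G) *s dpoly G"
  have "- \<omega> - wedge (- \<alpha>) ?g = - (\<omega> - wedge \<alpha> ?g)"
    unfolding uminus_form[of \<alpha>] wedge_smult_left by (simp add: uminus_form[symmetric])
  then have "- \<omega> - wedge (- \<alpha>) ?g \<in> C 2 0 I"
    using assms by (simp only: ld_iff C_uminus)
  then show ?thesis using assms by (simp add: ld_iff contract_uminus Om_uminus)
qed

lemma ld_diff: "ld I \<omega> \<alpha> \<Longrightarrow> ld I \<omega>' \<alpha>' \<Longrightarrow> ld I (\<omega> - \<omega>') (\<alpha> - \<alpha>')"
  using ld_add[of I \<omega> \<alpha> "- \<omega>'" "- \<alpha>'"] ld_uminus by simp

lemma ld_mono: "I \<subseteq> I' \<Longrightarrow> ld I \<omega> \<alpha> \<Longrightarrow> ld I' \<omega> \<alpha>"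
  by (simp add: ld_iff Om_mono C_mono)

text \<open>
  The lift is \<open>\<psi> \<and> (dG/G - n/(n-1) dG\<^sub>i/G\<^sub>i)\<close>, whose second factor is killed by the Euler field.
\<close>

lemma log_lift_exists:
  assumes \<psi>: "\<psi> \<in> Om 1 I" and i: "i \<in> I"
  shows "\<exists>\<omega>. ld I \<omega> \<psi>"
proof -
  \<comment> \<open>Contraction with the Euler field sends dG/G and dG_i/G_i to their degrees n and
    n - 1; the constant balances the two.\<close>
  define c where "c = emb (const (- (of_nat n / of_nat (n - 1)))) * (1 / emb (pd G i))"
  define \<eta> where "\<eta> = (1 / emb G) *s dpoly G + c *s dpoly (pd G i)"
  have c: "c \<in> R I (0 + (1 - int n))" unfolding c_def by (intro R_mult R_const R_inverse i)
  have \<psi>C: "\<psi> \<in> C 1 0 I" "contract euler \<psi> = 0" using \<psi> by (simp_all add: Om_iff)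
  have \<eta>C: "\<eta> $ S = 0" if "card S \<noteq> 1" for S
    unfolding \<eta>_def using C_D(2)[OF C_dpoly[OF homG] that] C_D(2)[OF C_dpoly[OF homog_pdG] that]
    by simp
  have hom: "homog (int (n - 1)) (pd G i)" using homog_pdG[of i] n by (simp add: of_nat_diff)
  define k :: complex where "k = - (of_nat n / of_nat (n - 1))"
  have "c * (of_nat (n - 1) * emb (pd G i)) = emb (const k) * of_nat (n - 1)"
    by (simp add: c_def k_def)
  also have "\<dots> = emb (const (k * of_nat (n - 1)))"
    by (simp only: const_simps(4) emb_simps(4) const_of_nat emb_of_nat)
  also have "k * of_nat (n - 1) = - of_nat n" using n by (simp add: k_def)
  also have "emb (const (- of_nat n)) = - of_nat n" by (simp add: const_of_nat)
  finally have cn: "c * (of_nat (n - 1) * emb (pd G i)) = - of_nat n" .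
  have "contract euler \<eta> $ {} = (1 / emb G) * (of_nat n * emb G) + c * (of_nat (n - 1) * emb (pd G i))"
    unfolding \<eta>_def contract_add contract_smult
    by (simp add: contract_euler_dpoly[OF homG] contract_euler_dpoly[OF hom])
  also have "\<dots> = 0" unfolding cn by simp
  finally have "contract euler (wedge \<psi> \<eta>) = 0"
    using contract_wedge_one_forms[OF C_D(2)[OF \<psi>C(1)] \<eta>C] \<psi>C(2) by simp
  moreover have "wedge \<psi> \<eta> - wedge \<psi> ((1 / emb G) *s dpoly G) \<in> C 2 0 I"
  proof -
    have "c *s dpoly (pd G i) \<in> C 1 (0 + (1 - int n) + (int n - 1)) I"
      by (intro C_scale c C_dpoly homog_pdG)
    then have "c *s dpoly (pd G i) \<in> C 1 0 I" by simp
    from C_wedge[OF \<psi>C(1) this] have "wedge \<psi> (c *s dpoly (pd G i)) \<in> C 2 0 I"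
      unfolding one_add_one by simp
    then show ?thesis by (simp add: \<eta>_def wedge_add_right)
  qed
  ultimately have "ld I (wedge \<psi> \<eta>) \<psi>" using \<psi> by (simp add: ld_iff)
  then show ?thesis by (rule exI)
qed

text \<open>For \<alpha> = G a + b dG the product with dG/G is the regular form a \<and> dG, because
  dG \<and> dG = 0. This is exactness of the residue sequence in the middle.\<close>

lemma log_zero_residue_regular:
  assumes ld: "ld I \<omega> \<alpha>" and Z: "\<alpha> \<in> Z I"
  shows "\<omega> \<in> Om 2 I"
proof -
  from Z obtain a b where a: "a \<in> C 1 (- int n) I" and b: "b \<in> C 0 (- int n) I"
    and \<alpha>: "\<alpha> = emb G *s a + wedge (dpoly G) b" unfolding Z_iff by (elim conjE exE)
  have b0: "b $ S = 0" if "S \<noteq> {}" for S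
    using C_D(2)[OF b, of S] that by simp
  have "wedge (dpoly G) b = (b $ {}) *s dpoly G" by (rule wedge_zero_form_right) (rule b0)
  then have "wedge \<alpha> ((1 / emb G) *s dpoly G) = wedge a (dpoly G)"
    unfolding \<alpha> by (simp add: wedge_add_left wedge_smult_left wedge_smult_right wedge_dpoly_self vector_smult_assoc)
  moreover have "wedge a (dpoly G) \<in> C (1 + 1) (- int n + int n) I"
    by (intro C_wedge a C_dpoly homG)
  then have "wedge a (dpoly G) \<in> C 2 0 I" unfolding one_add_one by simp
  ultimately have "(\<omega> - wedge \<alpha> ((1 / emb G) *s dpoly G)) + wedge \<alpha> ((1 / emb G) *s dpoly G) \<in> C 2 0 I"
    using ld unfolding ld_iff by (intro C_add) simp_all
  then show ?thesis using ld unfolding ld_iff Om_iff by simp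
qed

text \<open>After division by G, the term n G K_i vol of \<open>wedge_K_op_Omega_dpoly\<close> loses
  its pole and becomes the regular part. The degree -2 of c gives the residue form degree 0.\<close>

lemma log_lift_Omega:
  assumes c: "c \<in> R I (- 2)"
  shows "ld I (- (c * emb (pd G i) / emb G) *s Omega_vol) (c *s K_op i Omega_vol)"
proof -
  have "c *s K_op i Omega_vol \<in> C 1 (- 2 + 2) I" by (intro C_scale c C_K_op_Omega)
  then have 1: "c *s K_op i Omega_vol \<in> Om 1 I"
    by (simp add: Om_iff contract_smult contract_euler_K_op_Omega)
  have "wedge (c *s K_op i Omega_vol) ((1 / emb G) *s dpoly G)
      = (c * (1 / emb G)) *s wedge (K_op i Omega_vol) (dpoly G)"
    by (simp only: wedge_smult_left wedge_smult_right vector_smult_assoc mult.commute)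
  also have "\<dots> = (of_nat n * c) *s K_op i vol - (c * emb (pd G i) / emb G) *s Omega_vol"
    unfolding wedge_K_op_Omega_dpoly[OF homG] by (simp add: vec_eq_iff field_simps)
  finally have "- (c * emb (pd G i) / emb G) *s Omega_vol - wedge (c *s K_op i Omega_vol) ((1 / emb G) *s dpoly G)
      = - ((of_nat n * c) *s K_op i vol)"
    by (simp add: vec_eq_iff)
  moreover have "- ((of_nat n * c) *s K_op i vol) \<in> C 2 (0 + - 2 + 2) I"
  proof (intro C_uminus C_scale C_vol R_mult c)
    show "of_nat n \<in> R I 0" using R_const[of "of_nat n" I] by (simp add: const_of_nat)
  qed
  moreover have "contract euler (- (c * emb (pd G i) / emb G) *s Omega_vol) = 0"
    by (simp only: contract_smult contract_euler_Omega) (simp add: vec_eq_iff)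
  ultimately show ?thesis using 1 by (simp add: ld_iff)
qed

end

section \<open>Cech classes and the connecting map\<close>

lemma idx_1: "idx 1 = {[0, 1], [0, 2], [1, 2]}"
proof (rule set_eqI)
  fix s :: "3 list"
  show "s \<in> idx 1 \<longleftrightarrow> s \<in> {[0, 1], [0, 2], [1, 2]}"
  proof (cases "length s = 2")
    case True
    then obtain a b where s: "s = [a, b]" by (auto simp: length_Suc_conv numeral_eq_Suc)
    show ?thesis unfolding s using three_cases[of a] three_cases[of b] by (elim disjE) (simp_all add: idx_def)
  qed (auto simp: idx_def)
qed

lemma idx_2: "idx 2 = {[0, 1, 2]}"
proof (rule set_eqI)
  fix s :: "3 list"
  show "s \<in> idx 2 \<longleftrightarrow> s \<in> {[0, 1, 2]}"
  proof (cases "length s = 3")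
    case True
    then obtain a b c where s: "s = [a, b, c]" by (auto simp: length_Suc_conv numeral_eq_Suc)
    show ?thesis unfolding s using three_cases[of a] three_cases[of b] three_cases[of c]
      by (elim disjE) (simp_all add: idx_def)
  qed (auto simp: idx_def)
qed

lemma cech_d_0:
  assumes "s \<in> idx 1"
  shows "cech_d 0 \<psi> s = \<psi> [s ! 1] - \<psi> [s ! 0]"
proof -
  have "length s = 2" using assms by (simp add: idx_def)
  then obtain a b where s: "s = [a, b]" by (auto simp: length_Suc_conv numeral_eq_Suc)
  show ?thesis using assms unfolding s cech_d_def by (simp add: lessThan_Suc vec_eq_iff)
qed

lemma cech_d_1: "cech_d 1 \<phi> [0, 1, 2] = \<phi> [1, 2] - \<phi> [0, 2] + \<phi> [0, 1]"
proof -
  have "[0, 1, 2 :: 3] \<in> idx (1 + 1)" unfolding one_add_one by (simp add: idx_2)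
  then show ?thesis by (simp add: cech_d_def lessThan_Suc vec_eq_iff)
qed

lemma cech_d_1_outside: "s \<noteq> [0, 1, 2] \<Longrightarrow> cech_d 1 \<phi> s = 0"
  unfolding cech_d_def one_add_one by (simp add: idx_2)

lemma cech_d_1_eqI:
  assumes "\<phi> [1, 2] - \<phi> [0, 2] + \<phi> [0, 1] = \<Phi> [0, 1, 2]" "\<And>s. s \<noteq> [0, 1, 2] \<Longrightarrow> \<Phi> s = 0"
  shows "cech_d 1 \<phi> = \<Phi>"
proof
  fix s
  show "cech_d 1 \<phi> s = \<Phi> s"
  proof (cases "s = [0, 1, 2]")
    case True
    then show ?thesis using assms(1) by (simp only: cech_d_1)
  next
    case False
    then show ?thesis using assms(2)[OF False] cech_d_1_outside[OF False] by simp
  qed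
qed

lemma cech_d_1_add: "cech_d 1 (\<phi> + \<psi>) = cech_d 1 \<phi> + cech_d 1 \<psi>"
proof (rule cech_d_1_eqI)
  show "(\<phi> + \<psi>) [1, 2] - (\<phi> + \<psi>) [0, 2] + (\<phi> + \<psi>) [0, 1] = (cech_d 1 \<phi> + cech_d 1 \<psi>) [0, 1, 2]"
    unfolding plus_fun_apply cech_d_1 by simp
  show "(cech_d 1 \<phi> + cech_d 1 \<psi>) s = 0" if "s \<noteq> [0, 1, 2]" for s
    unfolding plus_fun_apply cech_d_1_outside[OF that] by simp
qed

lemma cech_d_1_uminus: "cech_d 1 (- \<phi>) = - cech_d 1 \<phi>"
proof (rule cech_d_1_eqI)
  show "(- \<phi>) [1, 2] - (- \<phi>) [0, 2] + (- \<phi>) [0, 1] = (- cech_d 1 \<phi>) [0, 1, 2]"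
    unfolding uminus_apply cech_d_1 by simp
  show "(- cech_d 1 \<phi>) s = 0" if "s \<noteq> [0, 1, 2]" for s
    unfolding uminus_apply cech_d_1_outside[OF that] by simp
qed

lemma cochainsD: "\<phi> \<in> cochains q S \<Longrightarrow> s \<in> idx q \<Longrightarrow> \<phi> s \<in> S (set s)"
  unfolding cochains_def by (auto dest: spec[of _ s])

context smooth_plane_curve
begin

lemma H1_iff: "\<phi>' \<in> H1_X n G \<phi> \<longleftrightarrow> \<phi>' \<in> cochains 1 (Om 1) \<and>
    (\<exists>\<psi>\<in>cochains 0 (Om 1). \<phi>' - \<phi> - cech_d 0 \<psi> \<in> cochains 1 Z)"
  by (simp add: H1_X_def cech_class_def)

lemma H2_iff: "\<phi>' \<in> H2_P2 n G \<phi> \<longleftrightarrow> \<phi>' \<in> cochains 2 (Om 2) \<and>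
    (\<exists>\<psi>\<in>cochains 1 (Om 2). \<phi>' - \<phi> - cech_d 1 \<psi> \<in> cochains 2 (\<lambda>_. {0}))"
  by (simp add: H2_P2_def cech_class_def)

text \<open>A class is the set of its representatives, so changing \<Phi> by a coboundary is
  absorbed by translating the witness \<psi>; using -\<theta> gives the reverse inclusion.\<close>

lemma H2_subset:
  assumes "\<theta> \<in> cochains 1 (Om 2)" "\<Phi> = \<Phi>' + cech_d 1 \<theta>"
  shows "H2_P2 n G \<Phi> \<subseteq> H2_P2 n G \<Phi>'"
proof
  fix \<phi> assume "\<phi> \<in> H2_P2 n G \<Phi>"
  then obtain \<psi> where \<phi>: "\<phi> \<in> cochains 2 (Om 2)" and \<psi>: "\<psi> \<in> cochains 1 (Om 2)"
    and eq: "\<phi> - \<Phi> - cech_d 1 \<psi> \<in> cochains 2 (\<lambda>_. {0})"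
    unfolding H2_iff by (elim conjE bexE)
  have "\<psi> + \<theta> \<in> cochains 1 (Om 2)"
    using \<psi> assms(1) by (simp add: cochains_def Om_add)
  moreover have "\<phi> - \<Phi>' - cech_d 1 (\<psi> + \<theta>) = \<phi> - \<Phi> - cech_d 1 \<psi>"
    unfolding assms(2) cech_d_1_add by (simp add: algebra_simps)
  then have "\<phi> - \<Phi>' - cech_d 1 (\<psi> + \<theta>) \<in> cochains 2 (\<lambda>_. {0})" by (simp only: eq)
  ultimately show "\<phi> \<in> H2_P2 n G \<Phi>'"
    unfolding H2_iff using \<phi> by (intro conjI bexI[of _ "\<psi> + \<theta>"])
qed

lemma H2_eq:
  assumes "\<theta> \<in> cochains 1 (Om 2)" "\<Phi> = \<Phi>' + cech_d 1 \<theta>"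
  shows "H2_P2 n G \<Phi> = H2_P2 n G \<Phi>'"
proof (rule equalityI)
  show "H2_P2 n G \<Phi> \<subseteq> H2_P2 n G \<Phi>'" by (rule H2_subset[OF assms])
  have "- \<theta> \<in> cochains 1 (Om 2)" using assms(1) by (simp add: cochains_def Om_uminus)
  moreover have "\<Phi>' = \<Phi> + cech_d 1 (- \<theta>)" unfolding assms(2) cech_d_1_uminus by simp
  ultimately show "H2_P2 n G \<Phi>' \<subseteq> H2_P2 n G \<Phi>" by (rule H2_subset)
qed

lemma H1_components:
  assumes "\<phi>' \<in> H1_X n G \<phi>"
  shows "\<exists>\<psi>\<in>cochains 0 (Om 1). \<forall>s\<in>idx 1. \<phi>' s - \<phi> s - cech_d 0 \<psi> s \<in> Z (set s)"
proof -
  from assms obtain \<psi> where \<psi>: "\<psi> \<in> cochains 0 (Om 1)" "\<phi>' - \<phi> - cech_d 0 \<psi> \<in> cochains 1 Z"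
    unfolding H1_iff by (elim conjE bexE)
  have "\<phi>' s - \<phi> s - cech_d 0 \<psi> s \<in> Z (set s)" if "s \<in> idx 1" for s
    using cochainsD[OF \<psi>(2) that] by (simp only: fun_diff_def)
  with \<psi>(1) show ?thesis by (intro bexI[of _ \<psi>] ballI)
qed

text \<open>Modulo forms vanishing on X, the two representatives differ by the coboundary of \<psi>1
  - \<psi>2. This 0-cochain lifts to logarithmic forms l. Then \<omega>1 - \<omega>2 - \<delta>l has
  zero residue on X, so it is a regular cochain \<theta>, and since \<delta>\<delta>l = 0 the
  coboundaries of \<omega>1 and \<omega>2 differ by that of \<theta>.\<close>

lemma connecting_unique:
  assumes 1: "\<phi>1 \<in> H1_X n G \<phi>" "\<And>s. s \<in> idx 1 \<Longrightarrow> has_residue n G (set s) (\<omega>1 s) (\<phi>1 s)"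
    and 2: "\<phi>2 \<in> H1_X n G \<phi>" "\<And>s. s \<in> idx 1 \<Longrightarrow> has_residue n G (set s) (\<omega>2 s) (\<phi>2 s)"
  shows "H2_P2 n G (cech_d 1 \<omega>1) = H2_P2 n G (cech_d 1 \<omega>2)"
proof -
  from H1_components[OF 1(1)] obtain \<psi>1 where \<psi>1: "\<psi>1 \<in> cochains 0 (Om 1)"
    "\<forall>s\<in>idx 1. \<phi>1 s - \<phi> s - cech_d 0 \<psi>1 s \<in> Z (set s)" by (elim bexE)
  from H1_components[OF 2(1)] obtain \<psi>2 where \<psi>2: "\<psi>2 \<in> cochains 0 (Om 1)"
    "\<forall>s\<in>idx 1. \<phi>2 s - \<phi> s - cech_d 0 \<psi>2 s \<in> Z (set s)" by (elim bexE)
  have "\<exists>\<omega>. ld {i} \<omega> (\<psi>1 [i] - \<psi>2 [i])" for i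
  proof (rule log_lift_exists)
    have "[i] \<in> idx 0" by (simp add: idx_def)
    then show "\<psi>1 [i] - \<psi>2 [i] \<in> Om 1 {i}"
      using cochainsD[OF \<psi>1(1), of "[i]"] cochainsD[OF \<psi>2(1), of "[i]"] by (simp add: Om_diff)
  qed simp
  then have "\<exists>l. \<forall>i. ld {i} (l i) (\<psi>1 [i] - \<psi>2 [i])" by (intro choice allI)
  then obtain l where l': "\<forall>i. ld {i} (l i) (\<psi>1 [i] - \<psi>2 [i])" by (elim exE)
  note l = spec[OF l']
  define \<theta> where "\<theta> s = (if s \<in> idx 1 then \<omega>1 s - \<omega>2 s - (l (s ! 1) - l (s ! 0)) else 0)" for s
  have "\<theta> s \<in> Om 2 (set s)" if s: "s \<in> idx 1" for s
  proof -
    from 1(2)[OF s] obtain \<alpha>1 where \<alpha>1: "ld (set s) (\<omega>1 s) \<alpha>1" "\<alpha>1 - \<phi>1 s \<in> Z (set s)"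
      unfolding has_residue_def by (elim exE conjE)
    from 2(2)[OF s] obtain \<alpha>2 where \<alpha>2: "ld (set s) (\<omega>2 s) \<alpha>2" "\<alpha>2 - \<phi>2 s \<in> Z (set s)"
      unfolding has_residue_def by (elim exE conjE)
    have len: "length s = 2" using s by (simp add: idx_def)
    have "ld (set s) (l (s ! k)) (\<psi>1 [s ! k] - \<psi>2 [s ! k])" if "k < 2" for k
      using that len by (intro ld_mono[OF _ l]) (simp add: nth_mem)
    then have ld: "ld (set s) (\<theta> s) (\<alpha>1 - \<alpha>2 - ((\<psi>1 [s ! 1] - \<psi>2 [s ! 1]) - (\<psi>1 [s ! 0] - \<psi>2 [s ! 0])))"
      using s by (simp add: \<theta>_def ld_diff \<alpha>1(1) \<alpha>2(1))
    \<comment> \<open>The residue of \<theta> is regrouped into four terms, each of which is zero on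
      X by one of the assumptions.\<close>
    have eq: "\<alpha>1 - \<alpha>2 - ((\<psi>1 [s ! 1] - \<psi>2 [s ! 1]) - (\<psi>1 [s ! 0] - \<psi>2 [s ! 0]))
        = ((\<alpha>1 - \<phi>1 s) - (\<alpha>2 - \<phi>2 s)) + ((\<phi>1 s - \<phi> s - cech_d 0 \<psi>1 s) - (\<phi>2 s - \<phi> s - cech_d 0 \<psi>2 s))"
      unfolding cech_d_0[OF s] by simp
    show ?thesis
    proof (rule log_zero_residue_regular[OF ld])
      show "\<alpha>1 - \<alpha>2 - ((\<psi>1 [s ! 1] - \<psi>2 [s ! 1]) - (\<psi>1 [s ! 0] - \<psi>2 [s ! 0])) \<in> Z (set s)"
        unfolding eq by (intro Z_add Z_diff \<alpha>1(2) \<alpha>2(2) bspec[OF \<psi>1(2) s] bspec[OF \<psi>2(2) s])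
    qed
  qed
  then have \<theta>: "\<theta> \<in> cochains 1 (Om 2)" by (simp add: cochains_def \<theta>_def)
  have "cech_d 1 \<omega>1 = cech_d 1 \<omega>2 + cech_d 1 \<theta>"
  proof (rule cech_d_1_eqI)
    show "\<omega>1 [1, 2] - \<omega>1 [0, 2] + \<omega>1 [0, 1] = (cech_d 1 \<omega>2 + cech_d 1 \<theta>) [0, 1, 2]"
      unfolding plus_fun_apply cech_d_1 by (simp add: \<theta>_def idx_1[unfolded One_nat_def])
    show "(cech_d 1 \<omega>2 + cech_d 1 \<theta>) s = 0" if "s \<noteq> [0, 1, 2]" for s
      using cech_d_1_outside[OF that] unfolding plus_fun_apply by simp
  qed
  with \<theta> show ?thesis by (rule H2_eq)
qed

lemma has_residueI: "ld I \<omega> \<alpha> \<Longrightarrow> has_residue n G I \<omega> \<alpha>"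
  unfolding has_residue_def by (rule exI[of _ \<alpha>]) (simp only: diff_self Z_zero simp_thms)

text \<open>One explicit lift satisfies the definite description in \<open>connecting\<close>, with
  \<phi> as representative of its own class; \<open>connecting_unique\<close> identifies every other
  candidate with it.\<close>

lemma connecting_eq:
  assumes \<phi>: "\<And>s. s \<notin> idx 1 \<Longrightarrow> \<phi> s = 0" and \<omega>: "\<And>s. s \<notin> idx 1 \<Longrightarrow> \<omega> s = 0"
    and ld: "\<And>s. s \<in> idx 1 \<Longrightarrow> ld (set s) (\<omega> s) (\<phi> s)"
  shows "connecting n G (H1_X n G \<phi>) = H2_P2 n G (cech_d 1 \<omega>)"
  unfolding connecting_def
proof (rule the_equality)
  have res: "has_residue n G (set s) (\<omega> s) (\<phi> s)" if "s \<in> idx 1" for s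
    using ld[OF that] by (rule has_residueI)
  have "\<phi> s \<in> Om 1 (set s)" if "s \<in> idx 1" for s using ld[OF that] by (simp add: ld_iff)
  then have "\<phi> \<in> cochains 1 (Om 1)" using \<phi> by (simp add: cochains_def)
  moreover have "0 \<in> cochains 0 (Om 1)" by (simp add: cochains_def)
  moreover have "cech_d 0 0 = 0"
    by (rule ext) (simp add: cech_d_def vec_eq_iff)
  then have "\<phi> - \<phi> - cech_d 0 0 \<in> cochains 1 Z"
    unfolding cochains_def by (simp add: Z_zero[unfolded One_nat_def])
  ultimately have mem: "\<phi> \<in> H1_X n G \<phi>" unfolding H1_iff by (intro conjI bexI[of _ 0])
  have "\<omega> s \<in> Omega2_log n G (set s)" if "s \<in> idx 1" for s
    unfolding Omega2_log_def using ld[OF that] by (intro CollectI exI)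
  then have "\<omega> \<in> cochains 1 (Omega2_log n G)" using \<omega> by (simp add: cochains_def)
  then show "\<exists>\<phi>\<in>H1_X n G \<phi>. \<exists>\<phi>'\<in>cochains 1 (Omega2_log n G).
      (\<forall>s\<in>idx 1. has_residue n G (set s) (\<phi>' s) (\<phi> s)) \<and> H2_P2 n G (cech_d 1 \<omega>) = H2_P2 n G (cech_d 1 \<phi>')"
    using mem res by (intro bexI[of _ \<phi>] bexI[of _ \<omega>] conjI ballI) simp_all
  fix e
  assume "\<exists>\<phi>\<in>H1_X n G \<phi>. \<exists>\<phi>'\<in>cochains 1 (Omega2_log n G).
      (\<forall>s\<in>idx 1. has_residue n G (set s) (\<phi>' s) (\<phi> s)) \<and> e = H2_P2 n G (cech_d 1 \<phi>')"
  then obtain \<phi>1 \<omega>1 where 1: "\<phi>1 \<in> H1_X n G \<phi>" "\<forall>s\<in>idx 1. has_residue n G (set s) (\<omega>1 s) (\<phi>1 s)"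
    and e: "e = H2_P2 n G (cech_d 1 \<omega>1)" by (elim bexE conjE)
  show "e = H2_P2 n G (cech_d 1 \<omega>)"
    unfolding e by (rule connecting_unique[OF 1(1) bspec[OF 1(2)] mem res])
qed

end

section \<open>The Grothendieck residue\<close>

lemma homog_xv_cancel:
  assumes "homog d (xv i * u)"
  shows "homog (d - 1) u"
  unfolding homog_def
proof
  fix m assume m: "m \<in> ks u"
  have "sg i 1 + m \<in> ks (xv i * u)" using mem_keys_xv_power_mult[OF m, of i 1] by simp
  then have "int (\<Sum>j\<in>UNIV. lk (sg i 1 + m) j) = d" using assms unfolding homog_def by (rule bspec[rotated])
  moreover have "(\<Sum>j\<in>UNIV. lk (sg i 1 + m) j) = 1 + (\<Sum>j\<in>UNIV. lk m j)"
    by (simp add: lookup_add lookup_single when_def sum.distrib)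
  ultimately show "int (\<Sum>j\<in>UNIV. lk m j) = d - 1" by (simp only: of_nat_add of_nat_1)
qed

lemma xv_nonzero [simp]: "xv i \<noteq> 0"
  using xv_power_reg0[of i 1 1] by auto

lemma power_times_divide: "c \<noteq> 0 \<Longrightarrow> c ^ m * b = c ^ (2 + m) * (b / c ^ 2)" for b c :: "'a::field"
  by (simp add: power_add power2_eq_square)

context smooth_plane_curve
begin

text \<open>All sufficiently large exponents are admissible in the denominator, so several regular
  functions can be given the same one.\<close>

lemma R_common:
  assumes "f \<in> R I d"
  shows "\<exists>k. \<forall>l\<ge>k. \<exists>P. f = emb P / emb (\<Prod>i\<in>I. pd G i) ^ l \<and> homog (d + int l * int (card I) * (int n - 1)) P"
proof -
  from assms obtain P k where P: "f = emb P / emb (\<Prod>i\<in>I. pd G i) ^ k"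
    "homog (d + int k * int (card I) * (int n - 1)) P" by (rule R_E)
  have "\<exists>Q. f = emb Q / emb (\<Prod>i\<in>I. pd G i) ^ l \<and> homog (d + int l * int (card I) * (int n - 1)) Q"
    if "k \<le> l" for l
    using P(2) that by (rule R_raise) (use P(1) in auto)
  then show ?thesis by blast
qed

text \<open>Over a common denominator the relation becomes x_j P = x_i Q, and x_i divides P because
  distinct variables are coprime.\<close>

lemma R_divide_xv:
  assumes "a \<in> R I d" "c \<in> R I d" "i \<noteq> j" "emb (xv j) * a = emb (xv i) * c"
  shows "a / emb (xv i) \<in> R I (d - 1)"
proof -
  let ?g = "\<Prod>i\<in>I. pd G i"
  from R_common[OF assms(1)] obtain k where k:
    "\<forall>l\<ge>k. \<exists>P. a = emb P / emb ?g ^ l \<and> homog (d + int l * int (card I) * (int n - 1)) P" by (elim exE)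
  from R_common[OF assms(2)] obtain k' where k':
    "\<forall>l\<ge>k'. \<exists>P. c = emb P / emb ?g ^ l \<and> homog (d + int l * int (card I) * (int n - 1)) P" by (elim exE)
  define l where "l = max k k'"
  have "k \<le> l" "k' \<le> l" by (simp_all add: l_def)
  from k[rule_format, OF this(1)] obtain P where
    P: "a = emb P / emb ?g ^ l" "homog (d + int l * int (card I) * (int n - 1)) P" by (elim exE conjE)
  from k'[rule_format, OF \<open>k' \<le> l\<close>] obtain Q where
    Q: "c = emb Q / emb ?g ^ l" "homog (d + int l * int (card I) * (int n - 1)) Q" by (elim exE conjE)
  have "emb (xv j) * emb P = emb (xv i) * emb Q" using assms(4) unfolding P(1) Q(1) by simp
  then have "emb (xv j * P) = emb (xv i * Q)" by (simp only: emb_simps)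
  then have "xv j ^ 1 * P = xv i ^ 1 * Q" by (simp only: emb_eq_iff power_one_right)
  then obtain u where u: "P = xv i ^ 1 * u" using xv_power_reg1 assms(3) by (elim exE[OF xv_power_reg1])
  then have "homog (d + int l * int (card I) * (int n - 1) - 1) u" using P(2) homog_xv_cancel by simp
  then have "homog (d - 1 + int l * int (card I) * (int n - 1)) u" by (simp only: diff_add_eq)
  from R_I[OF this] show ?thesis unfolding P(1) u by simp
qed

text \<open>The identification of the sheaf of two-forms on the plane with O(-3). Vanishing
  contraction gives x_0 a = x_2 c, so a / x_2 is regular; the other components follow by cancelling
  x_2.\<close>

lemma Om_2_multiple_of_Omega:
  assumes "\<eta> \<in> Om 2 I"
  shows "\<exists>f\<in>R I (- 3). \<eta> = f *s Omega_vol"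
proof -
  define a b c where "a = \<eta> $ {0, 1}" and "b = \<eta> $ {0, 2}" and "c = \<eta> $ {1, 2}"
  have \<eta>C: "\<eta> \<in> C 2 0 I" and ce: "contract euler \<eta> = 0" using assms by (simp_all add: Om_iff)
  have R: "a \<in> R I (- 2)" "c \<in> R I (- 2)"
    using C_D(1)[OF \<eta>C, of "{0, 1}"] C_D(1)[OF \<eta>C, of "{1, 2}"] by (simp_all add: a_def c_def)
  have "contract euler \<eta> $ {0} = 0" "contract euler \<eta> $ {1} = 0" unfolding ce by simp_all
  then have ab: "emb (xv 1) * a = - emb (xv 2) * b" and ac: "emb (xv 0) * a = emb (xv 2) * c"
    by (simp_all add: contract_component euler_component a_def b_def c_def eq_neg_iff_add_eq_0 neg_eq_iff_add_eq_0 add.commute)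
  define f where "f = a / emb (xv 2)"
  have "f \<in> R I (- 2 - 1)" unfolding f_def by (rule R_divide_xv[OF R _ ac]) simp
  then have f: "f \<in> R I (- 3)" by simp
  have x2: "emb (xv 2) \<noteq> 0" by simp
  have fa: "a = emb (xv 2) * f" by (simp add: f_def)
  have "emb (xv 2) * b = - (emb (xv 1) * a)" by (simp add: ab)
  also have "\<dots> = emb (xv 2) * (- emb (xv 1) * f)" by (simp add: fa)
  finally have "emb (xv 2) * b = emb (xv 2) * (- emb (xv 1) * f)" .
  then have fb: "b = - emb (xv 1) * f" using x2 by (simp only: mult_cancel_left simp_thms)
  have "emb (xv 2) * c = emb (xv 2) * (emb (xv 0) * f)" using ac by (simp add: fa)
  then have fc: "c = emb (xv 0) * f" using x2 by (simp only: mult_cancel_left simp_thms)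
  have z: "\<eta> $ {} = 0" "\<eta> $ {0} = 0" "\<eta> $ {1} = 0" "\<eta> $ {2} = 0" "\<eta> $ {0, 1, 2} = 0"
    by (rule C_D(2)[OF \<eta>C], simp)+
  have "\<eta> = f *s Omega_vol"
    unfolding form_eq_iff all_3set
    by (simp add: z Omega_vol_component fa[unfolded a_def] fb[unfolded b_def] fc[unfolded c_def] mult.commute)
  with f show ?thesis by (intro bexI[of _ f])
qed

abbreviation "I2 \<equiv> ideal3 ((pd G 0)\<^sup>2) ((pd G 1)\<^sup>2) ((pd G 2)\<^sup>2)"

text \<open>Equal classes make (F - F') / (G_0 G_1 G_2)^2 an alternating sum of functions f_ij with
  powers of G_i G_j as denominators. Multiplication by (G_0 G_1 G_2)^(2 + m) turns f_ij into a
  multiple of the (2 + m)-th power of the remaining partial derivative, and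
  \<open>colon_powers\<close> with k = 2 removes the surplus factor.\<close>

lemma top_difference_mem:
  assumes F: "homog (6 * int n - 9) F" and eq: "H2_P2 n G (top_cochain G F) = H2_P2 n G (top_cochain G F')"
  shows "F - F' \<in> I2"
proof -
  let ?g0 = "pd G 0" and ?g1 = "pd G 1" and ?g2 = "pd G 2"
  have prod: "(\<Prod>i\<in>{0, 1, 2}. pd G i) = ?g0 * ?g1 * ?g2" by (simp add: mult.assoc)
  \<comment> \<open>The equality of classes is used through an element. Since 6n - 9 = 6(n - 1) - 3,
    the coefficient of \<Omega> has degree -3 and the cochain represents its own class.\<close>
  have "top_cochain G F \<in> cochains 2 (Om 2)"
  proof -
    have "homog (- 3 + int 2 * int (card {0, 1, 2 :: 3}) * (int n - 1)) F" using F by (simp add: algebra_simps)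
    from R_I[OF this] have "emb F / emb (?g0 * ?g1 * ?g2) ^ 2 \<in> R {0, 1, 2} (- 3)" unfolding prod by simp
    from C_scale[OF this C_Omega] have "(emb F / emb (?g0 * ?g1 * ?g2) ^ 2) *s Omega_vol \<in> Om 2 {0, 1, 2}"
      by (simp add: Om_iff contract_smult contract_euler_Omega)
    then show ?thesis by (simp add: cochains_def top_cochain_def idx_2)
  qed
  moreover have "0 \<in> cochains 1 (Om 2)" by (simp add: cochains_def)
  moreover have "cech_d 1 0 = 0" by (rule ext) (simp add: cech_d_def vec_eq_iff)
  then have "top_cochain G F - top_cochain G F - cech_d 1 0 \<in> cochains 2 (\<lambda>_. {0})"
    unfolding cochains_def by simp
  ultimately have "top_cochain G F \<in> H2_P2 n G (top_cochain G F)"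
    unfolding H2_iff by (intro conjI bexI[of _ 0])
  then have "top_cochain G F \<in> H2_P2 n G (top_cochain G F')" by (simp only: eq)
  then obtain \<psi> where \<psi>: "\<psi> \<in> cochains 1 (Om 2)"
    and d: "top_cochain G F - top_cochain G F' - cech_d 1 \<psi> \<in> cochains 2 (\<lambda>_. {0})"
    unfolding H2_iff by (elim conjE bexE)
  have "\<psi> [0, 1] \<in> Om 2 {0, 1}" "\<psi> [0, 2] \<in> Om 2 {0, 2}" "\<psi> [1, 2] \<in> Om 2 {1, 2}"
    using cochainsD[OF \<psi>, of "[0, 1]"] cochainsD[OF \<psi>, of "[0, 2]"] cochainsD[OF \<psi>, of "[1, 2]"]
    unfolding idx_1 by simp_all
  note f = this[THEN Om_2_multiple_of_Omega]
  from f(1) obtain f01 where f01: "f01 \<in> R {0, 1} (- 3)" "\<psi> [0, 1] = f01 *s Omega_vol" by (elim bexE)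
  from f(2) obtain f02 where f02: "f02 \<in> R {0, 2} (- 3)" "\<psi> [0, 2] = f02 *s Omega_vol" by (elim bexE)
  from f(3) obtain f12 where f12: "f12 \<in> R {1, 2} (- 3)" "\<psi> [1, 2] = f12 *s Omega_vol" by (elim bexE)
  have "(top_cochain G F - top_cochain G F' - cech_d 1 \<psi>) [0, 1, 2] \<in> {0}"
    using cochainsD[OF d, of "[0, 1, 2]"] unfolding idx_2 by simp
  then have "(emb F / emb (?g0 * ?g1 * ?g2) ^ 2) *s Omega_vol - (emb F' / emb (?g0 * ?g1 * ?g2) ^ 2) *s Omega_vol
      - (f12 *s Omega_vol - f02 *s Omega_vol + f01 *s Omega_vol) = 0"
    unfolding fun_diff_def cech_d_1 f01 f02 f12 top_cochain_def idx_2 by simp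
  \<comment> \<open>One component suffices to compare the coefficients, since that of \<Omega> at
    {0, 1} is x_2, which is not 0.\<close>
  then have "((emb F / emb (?g0 * ?g1 * ?g2) ^ 2) *s Omega_vol - (emb F' / emb (?g0 * ?g1 * ?g2) ^ 2) *s Omega_vol
      - (f12 *s Omega_vol - f02 *s Omega_vol + f01 *s Omega_vol)) $ {0, 1} = 0" by simp
  then have "(emb F / emb (?g0 * ?g1 * ?g2) ^ 2 - emb F' / emb (?g0 * ?g1 * ?g2) ^ 2 - (f12 - f02 + f01)) * emb (xv 2) = 0"
    by (simp only: vector_minus_component vector_add_component vector_smult_component Omega_vol_component
        left_diff_distrib distrib_right)
  moreover have "emb (xv 2) \<noteq> 0" by simp
  ultimately have "emb F / emb (?g0 * ?g1 * ?g2) ^ 2 - emb F' / emb (?g0 * ?g1 * ?g2) ^ 2 - (f12 - f02 + f01) = 0"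
    by (simp only: mult_eq_0_iff simp_thms)
  then have rel: "emb (F - F') / emb (?g0 * ?g1 * ?g2) ^ 2 = f12 - f02 + f01"
    by (simp add: diff_divide_distrib)
  from R_common[OF f01(1)] obtain k01 where k01: "\<forall>l\<ge>k01. \<exists>P. f01 = emb P / emb (\<Prod>i\<in>{0, 1}. pd G i) ^ l
      \<and> homog (- 3 + int l * int (card {0, 1 :: 3}) * (int n - 1)) P" by (elim exE)
  from R_common[OF f02(1)] obtain k02 where k02: "\<forall>l\<ge>k02. \<exists>P. f02 = emb P / emb (\<Prod>i\<in>{0, 2}. pd G i) ^ l
      \<and> homog (- 3 + int l * int (card {0, 2 :: 3}) * (int n - 1)) P" by (elim exE)
  from R_common[OF f12(1)] obtain k12 where k12: "\<forall>l\<ge>k12. \<exists>P. f12 = emb P / emb (\<Prod>i\<in>{1, 2}. pd G i) ^ l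
      \<and> homog (- 3 + int l * int (card {1, 2 :: 3}) * (int n - 1)) P" by (elim exE)
  \<comment> \<open>The sum bounds all three exponents at once; the summand 2 in 2 + m is the
    exponent that survives the cancellation.\<close>
  define m where "m = k01 + k02 + k12"
  have le: "k01 \<le> 2 + m" "k02 \<le> 2 + m" "k12 \<le> 2 + m" by (simp_all add: m_def)
  from k01[rule_format, OF le(1)] obtain P01 where P01: "f01 = emb P01 / emb (?g0 * ?g1) ^ (2 + m)"
    by (elim exE conjE) (simp del: power_add emb_simps)
  from k02[rule_format, OF le(2)] obtain P02 where P02: "f02 = emb P02 / emb (?g0 * ?g2) ^ (2 + m)"
    by (elim exE conjE) (simp del: power_add emb_simps)
  from k12[rule_format, OF le(3)] obtain P12 where P12: "f12 = emb P12 / emb (?g1 * ?g2) ^ (2 + m)"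
    by (elim exE conjE) (simp del: power_add emb_simps)
  have nz: "emb ?g0 \<noteq> 0" "emb ?g1 \<noteq> 0" "emb ?g2 \<noteq> 0" by simp_all
  have "emb ((?g0 * ?g1 * ?g2) ^ m * (F - F'))
      = emb (?g0 * ?g1 * ?g2) ^ (2 + m) * (emb (F - F') / emb (?g0 * ?g1 * ?g2) ^ 2)"
    unfolding emb_simps(4)[of "_ ^ m"] emb_power by (rule power_times_divide) simp
  also have "\<dots> = emb (?g0 * ?g1 * ?g2) ^ (2 + m) * f12 - emb (?g0 * ?g1 * ?g2) ^ (2 + m) * f02
      + emb (?g0 * ?g1 * ?g2) ^ (2 + m) * f01"
    unfolding rel by (simp only: right_diff_distrib distrib_left)
  also have "emb (?g0 * ?g1 * ?g2) ^ (2 + m) * f12 = emb (P12 * ?g0 ^ (2 + m))"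
    using nz unfolding P12 emb_simps(4) power_mult_distrib emb_power by (simp add: field_simps)
  also have "emb (?g0 * ?g1 * ?g2) ^ (2 + m) * f02 = emb (P02 * ?g1 ^ (2 + m))"
    using nz unfolding P02 emb_simps(4) power_mult_distrib emb_power by (simp add: field_simps)
  also have "emb (?g0 * ?g1 * ?g2) ^ (2 + m) * f01 = emb (P01 * ?g2 ^ (2 + m))"
    using nz unfolding P01 emb_simps(4) power_mult_distrib emb_power by (simp add: field_simps)
  finally have "emb ((?g0 * ?g1 * ?g2) ^ m * (F - F'))
      = emb (P12 * ?g0 ^ (2 + m) + (- P02) * ?g1 ^ (2 + m) + P01 * ?g2 ^ (2 + m))"
    by (simp only: emb_simps mult_minus_left add_uminus_conv_diff)
  then have "(?g0 * ?g1 * ?g2) ^ m * (F - F') = P12 * ?g0 ^ (2 + m) + (- P02) * ?g1 ^ (2 + m) + P01 * ?g2 ^ (2 + m)"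
    by (simp only: emb_eq_iff)
  then have "(?g0 * ?g1 * ?g2) ^ m * (F - F') \<in> ideal3 (?g0 ^ (2 + m)) (?g1 ^ (2 + m)) (?g2 ^ (2 + m))"
    unfolding ideal3_def by (intro CollectI exI conjI TrueI)
  then show ?thesis by (rule colon_powers[OF irrelevant_pdG])
qed

lemma squares_sum_iff: "(\<exists>a :: 3 \<Rightarrow> cpoly. X = (\<Sum>i\<in>UNIV. a i * (pd G i)\<^sup>2)) \<longleftrightarrow> X \<in> I2"
proof
  assume "\<exists>a. X = (\<Sum>i\<in>UNIV. a i * (pd G i)\<^sup>2)"
  then obtain a :: "3 \<Rightarrow> cpoly" where "X = a 0 * (pd G 0)\<^sup>2 + a 1 * (pd G 1)\<^sup>2 + a 2 * (pd G 2)\<^sup>2"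
    unfolding sum_three by (elim exE)
  then show "X \<in> I2" unfolding ideal3_def by (intro CollectI exI conjI TrueI)
next
  assume "X \<in> I2"
  then obtain u v w where X: "X = u * (pd G 0)\<^sup>2 + v * (pd G 1)\<^sup>2 + w * (pd G 2)\<^sup>2"
    unfolding ideal3_def by (elim CollectE exE conjE)
  show "\<exists>a. X = (\<Sum>i\<in>UNIV. a i * (pd G i)\<^sup>2)"
    unfolding sum_three X by (rule exI[of _ "\<lambda>i. if i = 0 then u else if i = 1 then v else w"]) simp
qed

text \<open>The ideal contains F - F', so the two definite descriptions have the same
  predicate.\<close>

lemma R_num_cong:
  assumes "F - F' \<in> I2"
  shows "R_num G F = R_num G F'"
proof -
  note D = is_idealD[OF is_ideal_ideal3]
  have "F - X \<in> I2 \<longleftrightarrow> F' - X \<in> I2" for X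
  proof
    assume "F - X \<in> I2"
    from D(6)[OF this assms] show "F' - X \<in> I2" by simp
  next
    assume "F' - X \<in> I2"
    from D(2)[OF assms this] show "F - X \<in> I2" by simp
  qed
  then show ?thesis unfolding R_num_def squares_sum_iff by (simp only:)
qed

text \<open>The class determines F modulo the ideal of the squares, and \<open>R_num\<close> is
  constant on such residue classes; hence the description has only one value.\<close>

lemma Res0_top_cochain:
  assumes "homog (6 * int n - 9) F"
  shows "Res0 n G (H2_P2 n G (top_cochain G F)) = R_num G F"
  unfolding Res0_def
proof (rule the_equality)
  show "\<exists>F'. homog (6 * int n - 9) F' \<and> H2_P2 n G (top_cochain G F) = H2_P2 n G (top_cochain G F') \<and> R_num G F = R_num G F'"
    using assms by (intro exI[of _ F] conjI refl)
  fix r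
  assume "\<exists>F'. homog (6 * int n - 9) F' \<and> H2_P2 n G (top_cochain G F) = H2_P2 n G (top_cochain G F') \<and> r = R_num G F'"
  then obtain F' where "H2_P2 n G (top_cochain G F) = H2_P2 n G (top_cochain G F')" "r = R_num G F'"
    by (elim exE conjE)
  then show "r = R_num G F" using R_num_cong[OF top_difference_mem[OF assms]] by simp
qed

end

text \<open>Here x, y, z are the variables, the g's the partial derivatives, r and s the
  coefficients R of the two relations, and U, V, W stand for U_0, U_1, U_2. The left side is, up to
  sign, the numerator of the coboundary of the lifted Massey cochain.\<close>

lemma massey_identity:
  fixes x y z :: "'a::comm_ring_1"
  assumes p: "U * V = r0 * g0 + r1 * g1 + r2 * g2" and q: "V * W = s0 * g0 + s1 * g1 + s2 * g2"
  shows "W * g2 * ((- x * r2 + z * r0) * x * g0^2 + (y * r2 - z * r1) * y * g1^2 + (y * r2 - z * r1) * z * g1 * g2)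
      + U * g0 * ((x * s1 - y * s0) * x * g0 * g1 + (x * s1 - y * s0) * y * g1^2 + (- x * s2 + z * s0) * z * g2^2)
      = - ((x * g0 + y * g1 + z * g2)
        * (U * y * s0 * g0 * g1 + W * x * r2 * g0 * g2 + U * x * s0 * g0^2
          - ((y * r2 - z * r1) * W * g1 * g2 + U * (- x * s2 + z * s0) * g0 * g2 + U * V * W * x * g0)))"
    (is "?L = - (?E * (?A - (?B1 + ?B2 + U * V * W * x * g0)))")
proof -
  have UVW: "U * V * W * x * g0 = U * (s0 * g0 + s1 * g1 + s2 * g2) * x * g0"
    using q by (simp only: mult.assoc[of U V W])
  \<comment> \<open>U V W expanded through \<open>p\<close> and through \<open>q\<close>. The two
    sides of the claim differ by a multiple of the difference of these expansions.\<close>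
  have eq: "W * (r0 * g0 + r1 * g1 + r2 * g2) = U * (s0 * g0 + s1 * g1 + s2 * g2)"
    unfolding p[symmetric] q[symmetric] by (simp add: mult_ac)
  have "?L + ?E * (?A - (?B1 + ?B2 + U * (s0 * g0 + s1 * g1 + s2 * g2) * x * g0))
      = x * z * g0 * g2 * (W * (r0 * g0 + r1 * g1 + r2 * g2) - U * (s0 * g0 + s1 * g1 + s2 * g2))"
    by (simp add: algebra_simps power2_eq_square)
  also have "\<dots> = 0" unfolding eq by simp
  finally show ?thesis unfolding UVW by (simp only: eq_neg_iff_add_eq_0)
qed

section \<open>The Massey product\<close>

lemma homog_A_coef:
  assumes "\<And>i. homog d (r i)"
  shows "homog (1 + d) (A_coef r i)"
  unfolding A_coef_def
  using homog_mult[OF homog_xv assms] by (simp add: homog_diff homog_add homog_uminus)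

context smooth_plane_curve
begin

lemma R_K_op_K_op: "K_op j (K_op i Omega_vol) $ {} \<in> R I 1"
proof -
  have x: "emb (xv j) \<in> R I 1" for j by (intro R_poly homog_xv)
  have "\<forall>i j. K_op j (K_op i Omega_vol) $ {} \<in> R I 1"
    unfolding all_three by (simp add: K_op_def form_components axis_def x R_uminus)
  then show ?thesis by simp
qed

text \<open>The coefficient of \<Omega>_k on the intersection of indices i and j in the two
  products, with k = i for the product of W_01 and W_2 and k = j for that of W_0 and W_12. The last
  factor is the scalar \<Omega>_ij.\<close>

definition massey_coeff :: "cpoly \<Rightarrow> (3 \<Rightarrow> cpoly) \<Rightarrow> 3 \<Rightarrow> 3 \<Rightarrow> 3 \<Rightarrow> ratfun" where
  "massey_coeff U r k i j = (emb (A_coef r k) / emb (pd G k) ^ 2) * (emb U / emb (pd G i * pd G j))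
     * K_op j (K_op i Omega_vol) $ {}"

lemma massey_coeff_regular:
  assumes U: "homog (2 * int n - 3) U" and r: "\<And>i. homog (2 * int n - 5) (r i)"
    and "i \<in> I" "j \<in> I" "k \<in> I"
  shows "massey_coeff U r k i j \<in> R I (- 2)"
proof -
  have "emb (A_coef r k) * (1 / emb (pd G k) * (1 / emb (pd G k))) * (emb U * (1 / emb (pd G i) * (1 / emb (pd G j))))
      * K_op j (K_op i Omega_vol) $ {}
    \<in> R I ((1 + (2 * int n - 5)) + ((1 - int n) + (1 - int n)) + ((2 * int n - 3) + ((1 - int n) + (1 - int n))) + 1)"
    by (intro R_mult R_poly R_inverse R_K_op_K_op homog_A_coef assms)
  then show ?thesis by (simp add: massey_coeff_def power2_eq_square)
qed

text \<open>The product with W_12 carries the sign (-1)^(1 * 1), which cancels the minus sign in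
  W_12; so both products have the same shape.\<close>

lemma cup_components:
  assumes "s \<in> idx 1"
  shows "bullet 0 (0, 1) (W_kl G r) (W_0form G U) s
      = massey_coeff U r (s ! 0) (s ! 0) (s ! 1) *s K_op (s ! 0) Omega_vol"
    and "bullet 1 (1, 0) (W_0form G U) (- W_kl G r) s
      = massey_coeff U r (s ! 1) (s ! 0) (s ! 1) *s K_op (s ! 1) Omega_vol"
proof -
  have "length s = 2" using assms by (simp add: idx_def)
  then obtain i j where s: "s = [i, j]" by (auto simp: length_Suc_conv numeral_eq_Suc)
  have i: "[i] \<in> idx 0" "[j] \<in> idx 0" by (simp_all add: idx_def)
  have ij: "[i, j] \<in> idx (0 + 1)" "[i, j] \<in> idx (1 + 0)" "[i, j] \<in> idx 1" using assms s by simp_all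
  have zr: "wedge \<gamma> (K_op j (K_op i Omega_vol)) = (K_op j (K_op i Omega_vol) $ {}) *s \<gamma>" for \<gamma>
    by (rule wedge_zero_form_right) (rule K_op_K_op_Omega)
  have zl: "wedge (K_op j (K_op i Omega_vol)) \<gamma> = (K_op j (K_op i Omega_vol) $ {}) *s \<gamma>" for \<gamma>
    by (rule wedge_zero_form_left) (rule K_op_K_op_Omega)
  show "bullet 0 (0, 1) (W_kl G r) (W_0form G U) s
      = massey_coeff U r (s ! 0) (s ! 0) (s ! 1) *s K_op (s ! 0) Omega_vol"
  proof -
    have "bullet 0 (0, 1) (W_kl G r) (W_0form G U) [i, j] = wedge (W_kl G r [i]) (W_0form G U [i, j])"
      using ij(1) by (simp add: bullet_def)
    also have "\<dots> = ((emb (A_coef r i) / emb (pd G i) ^ 2) * (emb U / emb (pd G i * pd G j)))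
        *s wedge (K_op i Omega_vol) (K_op j (K_op i Omega_vol))"
      using i(1) ij(3) by (simp only: W_kl_def W_0form_def if_True wedge_smult_left wedge_smult_right vector_smult_assoc
          nth_Cons_0 nth_Cons_Suc One_nat_def mult.commute)
    finally show ?thesis unfolding s zr by (simp add: massey_coeff_def vector_smult_assoc)
  qed
  show "bullet 1 (1, 0) (W_0form G U) (- W_kl G r) s
      = massey_coeff U r (s ! 1) (s ! 0) (s ! 1) *s K_op (s ! 1) Omega_vol"
  proof -
    have "bullet 1 (1, 0) (W_0form G U) (- W_kl G r) [i, j] = (- 1) *s wedge (W_0form G U [i, j]) ((- 1) *s W_kl G r [j])"
      using ij(2) by (simp add: bullet_def uminus_form[symmetric])
    also have "\<dots> = wedge (W_0form G U [i, j]) (W_kl G r [j])"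
      unfolding wedge_smult_right vector_smult_assoc by simp
    also have "\<dots> = ((emb U / emb (pd G i * pd G j)) * (emb (A_coef r j) / emb (pd G j) ^ 2))
        *s wedge (K_op j (K_op i Omega_vol)) (K_op j Omega_vol)"
      using i(2) ij(3) by (simp only: W_kl_def W_0form_def if_True wedge_smult_left wedge_smult_right vector_smult_assoc
          nth_Cons_0 nth_Cons_Suc One_nat_def mult.commute)
    finally show ?thesis unfolding s zl by (simp add: massey_coeff_def vector_smult_assoc mult_ac)
  qed
qed

lemma massey_eq_R_num:
  assumes U0: "homog (2 * int n - 3) U0" and U1: "homog (int n - 3) U1" and U2: "homog (2 * int n - 3) U2"
    and r: "\<And>i. homog (2 * int n - 5) (r i)" and s: "\<And>i. homog (2 * int n - 5) (s i)"
    and p: "U0 * U1 = (\<Sum>i\<in>UNIV. r i * pd G i)" and q: "U1 * U2 = (\<Sum>i\<in>UNIV. s i * pd G i)"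
    and A: "A = U0 * xv 1 * s 0 * pd G 0 * pd G 1 + U2 * xv 0 * r 2 * pd G 0 * pd G 2 + U0 * xv 0 * s 0 * (pd G 0)\<^sup>2"
    and B: "B = A_coef r 0 * U2 * pd G 1 * pd G 2 + U0 * A_coef s 1 * pd G 0 * pd G 2 + U0 * U1 * U2 * xv 0 * pd G 0"
  shows "massey n G (W_0form G U0) (W_1form G U1) (W_0form G U2) (W_kl G r) (- W_kl G s) = R_num G (of_nat n * (A - B))"
proof -
  define \<phi> where "\<phi> = bullet 0 (0, 1) (W_kl G r) (W_0form G U2) + bullet 1 (1, 0) (W_0form G U0) (- W_kl G s)"
  define c where "c = (\<lambda>i j. massey_coeff U2 r i i j)"
  define c' where "c' = (\<lambda>i j. massey_coeff U0 s j i j)"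
  \<comment> \<open>The two summands are multiples of \<Omega>_i and \<Omega>_j for the first and
    the second index, and each is lifted by \<open>log_lift_Omega\<close>.\<close>
  define \<omega> :: cochain where "\<omega> = (\<lambda>t. if t \<in> idx 1 then
    - (c (t ! 0) (t ! 1) * emb (pd G (t ! 0)) / emb G) *s Omega_vol
    + - (c' (t ! 0) (t ! 1) * emb (pd G (t ! 1)) / emb G) *s Omega_vol else 0)"
  have conn: "connecting n G (H1_X n G \<phi>) = H2_P2 n G (cech_d 1 \<omega>)"
  proof (rule connecting_eq)
    show "\<phi> t = 0" if "t \<notin> idx 1" for t using that by (simp add: \<phi>_def bullet_def)
    show "\<omega> t = 0" if "t \<notin> idx 1" for t using that by (simp add: \<omega>_def)
    show "ld (set t) (\<omega> t) (\<phi> t)" if t: "t \<in> idx 1" for t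
    proof -
      have "length t = 2" using t by (simp add: idx_def)
      then have m: "t ! 0 \<in> set t" "t ! 1 \<in> set t" by (simp_all add: nth_mem)
      have "\<phi> t = c (t ! 0) (t ! 1) *s K_op (t ! 0) Omega_vol + c' (t ! 0) (t ! 1) *s K_op (t ! 1) Omega_vol"
        unfolding \<phi>_def plus_fun_apply cup_components[OF t] c_def c'_def by (rule refl)
      moreover have "\<omega> t = - (c (t ! 0) (t ! 1) * emb (pd G (t ! 0)) / emb G) *s Omega_vol
          + - (c' (t ! 0) (t ! 1) * emb (pd G (t ! 1)) / emb G) *s Omega_vol"
        using t by (simp only: \<omega>_def if_True)
      moreover have "c (t ! 0) (t ! 1) \<in> R (set t) (- 2)" "c' (t ! 0) (t ! 1) \<in> R (set t) (- 2)"
        unfolding c_def c'_def by (intro massey_coeff_regular U0 U2 r s m)+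
      ultimately show ?thesis by (simp only: ld_add log_lift_Omega)
    qed
  qed
  define F where "F = of_nat n * (A - B)"
  have hom: "homog (6 * int n - 9) F"
  proof -
    have Ac: "homog (1 + (2 * int n - 5)) (A_coef r i)" "homog (1 + (2 * int n - 5)) (A_coef s i)" for i
      by (intro homog_A_coef r s)+
    note h = homog_mult homog_xv homog_pdG U0 U1 U2 r s Ac
    have "homog (2 * int n - 3 + 1 + (2 * int n - 5) + (int n - 1) + (int n - 1)) (U0 * xv 1 * s 0 * pd G 0 * pd G 1)"
      "homog (2 * int n - 3 + 1 + (2 * int n - 5) + (int n - 1) + (int n - 1)) (U2 * xv 0 * r 2 * pd G 0 * pd G 2)"
      "homog (2 * int n - 3 + 1 + (2 * int n - 5) + (int n - 1) + (int n - 1)) (U0 * xv 0 * s 0 * pd G 0 * pd G 0)"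
      "homog (1 + (2 * int n - 5) + (2 * int n - 3) + (int n - 1) + (int n - 1)) (A_coef r 0 * U2 * pd G 1 * pd G 2)"
      "homog (2 * int n - 3 + (1 + (2 * int n - 5)) + (int n - 1) + (int n - 1)) (U0 * A_coef s 1 * pd G 0 * pd G 2)"
      "homog (2 * int n - 3 + (int n - 3) + (2 * int n - 3) + 1 + (int n - 1)) (U0 * U1 * U2 * xv 0 * pd G 0)"
      by (intro h)+
    then have "homog (6 * int n - 9) (A - B)"
      unfolding A B power2_eq_square by (intro homog_diff homog_add) (simp_all add: algebra_simps)
    from homog_mult[OF homog_of_nat this] show ?thesis by (simp add: F_def)
  qed
  have "cech_d 1 \<omega> = top_cochain G F"
  proof (rule cech_d_1_eqI)
    let ?g0 = "emb (pd G 0)" and ?g1 = "emb (pd G 1)" and ?g2 = "emb (pd G 2)"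
    let ?x = "emb (xv 0)" and ?y = "emb (xv 1)" and ?z = "emb (xv 2)"
    have nz: "?g0 \<noteq> 0" "?g1 \<noteq> 0" "?g2 \<noteq> 0" "emb G \<noteq> 0" by simp_all
    have e: "of_nat n * emb G = ?x * ?g0 + ?y * ?g1 + ?z * ?g2"
      using arg_cong[OF euler_pd[OF homG], of emb] by (simp add: sum_three)
    \<comment> \<open>Over the denominator G (G_0 G_1 G_2)^2 the coboundary has numerator -N. The
      terms with x_1 are positive because \<Omega>_02 = -x_1 meets the minus sign of the
      coboundary.\<close>
    define N where "N = emb U2 * ?g2 * (emb (A_coef r 1) * ?x * ?g0^2 + emb (A_coef r 0) * ?y * ?g1^2 + emb (A_coef r 0) * ?z * ?g1 * ?g2)
      + emb U0 * ?g0 * (emb (A_coef s 2) * ?x * ?g0 * ?g1 + emb (A_coef s 2) * ?y * ?g1^2 + emb (A_coef s 1) * ?z * ?g2^2)"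
    have p': "emb U0 * emb U1 = emb (r 0) * ?g0 + emb (r 1) * ?g1 + emb (r 2) * ?g2"
      using arg_cong[OF p, of emb] by (simp add: sum_three)
    have q': "emb U1 * emb U2 = emb (s 0) * ?g0 + emb (s 1) * ?g1 + emb (s 2) * ?g2"
      using arg_cong[OF q, of emb] by (simp add: sum_three)
    have "N = - ((?x * ?g0 + ?y * ?g1 + ?z * ?g2) * emb (A - B))"
      using massey_identity[OF p' q', of ?x ?z ?y]
      by (simp add: N_def A B A_coef_def)
    \<comment> \<open>The Euler sum is n G: the factor n goes into F, and G cancels the
      pole.\<close>
    also have "\<dots> = - (emb G * emb F)" unfolding e[symmetric] F_def by simp
    finally have N: "N = - (emb G * emb F)" .
    have idx: "[0, 1] \<in> idx 1" "[0, 2] \<in> idx 1" "[1, 2] \<in> idx 1" unfolding idx_1 by simp_all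
    define h where "h = (\<lambda>i j. - (c i j * emb (pd G i) / emb G) + - (c' i j * emb (pd G j) / emb G))"
    have \<omega>h: "\<omega> [0, 1] = h 0 1 *s Omega_vol" "\<omega> [0, 2] = h 0 2 *s Omega_vol" "\<omega> [1, 2] = h 1 2 *s Omega_vol"
      using idx by (simp_all only: \<omega>_def h_def if_True vector_sadd_rdistrib nth_Cons_0 nth_Cons_Suc One_nat_def)
    have "h 1 2 - h 0 2 + h 0 1 = - N / (emb G * (?g0 * ?g1 * ?g2) ^ 2)"
      using nz by (simp add: h_def c_def c'_def massey_coeff_def K_op_K_op_Omega_component N_def field_simps power2_eq_square)
    also have "\<dots> = emb F / emb (pd G 0 * pd G 1 * pd G 2) ^ 2"
      unfolding N using nz by simp
    finally have h: "h 1 2 - h 0 2 + h 0 1 = emb F / emb (pd G 0 * pd G 1 * pd G 2) ^ 2" .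
    have "\<omega> [1, 2] - \<omega> [0, 2] + \<omega> [0, 1] = (h 1 2 - h 0 2 + h 0 1) *s Omega_vol"
      unfolding \<omega>h by (simp only: vector_sadd_rdistrib vector_sub_rdistrib)
    then show "\<omega> [1, 2] - \<omega> [0, 2] + \<omega> [0, 1] = top_cochain G F [0, 1, 2]"
      unfolding h top_cochain_def idx_2 by simp
    show "top_cochain G F t = 0" if "t \<noteq> [0, 1, 2]" for t using that by (simp add: top_cochain_def idx_2)
  qed
  with conn have conn': "connecting n G (H1_X n G \<phi>) = H2_P2 n G (top_cochain G F)" by (simp only:)
  have "massey n G (W_0form G U0) (W_1form G U1) (W_0form G U2) (W_kl G r) (- W_kl G s) = R_num G F"
    unfolding massey_def \<phi>_def[symmetric] conn' by (rule Res0_top_cochain[OF hom])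
  then show ?thesis unfolding F_def .
qed

end

theorem theorem3p1:
  fixes n :: nat and G U0 U1 U2 :: cpoly and R01 R12 :: "3 \<Rightarrow> cpoly"
  assumes "n \<ge> 2"
    and "homog (int n) G"
    and "smooth_curve G"
    and "homog (2 * int n - 3) U0"
    and "homog (int n - 3) U1"
    and "homog (2 * int n - 3) U2"
    and "\<And>i. homog (2 * int n - 5) (R01 i)"
    and "\<And>i. homog (2 * int n - 5) (R12 i)"
    and "U0 * U1 = (\<Sum>i\<in>UNIV. R01 i * pd G i)"
    and "U1 * U2 = (\<Sum>i\<in>UNIV. R12 i * pd G i)"
  shows "let G0 = pd G 0; G1 = pd G 1; G2 = pd G 2;
             A = U0 * xv 1 * R12 0 * G0 * G1 + U2 * xv 0 * R01 2 * G0 * G2 + U0 * xv 0 * R12 0 * G0\<^sup>2;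
             B = A_coef R01 0 * U2 * G1 * G2 + U0 * A_coef R12 1 * G0 * G2 + U0 * U1 * U2 * xv 0 * G0
         in massey n G (W_0form G U0) (W_1form G U1) (W_0form G U2) (W_kl G R01) (- W_kl G R12)
              = R_num G (of_nat n * (A - B))"
proof -
  interpret smooth_plane_curve n G by unfold_locales (fact assms)+
  show ?thesis unfolding Let_def by (rule massey_eq_R_num[OF assms(4-10) refl refl])
qed

end
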